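(* Let $\psi$ be a doubly-robust functional satisfying the regularity conditions in the context, in a locally nonparametric model, and let $\hat\theta=(\hat b,\hat p,\vartheta)$ with $\hat b\in\mathcal B$, $\hat p\in\mathcal P$ fixed functions (computed from an independent training sample). Let $\tilde\psi_k(\theta)$ be the truncated parameter defined in the context. Then, under $P_{\hat\theta}$, for every $m\ge2$ the $m$-th order influence function of $\tilde\psi_k(\theta)$ is $$\widehat{\mathbb{IF}}_{m,k}(\Sigma_k^{-1})=\widehat{\mathbb{IF}}_1-\widehat{\mathbb{IF}}_{22\to mm,k}(\Sigma_k^{-1}),\qquad \widehat{\mathbb{IF}}_{22\to mm,k}(\Sigma_k^{-1})=\sum_{j=2}^m\widehat{\mathbb{IF}}_{jj,k}(\Sigma_k^{-1}),$$ where $\widehat{\mathbb{IF}}_1=\frac1n\sum_{i=1}^n\{\mathcal H_i(\hat b,\hat p)-\psi(\hat\theta)\}$ and $$\widehat{\mathbb{IF}}_{jj,k}(\Sigma_k^{-1})=\frac{(n-j)!}{n!}\sum_{1\le i_1\ne\cdots\ne i_j\le n}\widehat{\mathrm{IF}}_{jj,k,\bar i_j}(\Sigma_k^{-1}),\quad j\ge2,$$ $$\widehat{\mathrm{IF}}_{22,k,\bar i_2}(\Sigma_k^{-1})=[\mathcal E_{\hat b,m_2}(\bar z_k)(O)]_{i_1}^\top\Sigma_k^{-1}[\mathcal E_{\hat p,m_1}(\bar z_k)(O)]_{i_2},$$ and for $j>2$ $$\widehat{\mathrm{IF}}_{jj,k,\bar i_j}(\Sigma_k^{-1})=(-1)^j[\mathcal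 E_{\hat b,m_2}(\bar z_k)(O)]_{i_1}^\top\Big\{\prod_{s=3}^j\Sigma_k^{-1}\big([S_{bp}\bar z_k(X)\bar z_k(X)^\top]_{i_s}-\Sigma_k\big)\Big\}\Sigma_k^{-1}[\mathcal E_{\hat p,m_1}(\bar z_k)(O)]_{i_2}.$$ As a consequence, $\widehat{\mathbb{IF}}_{22\to mm,k}(\Sigma_k^{-1})$ is the $m$-th order influence function of $\mathrm{Bias}_{\theta,k}(\hat\psi_1)$ under $P_{\hat\theta}$.
   Context: **DR functionals.** An observation $O=(W,X)$ has law $P_\theta$ in a model $\{P_\theta:\theta=(b,p,\vartheta)\in\Theta=\mathcal B\times\mathcal P\times\mathcal T\}$ with $b,p,\vartheta$ variation independent, which is locally nonparametric (the tangent space at each $\theta$ is all mean-zero elements of $L_2(P_\theta)$). $X$ has marginal law $P_F$; $b,p$ are bounded real functions of $x$. The functional $\psi(\theta)$ has a first-order influence function $\mathrm{IF}_{1,\psi}(\theta)$ and is *doubly robust (DR)*: there is a known statistic $S_{bp}=s_{bp}(O)$, not depending on $\theta$, with $S_{bp}\ge0$ a.s., such that for all $\theta,\theta'$ (with nuisances $b,p$ and $b',p'$), $\psi(\theta')-\psi(\theta)+E_\theta[\mathrm{IF}_{1,\psi}(\theta')]=E_\theta[S_{bp}(b(X)-b'(X))(p(X)-p'(X))]$. Let $\lambda(x)=E_\theta[S_{bp}\mid X=x]$, bounded away from $0$ and $\infty$. Regularity conditions: there is a dense set $\mathcal H_b\subset L_2(P_F)$ with $\mathcal H_b\cap\mathcal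 B\ne\emptyset$ such that for each $\theta$ and $h\in\mathcal H_b$ one has $b+th\in\mathcal B$ for all small $|t|$; likewise $\mathcal H_p$ for $p,\mathcal P$; $E_\theta|S_{bp}p(X)h(X)|<\infty$ for $h\in\mathcal H_b$, $E_\theta|S_{bp}b(X)h(X)|<\infty$ for $h\in\mathcal H_p$, $E_\theta|S_{bp}b'(X)p'(X)|<\infty$ for $b'\in\mathcal B,p'\in\mathcal P$; and $b,p,\lambda b,\lambda p\in L_2(P_F)$. Known consequence (Rotnitzky et al.): there are a statistic $S_0$ and linear maps $h\mapsto m_1(O,h)$, $h\mapsto m_2(O,h)$, independent of $\theta$, with $\mathrm{IF}_{1,\psi}(\theta)=\mathcal H(b,p)-\psi(\theta)$, $\mathcal H(b,p)=S_{bp}b(X)p(X)+m_1(O,b)+m_2(O,p)+S_0$. It is further supposed that $h\mapsto E_\theta[m_j(O,h)]$, $j=1,2$, are continuous linear on $L_2(P_F)$, and then $E_\theta[S_{bp}hp+m_1(O,h)]=0=E_\theta[S_{bp}bh+m_2(O,h)]$ for $h\in L_2(P_F)$ and all $\theta\in\Theta$. **Truncated parameter.** $\bar z_k=(z_1,\dots,z_k)^\top$ is a vector of $k$ fixed functions in $L_2(P_F)$; $\Sigma_k=\Sigma_k(\theta)=E_\theta[S_{bp}\bar z_k(X)\bar z_k(X)^\top]$, assumed invertible; when an influence function is taken under a law $P_{\theta_0}$, the symbol $\Sigma_k$ appearing in it is the Gram matrix under that law. $m_j(O,\bar z_k)$ is componentwise. Put $\tilde\zeta_{b,k}(\theta)=-\Sigma_k^{-1}E_\theta[S_{bp}\hat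 b(X)\bar z_k(X)+m_2(O,\bar z_k)]$, $\tilde\zeta_{p,k}(\theta)=-\Sigma_k^{-1}E_\theta[S_{bp}\hat p(X)\bar z_k(X)+m_1(O,\bar z_k)]$, $\tilde b_{k,\theta}=\hat b+\tilde\zeta_{b,k}(\theta)^\top\bar z_k$, $\tilde p_{k,\theta}=\hat p+\tilde\zeta_{p,k}(\theta)^\top\bar z_k$, and $\tilde\psi_k(\theta)=E_\theta[\mathcal H(\tilde b_{k,\theta},\tilde p_{k,\theta})]$. With $\hat\psi_1=\frac1n\sum_{i=1}^n\mathcal H_i(\hat b,\hat p)$ ($O_1,\dots,O_n$ i.i.d., $\hat b,\hat p$ held fixed), $\mathrm{Bias}_{\theta,k}(\hat\psi_1)=E_\theta[\hat\psi_1-\tilde\psi_k(\theta)]$. For functions $b',p'$ and $h$: $\mathcal E_{b',m_2}(h)(O)=S_{bp}b'(X)h(X)+m_2(O,h)$, $\mathcal E_{p',m_1}(h)(O)=S_{bp}p'(X)h(X)+m_1(O,h)$, componentwise for vector-valued $h$. $[\cdot]_i$ means evaluation at $O_i$; sums over $i_1\ne\cdots\ne i_j$ are over distinct indices; $\bar i_j=(i_1,\dots,i_j)$. **Higher-order influence functions.** For a functional $\phi(\theta)$ with first-order influence function $\mathrm{if}_{1,\phi}(O;\theta)$ (mean zero, finite variance, representing pathwise derivatives), define $\mathbb{IF}_1(\theta)=\mathbb{IF}_{11}(\theta)=\frac1n\sum_i\mathrm{if}_{1,\phi}(O_i;\theta)$, and recursively for $m\ge2$, $\mathbb{IF}_m(\theta)=\mathbb{IF}_{m-1}(\theta)+\mathbb{IF}_{mm}(\theta)$,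 where $m\,\mathbb{IF}_{mm}(\theta)$ is the $m$-th order degenerate U-statistic component in the Hoeffding decomposition (under $P_\theta$) of $\frac{(n-m)!}{n!}\sum_{i_1\ne\cdots\ne i_m}\mathrm{if}_{1,\mathrm{if}_{m-1,m-1}(O_{i_1},\dots,O_{i_{m-1}};\cdot)}(O_{i_m};\theta)$; here $\mathrm{if}_{m-1,m-1}(o_{1},\dots,o_{m-1};\theta)$ is the kernel of the U-statistic $\mathbb{IF}_{m-1,m-1}(\theta)$, and $\mathrm{if}_{1,\mathrm{if}_{m-1,m-1}(o_1,\dots,o_{m-1};\cdot)}(\cdot;\theta)$ is the first-order influence function of the functional $\theta\mapsto\mathrm{if}_{m-1,m-1}(o_1,\dots,o_{m-1};\theta)$ for fixed $o_1,\dots,o_{m-1}$. $\mathbb{IF}_m(\theta)$ is the $m$-th order influence function; "under $P_{\hat\theta}$" means evaluated at $\theta=\hat\theta$.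
   Formalization: Added: H(b̂,p̂), E_{b̂,m2}(z̄_k), E_{p̂,m1}(z̄_k) and S_bp z̄_k z̄_k^T have finite variance under every P_θ (else the kernels may have infinite variance). Pathwise derivatives are along submodels with L2-differentiable likelihood ratio; m ≤ n. *)

theory Defs
  imports "HOL-Probability.Probability"
begin

section \<open>Square-integrable functions\<close>

text \<open>Elements of $L_2$ are handled as functions, not as equivalence classes.\<close>

definition L2 :: "'a measure \<Rightarrow> ('a \<Rightarrow> real) set" where
  "L2 M = {f \<in> borel_measurable M. integrable M (\<lambda>x. (f x)\<^sup>2)}"

definition L2_norm :: "'a measure \<Rightarrow> ('a \<Rightarrow> real) \<Rightarrow> real" where
  "L2_norm M f = sqrt (\<integral>x. (f x)\<^sup>2 \<partial>M)"

definition dense_in_L2 :: "'a measure \<Rightarrow> ('a \<Rightarrow> real) set \<Rightarrow> bool" where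
  "dense_in_L2 M H \<longleftrightarrow> H \<subseteq> L2 M \<and>
     (\<forall>f\<in>L2 M. \<forall>\<epsilon>>0. \<exists>h\<in>H. L2_norm M (\<lambda>x. f x - h x) < \<epsilon>)"


section \<open>Regular submodels and first-order influence functions\<close>

text \<open>
  A model is a family of laws \<open>P \<theta>\<close>, \<open>\<theta> \<in> \<Theta>\<close>.  A one-dimensional regular submodel through
  \<open>\<theta>\<close> is a path \<open>\<gamma>\<close> in \<open>\<Theta>\<close>, defined near 0, whose likelihood ratios
  \<open>q t = dP (\<gamma> t) / dP \<theta>\<close> exist, lie in $L_2(P_\theta)$ and are differentiable at \<open>t = 0\<close>
  in $L_2(P_\theta)$; the derivative is the score \<open>g\<close>.  This is smoother than differentiability in
  quadratic mean, under which expectations of unbounded square-integrable statistics need not be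
  differentiable along the path.
\<close>

definition regular_submodel ::
  "('t \<Rightarrow> 'o measure) \<Rightarrow> 't set \<Rightarrow> 't \<Rightarrow> (real \<Rightarrow> 't) \<Rightarrow> ('o \<Rightarrow> real) \<Rightarrow> bool" where
  "regular_submodel P \<Theta> \<theta> \<gamma> g \<longleftrightarrow>
     \<gamma> 0 = \<theta> \<and> (\<forall>\<^sub>F t in nhds 0. \<gamma> t \<in> \<Theta>) \<and> g \<in> L2 (P \<theta>) \<and>
     (\<exists>q :: real \<Rightarrow> 'o \<Rightarrow> real.
        (\<forall>\<^sub>F t in nhds 0. q t \<in> L2 (P \<theta>) \<and> (\<forall>x. 0 \<le> q t x) \<and>
           P (\<gamma> t) = density (P \<theta>) (\<lambda>x. ennreal (q t x))) \<and>
        ((\<lambda>t. L2_norm (P \<theta>) (\<lambda>x. (q t x - 1) / t - g x)) \<longlongrightarrow> 0) (at 0))"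

definition scores :: "('t \<Rightarrow> 'o measure) \<Rightarrow> 't set \<Rightarrow> 't \<Rightarrow> ('o \<Rightarrow> real) set" where
  "scores P \<Theta> \<theta> = {g. \<exists>\<gamma>. regular_submodel P \<Theta> \<theta> \<gamma> g}"

text \<open>The tangent space is the closed linear span of the scores in $L_2(P_\theta)$.\<close>

definition tangent_space :: "('t \<Rightarrow> 'o measure) \<Rightarrow> 't set \<Rightarrow> 't \<Rightarrow> ('o \<Rightarrow> real) set" where
  "tangent_space P \<Theta> \<theta> =
     {f \<in> L2 (P \<theta>). \<forall>\<epsilon>>0. \<exists>(N::nat) c g. (\<forall>i<N. g i \<in> scores P \<Theta> \<theta>) \<and>
        L2_norm (P \<theta>) (\<lambda>x. f x - (\<Sum>i<N. c i * g i x)) < \<epsilon>}"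

definition locally_nonparametric :: "('t \<Rightarrow> 'o measure) \<Rightarrow> 't set \<Rightarrow> bool" where
  "locally_nonparametric P \<Theta> \<longleftrightarrow>
     (\<forall>\<theta>\<in>\<Theta>. tangent_space P \<Theta> \<theta> = {f \<in> L2 (P \<theta>). (\<integral>x. f x \<partial>P \<theta>) = 0})"

definition influence_function ::
  "('t \<Rightarrow> 'o measure) \<Rightarrow> 't set \<Rightarrow> ('t \<Rightarrow> real) \<Rightarrow> 't \<Rightarrow> ('o \<Rightarrow> real) \<Rightarrow> bool" where
  "influence_function P \<Theta> \<phi> \<theta> f \<longleftrightarrow>
     f \<in> L2 (P \<theta>) \<and> (\<integral>x. f x \<partial>P \<theta>) = 0 \<and>
     (\<forall>\<gamma> g. regular_submodel P \<Theta> \<theta> \<gamma> g \<longrightarrow>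
        ((\<lambda>t. \<phi> (\<gamma> t)) has_real_derivative (\<integral>x. f x * g x \<partial>P \<theta>)) (at 0))"


section \<open>U-statistics and higher-order influence functions\<close>

text \<open>
  Samples and arguments of kernels are extensional functions on \<open>{1..n}\<close>, resp. \<open>{1..j}\<close>, i.e.
  points of the product space \<open>Pi\<^sub>M {1..n} (\<lambda>_. Q)\<close>.
\<close>

definition ustat :: "nat \<Rightarrow> nat \<Rightarrow> ((nat \<Rightarrow> 'o) \<Rightarrow> real) \<Rightarrow> (nat \<Rightarrow> 'o) \<Rightarrow> real" where
  "ustat n j K \<omega> = fact (n - j) / fact n *
     (\<Sum>i \<in> {i \<in> {1..j} \<rightarrow>\<^sub>E {1..n}. inj_on i {1..j}}. K (\<lambda>s\<in>{1..j}. \<omega> (i s)))"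

definition sym_kernel :: "nat \<Rightarrow> ((nat \<Rightarrow> 'o) \<Rightarrow> real) \<Rightarrow> (nat \<Rightarrow> 'o) \<Rightarrow> real" where
  "sym_kernel j K v = (\<Sum>\<pi> | \<pi> permutes {1..j}. K (\<lambda>s\<in>{1..j}. v (\<pi> s))) / fact j"

text \<open>
  Kernel of the order-\<open>j\<close> completely degenerate term in the Hoeffding decomposition under \<open>Q\<close> of the
  U-statistic with kernel \<open>K\<close>: the signed sum over \<open>S\<close> of the conditional expectations of the
  symmetrized kernel given the coordinates in \<open>S\<close>.
\<close>

definition degenerate_kernel ::
  "'o measure \<Rightarrow> nat \<Rightarrow> ((nat \<Rightarrow> 'o) \<Rightarrow> real) \<Rightarrow> (nat \<Rightarrow> 'o) \<Rightarrow> real" where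
  "degenerate_kernel Q j K v =
     (\<Sum>S\<in>Pow {1..j}. (-1) ^ (j - card S) *
        (\<integral>w. sym_kernel j K (\<lambda>s\<in>{1..j}. if s \<in> S then v s else w s) \<partial>(Pi\<^sub>M {1..j} (\<lambda>_. Q))))"

text \<open>
  \<open>K j \<theta>\<close> is the (symmetric) kernel of the \<open>j\<close>-th term of the influence function at \<open>\<theta>\<close>.
  Influence functions are determined only up to null sets, whereas the recursion differentiates
  \<open>\<theta> \<mapsto> K (j - 1) \<theta> v\<close> at a fixed point \<open>v\<close>; hence \<open>K\<close> is a choice of versions for all \<open>\<theta> \<in> \<Theta>\<close>
  at once.
\<close>

definition hoif_kernels ::
  "('t \<Rightarrow> 'o measure) \<Rightarrow> 't set \<Rightarrow> ('t \<Rightarrow> real) \<Rightarrow> nat \<Rightarrow>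
   (nat \<Rightarrow> 't \<Rightarrow> (nat \<Rightarrow> 'o) \<Rightarrow> real) \<Rightarrow> bool" where
  "hoif_kernels P \<Theta> \<phi> m K \<longleftrightarrow>
     (\<forall>\<theta>\<in>\<Theta>. influence_function P \<Theta> \<phi> \<theta> (\<lambda>x. K 1 \<theta> (\<lambda>s\<in>{1..1}. x))) \<and>
     (\<forall>j\<in>{2..m}. \<exists>D. \<forall>\<theta>\<in>\<Theta>.
        (\<forall>v \<in> space (Pi\<^sub>M {1..j - 1} (\<lambda>_. P \<theta>)).
           influence_function P \<Theta> (\<lambda>\<theta>'. K (j - 1) \<theta>' v) \<theta> (\<lambda>x. D \<theta> (v(j := x)))) \<and>
        D \<theta> \<in> L2 (Pi\<^sub>M {1..j} (\<lambda>_. P \<theta>)) \<and>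
        (\<forall>v \<in> space (Pi\<^sub>M {1..j} (\<lambda>_. P \<theta>)).
           real j * K j \<theta> v = degenerate_kernel (P \<theta>) j (D \<theta>) v))"

text \<open>\<open>U\<close> is the order-\<open>m\<close> influence function of \<open>\<phi>\<close> at \<open>\<theta>\<close>, for samples of size \<open>n\<close>.\<close>

definition higher_order_influence_function ::
  "('t \<Rightarrow> 'o measure) \<Rightarrow> 't set \<Rightarrow> nat \<Rightarrow> ('t \<Rightarrow> real) \<Rightarrow> nat \<Rightarrow> 't \<Rightarrow> ((nat \<Rightarrow> 'o) \<Rightarrow> real) \<Rightarrow> bool"
  where
  "higher_order_influence_function P \<Theta> n \<phi> m \<theta> U \<longleftrightarrow>
     (\<exists>K. hoif_kernels P \<Theta> \<phi> m K \<and>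
        (AE \<omega> in Pi\<^sub>M {1..n} (\<lambda>_. P \<theta>). U \<omega> = (\<Sum>j=1..m. ustat n j (K j \<theta>) \<omega>)))"


section \<open>Doubly robust functionals\<close>

text \<open>An observation is a pair \<open>(w, x)\<close>, so \<open>X = snd\<close>; \<open>marginal MX Q\<close> is the law of \<open>X\<close> under \<open>Q\<close>.\<close>

definition marginal :: "'x measure \<Rightarrow> ('w \<times> 'x) measure \<Rightarrow> 'x measure" where
  "marginal MX Q = distr Q MX snd"

definition Hstat ::
  "('w \<times> 'x \<Rightarrow> real) \<Rightarrow> ('w \<times> 'x \<Rightarrow> ('x \<Rightarrow> real) \<Rightarrow> real) \<Rightarrow>
   ('w \<times> 'x \<Rightarrow> ('x \<Rightarrow> real) \<Rightarrow> real) \<Rightarrow> ('w \<times> 'x \<Rightarrow> real) \<Rightarrow>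
   ('x \<Rightarrow> real) \<Rightarrow> ('x \<Rightarrow> real) \<Rightarrow> 'w \<times> 'x \<Rightarrow> real" where
  "Hstat S m1 m2 S0 b p y = S y * b (snd y) * p (snd y) + m1 y b + m2 y p + S0 y"

type_synonym ('x, 'c) param = "('x \<Rightarrow> real) \<times> ('x \<Rightarrow> real) \<times> 'c"

locale dr_model =
  fixes MW :: "'w measure" and MX :: "'x measure"
    and P :: "('x, 'c) param \<Rightarrow> ('w \<times> 'x) measure"
    and B :: "('x \<Rightarrow> real) set" and PP :: "('x \<Rightarrow> real) set" and T :: "'c set"
  assumes prob_P: "\<theta> \<in> B \<times> PP \<times> T \<Longrightarrow> prob_space (P \<theta>)"
    and sets_P: "\<theta> \<in> B \<times> PP \<times> T \<Longrightarrow> sets (P \<theta>) = sets (MW \<Otimes>\<^sub>M MX)"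
    and locally_nonparametric: "locally_nonparametric P (B \<times> PP \<times> T)"
    and measurable_nuisance: "f \<in> B \<union> PP \<Longrightarrow> f \<in> borel_measurable MX"
    and bounded_nuisance: "f \<in> B \<union> PP \<Longrightarrow> \<exists>C. \<forall>x\<in>space MX. \<bar>f x\<bar> \<le> C"

locale dr_functional = dr_model MW MX P B PP T
  for MW :: "'w measure" and MX :: "'x measure"
    and P :: "('x, 'c) param \<Rightarrow> ('w \<times> 'x) measure"
    and B :: "('x \<Rightarrow> real) set" and PP :: "('x \<Rightarrow> real) set" and T :: "'c set" +
  fixes \<psi> :: "('x, 'c) param \<Rightarrow> real"
    and IF1 :: "('x, 'c) param \<Rightarrow> 'w \<times> 'x \<Rightarrow> real"
    and S :: "'w \<times> 'x \<Rightarrow> real"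
    and lam :: "('x, 'c) param \<Rightarrow> 'x \<Rightarrow> real"
  assumes influence_function_psi:
      "\<theta> \<in> B \<times> PP \<times> T \<Longrightarrow> influence_function P (B \<times> PP \<times> T) \<psi> \<theta> (IF1 \<theta>)"
    and measurable_S: "S \<in> borel_measurable (MW \<Otimes>\<^sub>M MX)"
    and S_nonneg: "\<theta> \<in> B \<times> PP \<times> T \<Longrightarrow> AE y in P \<theta>. 0 \<le> S y"
    and S_integrable: "\<theta> \<in> B \<times> PP \<times> T \<Longrightarrow> integrable (P \<theta>) S"
    and IF1_integrable:
      "\<theta> \<in> B \<times> PP \<times> T \<Longrightarrow> \<theta>' \<in> B \<times> PP \<times> T \<Longrightarrow> integrable (P \<theta>) (IF1 \<theta>')"
    and doubly_robust:
      "(b, p, c) \<in> B \<times> PP \<times> T \<Longrightarrow> (b', p', c') \<in> B \<times> PP \<times> T \<Longrightarrow>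
       \<psi> (b', p', c') - \<psi> (b, p, c) + (\<integral>y. IF1 (b', p', c') y \<partial>P (b, p, c)) =
       (\<integral>y. S y * (b (snd y) - b' (snd y)) * (p (snd y) - p' (snd y)) \<partial>P (b, p, c))"
    and measurable_lam: "\<theta> \<in> B \<times> PP \<times> T \<Longrightarrow> lam \<theta> \<in> borel_measurable MX"
    and lam_cond_exp:
      "\<theta> \<in> B \<times> PP \<times> T \<Longrightarrow>
       AE y in P \<theta>. real_cond_exp (P \<theta>) (vimage_algebra (space (MW \<Otimes>\<^sub>M MX)) snd MX) S y
                      = lam \<theta> (snd y)"
    and lam_bounds:
      "\<theta> \<in> B \<times> PP \<times> T \<Longrightarrow>
       \<exists>c>0. \<exists>C. AE x in marginal MX (P \<theta>). c \<le> lam \<theta> x \<and> lam \<theta> x \<le> C"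

locale regular_dr_functional = dr_functional MW MX P B PP T \<psi> IF1 S lam
  for MW :: "'w measure" and MX :: "'x measure"
    and P :: "('x, 'c) param \<Rightarrow> ('w \<times> 'x) measure"
    and B :: "('x \<Rightarrow> real) set" and PP :: "('x \<Rightarrow> real) set" and T :: "'c set"
    and \<psi> :: "('x, 'c) param \<Rightarrow> real"
    and IF1 :: "('x, 'c) param \<Rightarrow> 'w \<times> 'x \<Rightarrow> real"
    and S :: "'w \<times> 'x \<Rightarrow> real"
    and lam :: "('x, 'c) param \<Rightarrow> 'x \<Rightarrow> real" +
  fixes Hb :: "('x \<Rightarrow> real) set" and Hp :: "('x \<Rightarrow> real) set"
  assumes Hb_dense: "\<theta> \<in> B \<times> PP \<times> T \<Longrightarrow> dense_in_L2 (marginal MX (P \<theta>)) Hb"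
    and Hp_dense: "\<theta> \<in> B \<times> PP \<times> T \<Longrightarrow> dense_in_L2 (marginal MX (P \<theta>)) Hp"
    and Hb_meets: "Hb \<inter> B \<noteq> {}"
    and Hp_meets: "Hp \<inter> PP \<noteq> {}"
    and Hb_perturb: "b \<in> B \<Longrightarrow> h \<in> Hb \<Longrightarrow> \<forall>\<^sub>F t::real in nhds 0. (\<lambda>x. b x + t * h x) \<in> B"
    and Hp_perturb: "p \<in> PP \<Longrightarrow> h \<in> Hp \<Longrightarrow> \<forall>\<^sub>F t::real in nhds 0. (\<lambda>x. p x + t * h x) \<in> PP"
    and Hb_integrable:
      "(b, p, c) \<in> B \<times> PP \<times> T \<Longrightarrow> h \<in> Hb \<Longrightarrow>
       integrable (P (b, p, c)) (\<lambda>y. S y * p (snd y) * h (snd y))"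
    and Hp_integrable:
      "(b, p, c) \<in> B \<times> PP \<times> T \<Longrightarrow> h \<in> Hp \<Longrightarrow>
       integrable (P (b, p, c)) (\<lambda>y. S y * b (snd y) * h (snd y))"
    and BP_integrable:
      "\<theta> \<in> B \<times> PP \<times> T \<Longrightarrow> b' \<in> B \<Longrightarrow> p' \<in> PP \<Longrightarrow>
       integrable (P \<theta>) (\<lambda>y. S y * b' (snd y) * p' (snd y))"
    and nuisance_L2:
      "(b, p, c) \<in> B \<times> PP \<times> T \<Longrightarrow> f \<in> {b, p} \<Longrightarrow> f \<in> L2 (marginal MX (P (b, p, c)))"
    and lam_nuisance_L2:
      "(b, p, c) \<in> B \<times> PP \<times> T \<Longrightarrow> f \<in> {b, p} \<Longrightarrow>
       (\<lambda>x. lam (b, p, c) x * f x) \<in> L2 (marginal MX (P (b, p, c)))"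

text \<open>
  \<open>continuous_linear_statistic MX Q m\<close>: \<open>h \<mapsto> m O h\<close> is almost surely linear on $L_2$ of the
  marginal law of \<open>X\<close> under \<open>Q\<close>, and \<open>h \<mapsto> E\<^sub>Q (m O h)\<close> is a continuous (= bounded) linear functional.
\<close>

definition continuous_linear_statistic ::
  "'x measure \<Rightarrow> ('w \<times> 'x) measure \<Rightarrow> ('w \<times> 'x \<Rightarrow> ('x \<Rightarrow> real) \<Rightarrow> real) \<Rightarrow> bool" where
  "continuous_linear_statistic MX Q m \<longleftrightarrow>
     (\<forall>g\<in>L2 (marginal MX Q). \<forall>h\<in>L2 (marginal MX Q). \<forall>a c :: real.
        AE y in Q. m y (\<lambda>x. a * g x + c * h x) = a * m y g + c * m y h) \<and>
     (\<forall>h\<in>L2 (marginal MX Q). integrable Q (\<lambda>y. m y h)) \<and>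
     (\<exists>C. \<forall>h\<in>L2 (marginal MX Q). \<bar>\<integral>y. m y h \<partial>Q\<bar> \<le> C * L2_norm (marginal MX Q) h)"

locale linear_dr_functional = regular_dr_functional MW MX P B PP T \<psi> IF1 S lam Hb Hp
  for MW :: "'w measure" and MX :: "'x measure"
    and P :: "('x, 'c) param \<Rightarrow> ('w \<times> 'x) measure"
    and B :: "('x \<Rightarrow> real) set" and PP :: "('x \<Rightarrow> real) set" and T :: "'c set"
    and \<psi> :: "('x, 'c) param \<Rightarrow> real"
    and IF1 :: "('x, 'c) param \<Rightarrow> 'w \<times> 'x \<Rightarrow> real"
    and S :: "'w \<times> 'x \<Rightarrow> real"
    and lam :: "('x, 'c) param \<Rightarrow> 'x \<Rightarrow> real"
    and Hb :: "('x \<Rightarrow> real) set" and Hp :: "('x \<Rightarrow> real) set" +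
  fixes m1 :: "'w \<times> 'x \<Rightarrow> ('x \<Rightarrow> real) \<Rightarrow> real"
    and m2 :: "'w \<times> 'x \<Rightarrow> ('x \<Rightarrow> real) \<Rightarrow> real"
    and S0 :: "'w \<times> 'x \<Rightarrow> real"
  assumes measurable_S0: "S0 \<in> borel_measurable (MW \<Otimes>\<^sub>M MX)"
    and m1_linear: "\<theta> \<in> B \<times> PP \<times> T \<Longrightarrow> continuous_linear_statistic MX (P \<theta>) m1"
    and m2_linear: "\<theta> \<in> B \<times> PP \<times> T \<Longrightarrow> continuous_linear_statistic MX (P \<theta>) m2"
    and IF1_form:
      "\<theta> \<in> B \<times> PP \<times> T \<Longrightarrow> (b, p, c) \<in> B \<times> PP \<times> T \<Longrightarrow>
       AE y in P \<theta>. IF1 (b, p, c) y = Hstat S m1 m2 S0 b p y - \<psi> (b, p, c)"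


section \<open>The truncated parameter\<close>

text \<open>
  \<open>Ecal S f m h\<close> is $\mathcal E_{f,m}(h)$.  The vector of basis functions is \<open>z :: 'x \<Rightarrow> real ^ 'k\<close>,
  and \<open>Ecal_vec\<close> applies \<open>Ecal\<close> componentwise.
\<close>

definition Ecal ::
  "('w \<times> 'x \<Rightarrow> real) \<Rightarrow> ('x \<Rightarrow> real) \<Rightarrow> ('w \<times> 'x \<Rightarrow> ('x \<Rightarrow> real) \<Rightarrow> real) \<Rightarrow>
   ('x \<Rightarrow> real) \<Rightarrow> 'w \<times> 'x \<Rightarrow> real" where
  "Ecal S f m h y = S y * f (snd y) * h (snd y) + m y h"

definition Ecal_vec ::
  "('w \<times> 'x \<Rightarrow> real) \<Rightarrow> ('x \<Rightarrow> real) \<Rightarrow> ('w \<times> 'x \<Rightarrow> ('x \<Rightarrow> real) \<Rightarrow> real) \<Rightarrow>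
   ('x \<Rightarrow> real ^ 'k) \<Rightarrow> 'w \<times> 'x \<Rightarrow> real ^ 'k" where
  "Ecal_vec S f m z y = (\<chi> i. Ecal S f m (\<lambda>x. z x $ i) y)"

definition Szz ::
  "('w \<times> 'x \<Rightarrow> real) \<Rightarrow> ('x \<Rightarrow> real ^ 'k) \<Rightarrow> 'w \<times> 'x \<Rightarrow> real ^ 'k ^ 'k" where
  "Szz S z y = (\<chi> i j. S y * z (snd y) $ i * z (snd y) $ j)"

definition gram ::
  "('w \<times> 'x) measure \<Rightarrow> ('w \<times> 'x \<Rightarrow> real) \<Rightarrow> ('x \<Rightarrow> real ^ 'k) \<Rightarrow> real ^ 'k ^ 'k" where
  "gram Q S z = (\<integral>y. Szz S z y \<partial>Q)"

text \<open>
  With \<open>(f, m) = (b\<^sub>0, m2)\<close> the next two are $\tilde\zeta_{b,k}$ and $\tilde b_k$ under the law \<open>Q\<close>; with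
  \<open>(f, m) = (p\<^sub>0, m1)\<close> they are $\tilde\zeta_{p,k}$ and $\tilde p_k$.
\<close>

definition zeta ::
  "('w \<times> 'x) measure \<Rightarrow> ('w \<times> 'x \<Rightarrow> real) \<Rightarrow> ('x \<Rightarrow> real) \<Rightarrow>
   ('w \<times> 'x \<Rightarrow> ('x \<Rightarrow> real) \<Rightarrow> real) \<Rightarrow> ('x \<Rightarrow> real ^ 'k) \<Rightarrow> real ^ 'k" where
  "zeta Q S f m z = - (matrix_inv (gram Q S z) *v (\<integral>y. Ecal_vec S f m z y \<partial>Q))"

definition truncated_nuisance ::
  "('w \<times> 'x) measure \<Rightarrow> ('w \<times> 'x \<Rightarrow> real) \<Rightarrow> ('x \<Rightarrow> real) \<Rightarrow>
   ('w \<times> 'x \<Rightarrow> ('x \<Rightarrow> real) \<Rightarrow> real) \<Rightarrow> ('x \<Rightarrow> real ^ 'k) \<Rightarrow> 'x \<Rightarrow> real" where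
  "truncated_nuisance Q S f m z x = f x + zeta Q S f m z \<bullet> z x"

text \<open>\<open>b\<^sub>0\<close>, \<open>p\<^sub>0\<close> are the initial estimates $\hat b$, $\hat p$, held fixed.\<close>

definition psi_trunc ::
  "('w \<times> 'x \<Rightarrow> real) \<Rightarrow> ('w \<times> 'x \<Rightarrow> ('x \<Rightarrow> real) \<Rightarrow> real) \<Rightarrow>
   ('w \<times> 'x \<Rightarrow> ('x \<Rightarrow> real) \<Rightarrow> real) \<Rightarrow> ('w \<times> 'x \<Rightarrow> real) \<Rightarrow>
   ('x \<Rightarrow> real) \<Rightarrow> ('x \<Rightarrow> real) \<Rightarrow> ('x \<Rightarrow> real ^ 'k) \<Rightarrow> ('w \<times> 'x) measure \<Rightarrow> real" where
  "psi_trunc S m1 m2 S0 b\<^sub>0 p\<^sub>0 z Q =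
     (\<integral>y. Hstat S m1 m2 S0 (truncated_nuisance Q S b\<^sub>0 m2 z) (truncated_nuisance Q S p\<^sub>0 m1 z) y \<partial>Q)"

definition psi_hat1 ::
  "('w \<times> 'x \<Rightarrow> real) \<Rightarrow> ('w \<times> 'x \<Rightarrow> ('x \<Rightarrow> real) \<Rightarrow> real) \<Rightarrow>
   ('w \<times> 'x \<Rightarrow> ('x \<Rightarrow> real) \<Rightarrow> real) \<Rightarrow> ('w \<times> 'x \<Rightarrow> real) \<Rightarrow>
   ('x \<Rightarrow> real) \<Rightarrow> ('x \<Rightarrow> real) \<Rightarrow> nat \<Rightarrow> (nat \<Rightarrow> 'w \<times> 'x) \<Rightarrow> real" where
  "psi_hat1 S m1 m2 S0 b\<^sub>0 p\<^sub>0 n \<omega> = (1 / real n) * (\<Sum>i=1..n. Hstat S m1 m2 S0 b\<^sub>0 p\<^sub>0 (\<omega> i))"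

definition trunc_bias ::
  "('w \<times> 'x \<Rightarrow> real) \<Rightarrow> ('w \<times> 'x \<Rightarrow> ('x \<Rightarrow> real) \<Rightarrow> real) \<Rightarrow>
   ('w \<times> 'x \<Rightarrow> ('x \<Rightarrow> real) \<Rightarrow> real) \<Rightarrow> ('w \<times> 'x \<Rightarrow> real) \<Rightarrow>
   ('x \<Rightarrow> real) \<Rightarrow> ('x \<Rightarrow> real) \<Rightarrow> ('x \<Rightarrow> real ^ 'k) \<Rightarrow> nat \<Rightarrow> ('w \<times> 'x) measure \<Rightarrow> real" where
  "trunc_bias S m1 m2 S0 b\<^sub>0 p\<^sub>0 z n Q =
     (\<integral>\<omega>. psi_hat1 S m1 m2 S0 b\<^sub>0 p\<^sub>0 n \<omega> - psi_trunc S m1 m2 S0 b\<^sub>0 p\<^sub>0 z Q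
        \<partial>(Pi\<^sub>M {1..n} (\<lambda>_. Q)))"


section \<open>The influence function of the truncated parameter\<close>

definition IF1_hat ::
  "('w \<times> 'x \<Rightarrow> real) \<Rightarrow> ('w \<times> 'x \<Rightarrow> ('x \<Rightarrow> real) \<Rightarrow> real) \<Rightarrow>
   ('w \<times> 'x \<Rightarrow> ('x \<Rightarrow> real) \<Rightarrow> real) \<Rightarrow> ('w \<times> 'x \<Rightarrow> real) \<Rightarrow>
   ('x \<Rightarrow> real) \<Rightarrow> ('x \<Rightarrow> real) \<Rightarrow> real \<Rightarrow> nat \<Rightarrow> (nat \<Rightarrow> 'w \<times> 'x) \<Rightarrow> real" where
  "IF1_hat S m1 m2 S0 b\<^sub>0 p\<^sub>0 r n \<omega> =
     (1 / real n) * (\<Sum>i=1..n. Hstat S m1 m2 S0 b\<^sub>0 p\<^sub>0 (\<omega> i) - r)"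

text \<open>
  Kernel of order \<open>j \<ge> 2\<close> with Gram matrix \<open>G\<close>.  The matrix product is ordered, \<open>s = 3, \<dots>, j\<close> from
  left to right; for \<open>j = 2\<close> it is empty, and the sign is \<open>1\<close>.
\<close>

definition IFjj_kernel ::
  "('w \<times> 'x \<Rightarrow> real) \<Rightarrow> ('w \<times> 'x \<Rightarrow> ('x \<Rightarrow> real) \<Rightarrow> real) \<Rightarrow>
   ('w \<times> 'x \<Rightarrow> ('x \<Rightarrow> real) \<Rightarrow> real) \<Rightarrow>
   ('x \<Rightarrow> real) \<Rightarrow> ('x \<Rightarrow> real) \<Rightarrow> ('x \<Rightarrow> real ^ 'k) \<Rightarrow> real ^ 'k ^ 'k \<Rightarrow>
   nat \<Rightarrow> (nat \<Rightarrow> 'w \<times> 'x) \<Rightarrow> real" where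
  "IFjj_kernel S m1 m2 b\<^sub>0 p\<^sub>0 z G j v =
     (-1) ^ j *
     (Ecal_vec S b\<^sub>0 m2 z (v 1) \<bullet>
       ((foldr (**) (map (\<lambda>s. matrix_inv G ** (Szz S z (v s) - G)) [3..<Suc j]) (mat 1)
          ** matrix_inv G) *v
        Ecal_vec S p\<^sub>0 m1 z (v 2)))"

definition IF22mm ::
  "('w \<times> 'x \<Rightarrow> real) \<Rightarrow> ('w \<times> 'x \<Rightarrow> ('x \<Rightarrow> real) \<Rightarrow> real) \<Rightarrow>
   ('w \<times> 'x \<Rightarrow> ('x \<Rightarrow> real) \<Rightarrow> real) \<Rightarrow>
   ('x \<Rightarrow> real) \<Rightarrow> ('x \<Rightarrow> real) \<Rightarrow> ('x \<Rightarrow> real ^ 'k) \<Rightarrow> real ^ 'k ^ 'k \<Rightarrow>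
   nat \<Rightarrow> nat \<Rightarrow> (nat \<Rightarrow> 'w \<times> 'x) \<Rightarrow> real" where
  "IF22mm S m1 m2 b\<^sub>0 p\<^sub>0 z G n m \<omega> =
     (\<Sum>j=2..m. ustat n j (IFjj_kernel S m1 m2 b\<^sub>0 p\<^sub>0 z G j) \<omega>)"

end

theory Submission
  imports Defs "HOL-Combinatorics.Multiset_Permutations"
begin

text \<open>
  The truncated parameter is $E_\theta \mathcal H(\hat b, \hat p) - a^\top \Sigma_k^{-1} c$ with
  $a = E_\theta \mathcal E_{\hat b, m_2}(\bar z_k)$ and $c = E_\theta \mathcal E_{\hat p, m_1}(\bar z_k)$.  Up to
  sign it is therefore a corner entry of $N^{-1}$, where $N$ is the $P_\theta$-mean of the matrix-valued
  statistic with rows $(1, \mathcal E_{\hat b, m_2}^\top, \mathcal H)$,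
  $(0, S_{bp} \bar z_k \bar z_k^\top, \mathcal E_{\hat p, m_1})$ and $(0, 0, 1)$.

  For an entry of the inverse of a mean $N = E_\theta \nu(O)$ the recursion is explicit.  As
  $dN^{-1} = - N^{-1} (dN) N^{-1}$, differentiating
  $N^{-1} (\nu(O_1) - N) N^{-1} \cdots (\nu(O_j) - N) N^{-1}$ either inserts a new centred factor, in one of
  $j + 1$ places, or replaces one of the old factors; the latter terms miss a coordinate and
  vanish in the degenerate projection.  Hence the order-$j$ kernel is $(-1)^j$ times the
  symmetrization of this product.

  Under $P_{\hat\theta}$ double robustness and density of the perturbation directions give $a = c = 0$.  The
  product then collapses to the stated kernels.
\<close>

section \<open>Square-integrable functions and regular submodels\<close>

text \<open>The recursion differentiates the kernel at a fixed sample point as a function of the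
  law, so explicit kernels are needed at every law of the model, where a and c need not vanish.
  Differentiating a, c and the inverse Gram matrix separately would mix three kinds of terms at each
  order. Inside the single matrix N they move together, and alternating products of the inverse with
  centred factors are closed under differentiation. The entry H drops out of every product of two or
  more centred factors, since these have zero first column and zero last row; it is felt at order
  one only.

  The normalization is a count: all \<open>j = i + 1\<close> insertions into an ordering of
  \<open>{1..i}\<close> have the same symmetrization, so the \<open>fact i\<close> orderings turn
  \<open>1 / fact i\<close> into \<open>j / fact j\<close>, and the definition divides by
  \<open>j\<close>.

  That a = c = 0 is a first-order condition: with one nuisance correct, the right-hand side of the
  double robustness identity is 0, so the mean of H does not change when the other nuisance is
  perturbed. The bounds on \<open>lam\<close> and the continuity of the means of \<open>m1\<close>
  and \<open>m2\<close> extend this from the dense directions to the basis functions.\<close>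

lemma L2_measurable: "f \<in> L2 M \<Longrightarrow> f \<in> borel_measurable M"
  by (simp add: L2_def)

lemma L2_mult_integrable:
  assumes "f \<in> L2 M" "g \<in> L2 M"
  shows "integrable M (\<lambda>x. f x * g x)"
proof (rule Bochner_Integration.integrable_bound)
  show "integrable M (\<lambda>x. (f x)\<^sup>2 + (g x)\<^sup>2)"
    using assms by (auto simp: L2_def)
  show "(\<lambda>x. f x * g x) \<in> borel_measurable M"
    using assms by (auto simp: L2_def)
  have "\<bar>a * b\<bar> \<le> a\<^sup>2 + b\<^sup>2" for a b :: real
  proof -
    have "2 * (\<bar>a\<bar> * \<bar>b\<bar>) \<le> a\<^sup>2 + b\<^sup>2"
      using sum_squares_bound[of "\<bar>a\<bar>" "\<bar>b\<bar>"] by (simp add: algebra_simps)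
    then show ?thesis
      by (simp add: abs_mult) (smt (verit) mult_nonneg_nonneg abs_ge_zero)
  qed
  then show "AE x in M. norm (f x * g x) \<le> norm ((f x)\<^sup>2 + (g x)\<^sup>2)"
    by simp
qed

lemma L2_add: "f \<in> L2 M \<Longrightarrow> g \<in> L2 M \<Longrightarrow> (\<lambda>x. f x + g x) \<in> L2 M"
  using L2_mult_integrable[of f M g]
  by (auto simp: L2_def power2_sum mult.assoc intro!: Bochner_Integration.integrable_add)

lemma L2_cmult: "f \<in> L2 M \<Longrightarrow> (\<lambda>x. c * f x) \<in> L2 M"
  by (auto simp: L2_def power_mult_distrib)

lemma L2_diff: "f \<in> L2 M \<Longrightarrow> g \<in> L2 M \<Longrightarrow> (\<lambda>x. f x - g x) \<in> L2 M"
  using L2_add[of f M "\<lambda>x. (-1) * g x"] L2_cmult[of g M "-1"] by simp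

lemma L2_zero: "(\<lambda>x. 0) \<in> L2 M"
  by (simp add: L2_def)

lemma L2_sum: "(\<And>i. i \<in> I \<Longrightarrow> f i \<in> L2 M) \<Longrightarrow> (\<lambda>x. \<Sum>i\<in>I. f i x) \<in> L2 M"
  by (induction I rule: infinite_finite_induct) (auto intro: L2_zero L2_add)

context prob_space
begin

lemma L2_const: "(\<lambda>x. c) \<in> L2 M"
  by (simp add: L2_def)

lemma L2_integrable: "f \<in> L2 M \<Longrightarrow> integrable M f"
  using L2_mult_integrable[of f M "\<lambda>x. 1"] L2_const by simp

end

lemma L2_norm_nonneg: "0 \<le> L2_norm M f"
  by (simp add: L2_norm_def)

lemma L2_Cauchy_Schwarz:
  assumes f: "f \<in> L2 M" and g: "g \<in> L2 M"
  shows "\<bar>\<integral>x. f x * g x \<partial>M\<bar> \<le> L2_norm M f * L2_norm M g"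
proof -
  define A B C where "A = (\<integral>x. (f x)\<^sup>2 \<partial>M)" and "B = (\<integral>x. f x * g x \<partial>M)"
    and "C = (\<integral>x. (g x)\<^sup>2 \<partial>M)"
  have i: "integrable M (\<lambda>x. (f x)\<^sup>2)" "integrable M (\<lambda>x. (g x)\<^sup>2)"
    "integrable M (\<lambda>x. f x * g x)"
    using f g L2_mult_integrable[OF f g] by (auto simp: L2_def)
  have q: "0 \<le> s\<^sup>2 * A + 2 * s * t * B + t\<^sup>2 * C" for s t
  proof -
    have "0 \<le> (\<integral>x. (s * f x + t * g x)\<^sup>2 \<partial>M)"
      by simp
    also have "\<dots> = (\<integral>x. s\<^sup>2 * (f x)\<^sup>2 + (2 * s * t) * (f x * g x) + t\<^sup>2 * (g x)\<^sup>2 \<partial>M)"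
      by (intro Bochner_Integration.integral_cong) (auto simp: power2_eq_square algebra_simps)
    also have "\<dots> = s\<^sup>2 * A + 2 * s * t * B + t\<^sup>2 * C"
      using i by (simp add: A_def B_def C_def)
    finally show ?thesis .
  qed
  have nn: "0 \<le> A" "0 \<le> C" by (simp_all add: A_def C_def)
  have "B\<^sup>2 \<le> A * C"
  proof (cases "C = 0")
    case True
    \<comment> \<open>The value of \<open>t\<close> is chosen so that
      \<open>A + 2 * t * B = -1\<close>, which contradicts nonnegativity unless
      \<open>B = 0\<close>.\<close>
    have "0 \<le> 1 * A + 2 * (- (A + 1) * B / (2 * B\<^sup>2)) * B" if "B \<noteq> 0"
      using q[of 1 "- (A + 1) * B / (2 * B\<^sup>2)"] True by simp
    then have "B = 0"
      using nn by (auto simp: power2_eq_square field_simps)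
    then show ?thesis using nn by simp
  next
    case False
    \<comment> \<open>Up to scaling, \<open>(C, - B)\<close> minimizes the quadratic form.\<close>
    have "0 \<le> C\<^sup>2 * A - 2 * C * B * B + B\<^sup>2 * C"
      using q[of C "- B"] by simp
    also have "\<dots> = C * (A * C - B\<^sup>2)"
      by (simp add: power2_eq_square algebra_simps)
    finally show ?thesis
      using False nn by (simp add: zero_le_mult_iff)
  qed
  then have "sqrt (B\<^sup>2) \<le> sqrt (A * C)"
    by (rule real_sqrt_le_mono)
  then show ?thesis
    by (simp add: L2_norm_def A_def B_def C_def real_sqrt_mult)
qed

text \<open>The difference quotient minus its limit is the integral of \<open>f\<close> against
  \<open>(q t x - 1) / t - g x\<close>, so Cauchy-Schwarz bounds it by the L2 error of the score.
  Differentiability of the likelihood ratio in L2 is what admits unbounded \<open>f\<close>.\<close>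

lemma regular_submodel_expectation:
  assumes reg: "regular_submodel P \<Theta> \<theta> \<gamma> g" and prob: "prob_space (P \<theta>)"
    and f: "f \<in> L2 (P \<theta>)"
  shows "((\<lambda>t. \<integral>x. f x \<partial>P (\<gamma> t)) has_real_derivative (\<integral>x. f x * g x \<partial>P \<theta>)) (at 0)"
proof -
  interpret prob_space "P \<theta>" by (rule prob)
  have \<gamma>0: "\<gamma> 0 = \<theta>" and g: "g \<in> L2 (P \<theta>)" using reg by (auto simp: regular_submodel_def)
  obtain q where q: "\<forall>\<^sub>F t in nhds 0. q t \<in> L2 (P \<theta>) \<and> (\<forall>x. 0 \<le> q t x) \<and>
           P (\<gamma> t) = density (P \<theta>) (\<lambda>x. ennreal (q t x))"
    and lim: "((\<lambda>t. L2_norm (P \<theta>) (\<lambda>x. (q t x - 1) / t - g x)) \<longlongrightarrow> 0) (at 0)"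
    using reg by (auto simp: regular_submodel_def)
  have "((\<lambda>t. ((\<integral>x. f x \<partial>P (\<gamma> t)) - (\<integral>x. f x \<partial>P \<theta>)) / t - (\<integral>x. f x * g x \<partial>P \<theta>)) \<longlongrightarrow> 0) (at 0)"
  proof (rule Lim_null_comparison)
    show "((\<lambda>t. L2_norm (P \<theta>) f * L2_norm (P \<theta>) (\<lambda>x. (q t x - 1) / t - g x)) \<longlongrightarrow> 0) (at 0)"
      using tendsto_mult_right_zero[OF lim] .
    have "\<forall>\<^sub>F t in at 0. t \<noteq> (0::real)"
      by (rule eventually_neq_at_within)
    moreover have "\<forall>\<^sub>F t in at 0. q t \<in> L2 (P \<theta>) \<and> (\<forall>x. 0 \<le> q t x) \<and>
           P (\<gamma> t) = density (P \<theta>) (\<lambda>x. ennreal (q t x))"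
      using q eventually_nhds_x_imp_x filter_leD[OF at_within_le_nhds] by blast
    ultimately show "\<forall>\<^sub>F t in at 0. norm (((\<integral>x. f x \<partial>P (\<gamma> t)) - (\<integral>x. f x \<partial>P \<theta>)) / t - (\<integral>x. f x * g x \<partial>P \<theta>))
        \<le> L2_norm (P \<theta>) f * L2_norm (P \<theta>) (\<lambda>x. (q t x - 1) / t - g x)"
    proof eventually_elim
      case (elim t)
      have qt: "q t \<in> L2 (P \<theta>)" using elim by simp
      have i: "integrable (P \<theta>) (\<lambda>x. q t x * f x)" "integrable (P \<theta>) f"
          "integrable (P \<theta>) (\<lambda>x. f x * g x)"
        using L2_mult_integrable[OF qt f] L2_mult_integrable[OF f g] L2_integrable[OF f] by auto
      have d: "(\<lambda>x. (q t x - 1) / t - g x) \<in> L2 (P \<theta>)"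
        using L2_cmult[OF L2_diff[OF qt L2_const[of 1]], of "1 / t"] g by (intro L2_diff) auto
      have "(\<integral>x. f x \<partial>P (\<gamma> t)) = (\<integral>x. q t x * f x \<partial>P \<theta>)"
        using elim f qt by (auto intro!: integral_real_density L2_measurable)
      then have "((\<integral>x. f x \<partial>P (\<gamma> t)) - (\<integral>x. f x \<partial>P \<theta>)) / t - (\<integral>x. f x * g x \<partial>P \<theta>)
          = (\<integral>x. (q t x * f x - f x) / t - f x * g x \<partial>P \<theta>)"
        using i by simp
      also have "\<dots> = (\<integral>x. f x * ((q t x - 1) / t - g x) \<partial>P \<theta>)"
        by (intro Bochner_Integration.integral_cong) (auto simp: field_simps)
      finally show ?case
        using L2_Cauchy_Schwarz[OF f d] by simp
    qed
  qed
  then show ?thesis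
    by (simp add: has_field_derivative_iff \<gamma>0 LIM_zero_iff)
qed

text \<open>The total mass is 1 along the path, so the mean of the constant 1 has derivative
  0.\<close>

lemma regular_submodel_score_mean:
  assumes reg: "regular_submodel P \<Theta> \<theta> \<gamma> g" and prob: "\<And>\<theta>. \<theta> \<in> \<Theta> \<Longrightarrow> prob_space (P \<theta>)"
    and "\<theta> \<in> \<Theta>"
  shows "(\<integral>x. g x \<partial>P \<theta>) = 0"
proof -
  interpret prob_space "P \<theta>" using assms by blast
  have "\<forall>\<^sub>F t in nhds 0. \<gamma> t \<in> \<Theta>" using reg by (auto simp: regular_submodel_def)
  then have ev: "\<forall>\<^sub>F t in nhds 0. (\<integral>x. (1::real) \<partial>P (\<gamma> t)) = 1"
    by (rule eventually_mono) (simp add: prob prob_space.prob_space)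
  have "((\<lambda>t. \<integral>x. (1::real) \<partial>P (\<gamma> t)) has_real_derivative (\<integral>x. 1 * g x \<partial>P \<theta>)) (at 0)"
    using assms by (intro regular_submodel_expectation[OF reg] L2_const) auto
  then have "((\<lambda>t. 1) has_real_derivative (\<integral>x. 1 * g x \<partial>P \<theta>)) (at 0)"
    using DERIV_cong_ev[OF refl ev refl] by simp
  then show ?thesis
    using DERIV_unique[OF _ DERIV_const] by fastforce
qed

section \<open>Alternating matrix products\<close>

text \<open>Entrywise derivatives match \<open>influence_function\<close> directly, which speaks of
  real derivatives of a real functional, here one matrix entry.\<close>

definition has_entrywise_derivative ::
    "(real \<Rightarrow> real ^ 'n ^ 'm) \<Rightarrow> real ^ 'n ^ 'm \<Rightarrow> bool" where
  "has_entrywise_derivative M V \<longleftrightarrow>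
     (\<forall>a b. ((\<lambda>t. M t $ a $ b) has_real_derivative V $ a $ b) (at 0))"

lemma has_entrywise_derivativeD:
  "has_entrywise_derivative M V \<Longrightarrow> ((\<lambda>t. M t $ a $ b) has_real_derivative V $ a $ b) (at 0)"
  by (simp add: has_entrywise_derivative_def)

lemma has_entrywise_derivative_const: "has_entrywise_derivative (\<lambda>t. C) 0"
  by (simp add: has_entrywise_derivative_def)

lemma has_entrywise_derivative_unique:
  "has_entrywise_derivative M V \<Longrightarrow> has_entrywise_derivative M W \<Longrightarrow> V = W"
  unfolding has_entrywise_derivative_def vec_eq_iff using DERIV_unique by blast

lemma has_entrywise_derivative_diff:
  "has_entrywise_derivative M V \<Longrightarrow> has_entrywise_derivative L W \<Longrightarrow>
   has_entrywise_derivative (\<lambda>t. M t - L t) (V - W)"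
  by (auto simp: has_entrywise_derivative_def intro!: derivative_intros)

lemma has_entrywise_derivative_matrix_mult:
  assumes "has_entrywise_derivative M V" "has_entrywise_derivative L W"
  shows "has_entrywise_derivative (\<lambda>t. M t ** L t) (V ** L 0 + M 0 ** W)"
  unfolding has_entrywise_derivative_def
proof (intro allI)
  fix a b
  have "((\<lambda>t. \<Sum>k\<in>UNIV. M t $ a $ k * L t $ k $ b) has_real_derivative
      (\<Sum>k\<in>UNIV. M 0 $ a $ k * W $ k $ b + V $ a $ k * L 0 $ k $ b)) (at 0)"
    by (intro DERIV_sum DERIV_mult' has_entrywise_derivativeD assms)
  then show "((\<lambda>t. (M t ** L t) $ a $ b) has_real_derivative (V ** L 0 + M 0 ** W) $ a $ b) (at 0)"
    by (simp add: matrix_matrix_mult_def sum.distrib add.commute)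
qed

lemma has_entrywise_derivative_cong:
  assumes "\<forall>\<^sub>F t in nhds 0. M t = L t" "has_entrywise_derivative L V"
  shows "has_entrywise_derivative M V"
  unfolding has_entrywise_derivative_def
proof (intro allI)
  fix a b
  have "\<forall>\<^sub>F t in nhds 0. M t $ a $ b = L t $ a $ b"
    using assms(1) by (rule eventually_mono) simp
  from DERIV_cong_ev[OF refl this refl]
  show "((\<lambda>t. M t $ a $ b) has_real_derivative V $ a $ b) (at 0)"
    using assms(2) by (auto simp: has_entrywise_derivative_def)
qed

lemma matrix_mult_minus_left: "(- A) ** B = - (A ** (B :: real ^ 'k ^ 'n))"
  by (simp add: matrix_matrix_mult_def vec_eq_iff sum_negf)

lemma matrix_mult_minus_right: "A ** (- B) = - (A ** (B :: real ^ 'k ^ 'n))"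
  by (simp add: matrix_matrix_mult_def vec_eq_iff sum_negf)

lemma matrix_sub_ldistrib: "A ** (B - C) = A ** B - A ** (C :: real ^ 'k ^ 'n)"
  by (simp add: matrix_matrix_mult_def vec_eq_iff sum_subtractf right_diff_distrib)

lemma matrix_sub_rdistrib: "(A - B) ** C = A ** C - B ** (C :: real ^ 'k ^ 'n)"
  by (simp add: matrix_matrix_mult_def vec_eq_iff sum_subtractf left_diff_distrib)

lemma matrix_inv_inverse:
  fixes A :: "real ^ 'n ^ 'n"
  assumes "invertible A"
  shows "A ** matrix_inv A = mat 1" "matrix_inv A ** A = mat 1"
  using assms someI_ex[of "\<lambda>A'. A ** A' = mat 1 \<and> A' ** A = mat 1"]
  by (auto simp: invertible_def matrix_inv_def)

lemma matrix_inv_eqI: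
  fixes A :: "real ^ 'n ^ 'n"
  assumes "A ** L = mat 1"
  shows "matrix_inv A = L"
proof -
  have inv: "invertible A"
    using assms matrix_left_right_inverse[of A L] by (auto simp: invertible_def)
  have "matrix_inv A = matrix_inv A ** (A ** L)"
    by (simp add: assms)
  then show ?thesis
    by (simp add: matrix_mul_assoc matrix_inv_inverse[OF inv])
qed

text \<open>Column \<open>b\<close> of the inverse solves a linear system with right-hand side
  \<open>axis b 1\<close>. The formula serves to show that the entries depend differentiably on the
  matrix.\<close>

lemma matrix_inv_entry:
  fixes A :: "real ^ 'n ^ 'n"
  assumes "invertible A"
  shows "matrix_inv A $ a $ b = det (\<chi> i j. if j = a then axis b 1 $ i else A $ i $ j) / det A"
proof -
  have "A *v (matrix_inv A *v axis b 1) = axis b 1"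
    by (simp add: matrix_vector_mul_assoc matrix_inv_inverse[OF assms])
  then have "matrix_inv A *v axis b 1
      = (\<chi> k. det (\<chi> i j. if j = k then axis b 1 $ i else A $ i $ j) / det A)"
    using assms cramer[of A] by (simp add: invertible_det_nz)
  then have "(matrix_inv A *v axis b 1) $ a
      = (\<chi> k. det (\<chi> i j. if j = k then axis b 1 $ i else A $ i $ j) / det A) $ a"
    by (rule arg_cong)
  moreover have "(matrix_inv A *v axis b 1) $ a = matrix_inv A $ a $ b"
    by (simp add: matrix_vector_mult_basis column_def)
  ultimately show ?thesis
    by simp
qed

lemma det_differentiable:
  fixes M :: "real \<Rightarrow> real ^ 'n ^ 'n"
  assumes "\<And>a b. (\<lambda>t. M t $ a $ b) differentiable (at x)"
  shows "(\<lambda>t. det (M t)) differentiable (at x)"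
proof -
  have "(\<lambda>t. \<Prod>i\<in>I. M t $ i $ p i) differentiable (at x)" for p and I :: "'n set"
    by (induction I rule: infinite_finite_induct) (auto intro!: derivative_intros assms)
  then show ?thesis
    unfolding det_def by (intro differentiable_sum differentiable_mult) auto
qed

text \<open>Cramer's rule gives differentiability; the product rule for \<open>N t ** matrix_inv (N t)\<close> then
  determines the derivative.\<close>

lemma has_entrywise_derivative_matrix_inv:
  fixes N :: "real \<Rightarrow> real ^ 'n ^ 'n"
  assumes N: "has_entrywise_derivative N V" and inv: "\<forall>\<^sub>F t in nhds 0. invertible (N t)"
  shows "has_entrywise_derivative (\<lambda>t. matrix_inv (N t))
           (- (matrix_inv (N 0) ** V ** matrix_inv (N 0)))"
proof -
  have inv0: "invertible (N 0)"
    using inv by (rule eventually_nhds_x_imp_x)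
  have diffN: "(\<lambda>t. N t $ a $ b) differentiable (at 0)" for a b
    using N by (auto simp: has_entrywise_derivative_def real_differentiable_def)
  define D where "D a b t = det (\<chi> i j. if j = a then axis b 1 $ i else N t $ i $ j) / det (N t)" for a b t
  have "D a b differentiable (at 0)" for a b
    unfolding D_def using inv0
  proof (intro differentiable_divide det_differentiable diffN)
    fix i j
    show "(\<lambda>t. (\<chi> i j. if j = a then axis b 1 $ i else N t $ i $ j) $ i $ j) differentiable at 0"
      by (cases "j = a") (simp_all add: diffN)
  qed (simp add: invertible_det_nz)
  then have "\<forall>a b. \<exists>d. (D a b has_real_derivative d) (at 0)"
    by (simp add: real_differentiable_def)
  then obtain d where d: "\<And>a b. (D a b has_real_derivative d a b) (at 0)"
    by metis
  define W where "W = (\<chi> a b. d a b)"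
  have W: "has_entrywise_derivative (\<lambda>t. matrix_inv (N t)) W"
  proof (rule has_entrywise_derivative_cong)
    show "\<forall>\<^sub>F t in nhds 0. matrix_inv (N t) = (\<chi> a b. D a b t)"
      using inv by (rule eventually_mono) (simp add: vec_eq_iff D_def matrix_inv_entry)
    show "has_entrywise_derivative (\<lambda>t. \<chi> a b. D a b t) W"
      using d by (simp add: has_entrywise_derivative_def W_def)
  qed
  have "has_entrywise_derivative (\<lambda>t. N t ** matrix_inv (N t)) (V ** matrix_inv (N 0) + N 0 ** W)"
    by (intro has_entrywise_derivative_matrix_mult N W)
  moreover have "has_entrywise_derivative (\<lambda>t. N t ** matrix_inv (N t)) 0"
    by (rule has_entrywise_derivative_cong[OF _ has_entrywise_derivative_const[of "mat 1"]])
       (use inv in \<open>auto elim!: eventually_mono simp: matrix_inv_inverse\<close>)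
  ultimately have "V ** matrix_inv (N 0) + N 0 ** W = 0"
    by (rule has_entrywise_derivative_unique)
  then have "N 0 ** W = - (V ** matrix_inv (N 0))"
    by (simp add: eq_neg_iff_add_eq_0 add.commute)
  then have "matrix_inv (N 0) ** (N 0 ** W) = - (matrix_inv (N 0) ** V ** matrix_inv (N 0))"
    by (simp add: matrix_mul_assoc matrix_mult_minus_right)
  then have "W = - (matrix_inv (N 0) ** V ** matrix_inv (N 0))"
    by (simp add: matrix_mul_assoc matrix_inv_inverse[OF inv0])
  with W show ?thesis by simp
qed

section \<open>Words of centred factors and their product rule\<close>

text \<open>A word of \<open>j\<close> letters is interleaved with \<open>j + 1\<close> copies of
  \<open>\<Lambda>\<close>. Letters are labels rather than matrices, so that a word can be read with
  one label reinterpreted, and permuted by relabelling.\<close>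

primrec chain :: "real ^ 'n ^ 'n \<Rightarrow> (nat \<Rightarrow> real ^ 'n ^ 'n) \<Rightarrow> nat list \<Rightarrow> real ^ 'n ^ 'n" where
  "chain \<Lambda> A [] = \<Lambda>"
| "chain \<Lambda> A (x # xs) = \<Lambda> ** A x ** chain \<Lambda> A xs"

text \<open>One word for each copy of \<open>\<Lambda>\<close> in the chain, these being the places
  where the derivative of the inverse acts.\<close>

primrec insertions :: "'a \<Rightarrow> 'a list \<Rightarrow> 'a list list" where
  "insertions y [] = [[y]]"
| "insertions y (x # xs) = (y # x # xs) # map ((#) x) (insertions y xs)"

text \<open>One word for each centred factor hit by the derivative. The old label is lost, which is
  why these words vanish in the degenerate projection.\<close>

primrec replacements :: "'a \<Rightarrow> 'a list \<Rightarrow> 'a list list" where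
  "replacements y [] = []"
| "replacements y (x # xs) = (y # xs) # map ((#) x) (replacements y xs)"

lemma length_insertions: "length (insertions y xs) = Suc (length xs)"
  by (induction xs) auto

lemma insertionsD:
  "ys \<in> set (insertions y xs) \<Longrightarrow> set ys = insert y (set xs) \<and> length ys = Suc (length xs)"
  by (induction xs arbitrary: ys) auto

lemma replacementsD:
  "ys \<in> set (replacements y xs) \<Longrightarrow> set ys \<subseteq> insert y (set xs) \<and> y \<in> set ys \<and> length ys = length xs"
proof (induction xs arbitrary: ys)
  case (Cons x xs)
  then consider "ys = y # xs" | zs where "ys = x # zs" "zs \<in> set (replacements y xs)"
    by auto
  then show ?case
    using Cons.IH by cases auto
qed simp

lemma replacements_distinct:
  "ys \<in> set (replacements y xs) \<Longrightarrow> distinct xs \<Longrightarrow> y \<notin> set xs \<Longrightarrow> distinct ys"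
proof (induction xs arbitrary: ys)
  case (Cons x xs)
  then consider "ys = y # xs" | zs where "ys = x # zs" "zs \<in> set (replacements y xs)"
    by auto
  then show ?case
  proof cases
    case 2
    then show ?thesis
      using Cons replacementsD[of zs y xs] by auto
  qed (use Cons in auto)
qed simp

lemma chain_cong: "(\<And>s. s \<in> set xs \<Longrightarrow> A s = A' s) \<Longrightarrow> chain \<Lambda> A xs = chain \<Lambda> A' xs"
  by (induction xs) auto

lemma chain_map: "chain \<Lambda> A (map f xs) = chain \<Lambda> (A \<circ> f) xs"
  by (induction xs) auto

lemma matrix_mult_sum_list_right:
  "M ** sum_list (map f xs) = sum_list (map (\<lambda>x. M ** (f x :: real ^ 'k ^ 'm)) xs)"
  by (induction xs) (auto simp: matrix_add_ldistrib)

text \<open>By the product rule each \<open>\<Lambda>\<close> yields - \<Lambda> V \<Lambda>, an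
  insertion, and each factor \<open>A s - N t\<close> yields - V, a replacement. The fresh label
  \<open>y\<close> stands for \<open>V\<close>.\<close>

lemma has_entrywise_derivative_chain:
  fixes N :: "real \<Rightarrow> real ^ 'n ^ 'n"
  assumes N: "has_entrywise_derivative N V" and inv: "\<forall>\<^sub>F t in nhds 0. invertible (N t)"
    and "y \<notin> set xs"
  shows "has_entrywise_derivative (\<lambda>t. chain (matrix_inv (N t)) (\<lambda>s. A s - N t) xs)
     (- (\<Sum>ys\<leftarrow>insertions y xs. chain (matrix_inv (N 0)) ((\<lambda>s. A s - N 0)(y := V)) ys)
      - (\<Sum>ys\<leftarrow>replacements y xs. chain (matrix_inv (N 0)) ((\<lambda>s. A s - N 0)(y := V)) ys))"
  using assms(3)
proof (induction xs)
  case Nil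
  show ?case
    using has_entrywise_derivative_matrix_inv[OF N inv] by simp
next
  case (Cons x xs)
  let ?L = "matrix_inv (N 0)" and ?A = "(\<lambda>s. A s - N 0)(y := V)"
  have 1: "has_entrywise_derivative (\<lambda>t. chain (matrix_inv (N t)) (\<lambda>s. A s - N t) xs)
     (- (\<Sum>ys\<leftarrow>insertions y xs. chain ?L ?A ys) - (\<Sum>ys\<leftarrow>replacements y xs. chain ?L ?A ys))"
    using Cons.prems by (intro Cons.IH) auto
  have 2: "has_entrywise_derivative (\<lambda>t. A x - N t) (0 - V)"
    by (intro has_entrywise_derivative_diff has_entrywise_derivative_const N)
  have c: "chain ?L (\<lambda>s. A s - N 0) xs = chain ?L ?A xs"
    using Cons.prems by (intro chain_cong) auto
  have neq: "x \<noteq> y" using Cons.prems by auto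
  have m: "(\<Sum>ys\<leftarrow>map ((#) x) yss. chain ?L ?A ys)
      = ?L ** (A x - N 0) ** (\<Sum>ys\<leftarrow>yss. chain ?L ?A ys)" for yss
    using neq by (simp add: matrix_mult_sum_list_right o_def)
  \<comment> \<open>The noncommutative identity is proved for atoms, \<open>I\<close> and
    \<open>R\<close> standing for the sums over the shorter word. The two terms with
    \<open>C\<close> are the insertion and the replacement at the head.\<close>
  have alg: "(- (L ** V ** L) ** X + L ** (0 - V)) ** C + L ** X ** (- I - R)
      = - (L ** V ** (L ** X ** C) + L ** X ** I) - (L ** V ** C + L ** X ** R)"
    for L X C I R :: "real ^ 'n ^ 'n"
    by (simp add: matrix_mul_assoc matrix_mult_minus_left matrix_mult_minus_right
        matrix_sub_ldistrib matrix_sub_rdistrib)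
  have e: "(- (?L ** V ** ?L) ** (A x - N 0) + ?L ** (0 - V)) ** chain ?L (\<lambda>s. A s - N 0) xs
      + ?L ** (A x - N 0) ** (- (\<Sum>ys\<leftarrow>insertions y xs. chain ?L ?A ys)
          - (\<Sum>ys\<leftarrow>replacements y xs. chain ?L ?A ys))
    = - (\<Sum>ys\<leftarrow>insertions y (x # xs). chain ?L ?A ys)
      - (\<Sum>ys\<leftarrow>replacements y (x # xs). chain ?L ?A ys)"
    unfolding insertions.simps replacements.simps list.map(2) sum_list.Cons m c alg
    using neq by simp
  show ?case
    using has_entrywise_derivative_matrix_mult[OF has_entrywise_derivative_matrix_mult[OF
      has_entrywise_derivative_matrix_inv[OF N inv] 2] 1] unfolding e chain.simps .
qed

section \<open>Degenerate kernels\<close>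

text \<open>Finite sums of products with one mean-zero factor for each coordinate in
  \<open>J\<close>. Conditioning either keeps such a sum or kills it, so the Hoeffding decomposition
  reduces to bookkeeping with coordinate sets.\<close>

inductive_set centered_span :: "'o measure \<Rightarrow> nat set \<Rightarrow> ((nat \<Rightarrow> 'o) \<Rightarrow> real) set"
  for Q J where
  zero: "(\<lambda>v. 0) \<in> centered_span Q J"
| add: "K \<in> centered_span Q J \<Longrightarrow> \<forall>s\<in>J. g s \<in> L2 Q \<and> (\<integral>x. g s x \<partial>Q) = 0 \<Longrightarrow>
    (\<lambda>v. K v + c * (\<Prod>s\<in>J. g s (v s))) \<in> centered_span Q J"

lemma centered_span_add:
  assumes "K \<in> centered_span Q J" "L \<in> centered_span Q J"
  shows "(\<lambda>v. K v + L v) \<in> centered_span Q J"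
  using assms(2)
proof induction
  case zero
  then show ?case using assms(1) by simp
next
  case (add L g c)
  then show ?case
    using centered_span.add[of "\<lambda>v. K v + L v" Q J g c] by (simp add: add.assoc)
qed

lemma centered_span_sum:
  "(\<And>i. i \<in> I \<Longrightarrow> K i \<in> centered_span Q J) \<Longrightarrow> (\<lambda>v. \<Sum>i\<in>I. K i v) \<in> centered_span Q J"
  by (induction I rule: infinite_finite_induct)
     (auto intro: centered_span.zero centered_span_add)

lemma centered_span_const: "(\<lambda>v. c) \<in> centered_span Q {}"
  using centered_span.add[OF centered_span.zero, of "{}" _ Q c] by simp

lemma centered_span_mult:
  assumes "K \<in> centered_span Q J" and "s \<notin> J" "finite J" and g: "g \<in> L2 Q" "(\<integral>x. g x \<partial>Q) = 0"
  shows "(\<lambda>v. g (v s) * K v) \<in> centered_span Q (insert s J)"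
  using assms(1)
proof induction
  case zero
  then show ?case by (simp add: centered_span.zero)
next
  case (add K f c)
  have "(\<Prod>r\<in>J. (f(s := g)) r (v r)) = (\<Prod>r\<in>J. f r (v r))" for v
    using \<open>s \<notin> J\<close> by (intro prod.cong) auto
  then have *: "(\<Prod>r\<in>insert s J. (f(s := g)) r (v r)) = g (v s) * (\<Prod>r\<in>J. f r (v r))" for v
    using \<open>s \<notin> J\<close> \<open>finite J\<close> by (subst prod.insert) auto
  have "(\<lambda>v. g (v s) * K v + c * (\<Prod>r\<in>insert s J. (f(s := g)) r (v r))) \<in> centered_span Q (insert s J)"
    using add g by (intro centered_span.add) auto
  then show ?case
    unfolding * by (simp add: algebra_simps)
qed

text \<open>Padding with 1 brings a product over some coordinates into the form required by Fubini
  on the whole product space.\<close>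

lemma prod_extend:
  "J \<subseteq> I \<Longrightarrow> finite I \<Longrightarrow> (\<Prod>i\<in>J. f i) = (\<Prod>i\<in>I. if i \<in> J then f i else (1::real))"
  by (simp add: prod.If_cases Int_absorb1)

context prob_space
begin

lemma product_integral_prob:
  assumes "finite I" "\<And>i. i \<in> I \<Longrightarrow> integrable M (f i :: _ \<Rightarrow> real)"
  shows "integrable (Pi\<^sub>M I (\<lambda>_. M)) (\<lambda>w. \<Prod>i\<in>I. f i (w i))"
    and "(\<integral>w. (\<Prod>i\<in>I. f i (w i)) \<partial>Pi\<^sub>M I (\<lambda>_. M)) = (\<Prod>i\<in>I. \<integral>x. f i x \<partial>M)"
proof -
  interpret product_sigma_finite "\<lambda>_. M"
    by (simp add: product_sigma_finite_def sigma_finite_measure_axioms)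
  show "integrable (Pi\<^sub>M I (\<lambda>_. M)) (\<lambda>w. \<Prod>i\<in>I. f i (w i))"
    using assms by (rule product_integrable_prod)
  show "(\<integral>w. (\<Prod>i\<in>I. f i (w i)) \<partial>Pi\<^sub>M I (\<lambda>_. M)) = (\<Prod>i\<in>I. \<integral>x. f i x \<partial>M)"
    using assms by (rule product_integral_prod)
qed

lemma centered_span_L2:
  assumes "K \<in> centered_span M J" and J: "J \<subseteq> I" "finite I"
  shows "K \<in> L2 (Pi\<^sub>M I (\<lambda>_. M))"
  using assms(1)
proof induction
  case zero
  then show ?case by (rule L2_zero)
next
  case (add K g c)
  let ?f = "\<lambda>i x. if i \<in> J then g i x else 1"
  have f: "?f i \<in> L2 M" for i
    using add L2_const by (cases "i \<in> J") auto
  have eq: "(\<Prod>s\<in>J. g s (v s)) = (\<Prod>i\<in>I. ?f i (v i))" for v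
    using J by (simp add: prod_extend)
  have "(\<lambda>v. \<Prod>i\<in>I. ?f i (v i)) \<in> borel_measurable (Pi\<^sub>M I (\<lambda>_. M))"
    using f L2_integrable by (intro borel_measurable_integrable product_integral_prob J) auto
  moreover have "integrable (Pi\<^sub>M I (\<lambda>_. M)) (\<lambda>v. \<Prod>i\<in>I. (?f i (v i))\<^sup>2)"
    using f by (intro product_integral_prob(1)[where f = "\<lambda>i x. (?f i x)\<^sup>2"] J) (simp add: L2_def)
  ultimately have "(\<lambda>v. \<Prod>i\<in>I. ?f i (v i)) \<in> L2 (Pi\<^sub>M I (\<lambda>_. M))"
    by (simp add: L2_def prod_power_distrib)
  then show ?case
    using add unfolding eq by (intro L2_add L2_cmult)
qed

text \<open>With the coordinates in \<open>S\<close> frozen, the integral factorizes, and each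
  coordinate of \<open>J\<close> outside \<open>S\<close> contributes the factor 0. Freezing only
  inserts constants, so this holds for every \<open>v\<close>, not merely almost every
  \<open>v\<close>.\<close>

lemma centered_span_section:
  assumes "K \<in> centered_span M J" and J: "J \<subseteq> I" "finite I"
  shows "integrable (Pi\<^sub>M I (\<lambda>_. M)) (\<lambda>w. K (\<lambda>s\<in>I. if s \<in> S then v s else w s)) \<and>
    (\<integral>w. K (\<lambda>s\<in>I. if s \<in> S then v s else w s) \<partial>Pi\<^sub>M I (\<lambda>_. M)) = (if J \<subseteq> S then K v else 0)"
  using assms(1)
proof induction
  case zero
  then show ?case by simp
next
  case (add K g c)
  let ?f = "\<lambda>i x. if i \<in> J then (if i \<in> S then g i (v i) else g i x) else 1"
  let ?m = "\<lambda>w. \<lambda>s\<in>I. if s \<in> S then v s else w s"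
  have f: "integrable M (?f i)" for i
    using add.hyps L2_integrable by (cases "i \<in> J"; cases "i \<in> S") auto
  have eq: "(\<Prod>s\<in>J. g s (?m w s)) = (\<Prod>i\<in>I. ?f i (w i))" for w
    unfolding prod_extend[OF J] by (intro prod.cong) auto
  have int: "(\<integral>x. ?f i x \<partial>M) = (if i \<in> J then (if i \<in> S then g i (v i) else 0) else 1)" for i
    using add.hyps prob_space by (cases "i \<in> J"; cases "i \<in> S") auto
  have "(\<Prod>i\<in>I. \<integral>x. ?f i x \<partial>M) = (\<Prod>i\<in>J. if i \<in> S then g i (v i) else 0)"
    unfolding int by (rule prod_extend[OF J, symmetric])
  also have "\<dots> = (if J \<subseteq> S then (\<Prod>i\<in>J. g i (v i)) else 0)"
    using finite_subset[OF J] by (auto intro!: prod.cong prod_zero)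
  finally have "(\<integral>w. (\<Prod>s\<in>J. g s (?m w s)) \<partial>Pi\<^sub>M I (\<lambda>_. M)) = (if J \<subseteq> S then (\<Prod>i\<in>J. g i (v i)) else 0)"
    unfolding eq by (subst product_integral_prob(2)) (use f J in auto)
  moreover have "integrable (Pi\<^sub>M I (\<lambda>_. M)) (\<lambda>w. \<Prod>s\<in>J. g s (?m w s))"
    unfolding eq by (intro product_integral_prob(1) f J)
  ultimately show ?case
    using add.IH by simp
qed

end

section \<open>Inclusion-exclusion and symmetrization\<close>

text \<open>Expand the product over \<open>I\<close> of 1 + w(x), with w = 0 on \<open>J\<close> and
  w = -1 off \<open>J\<close>: a subset \<open>S\<close> contributes 0 unless it contains
  \<open>J\<close>, and the product is 0 as soon as \<open>I\<close> has a point outside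
  \<open>J\<close>.\<close>

lemma alternating_sum_supersets:
  assumes "finite I" "J \<subseteq> I"
  shows "(\<Sum>S\<in>Pow I. (-1) ^ (card I - card S) * (if J \<subseteq> S then c else 0)) = (if J = I then c else (0::real))"
proof -
  have "(\<Sum>S\<in>Pow I. (-1) ^ (card I - card S) * (if J \<subseteq> S then c else 0))
      = c * (\<Sum>S\<in>Pow I. (\<Prod>x\<in>S. 1) * (\<Prod>x\<in>I - S. if x \<in> J then 0 else (-1::real)))"
    unfolding sum_distrib_left
  proof (rule sum.cong)
    fix S assume S: "S \<in> Pow I"
    then have fin: "finite S" using assms finite_subset by auto
    show "(-1) ^ (card I - card S) * (if J \<subseteq> S then c else 0)
        = c * ((\<Prod>x\<in>S. 1) * (\<Prod>x\<in>I - S. if x \<in> J then 0 else (-1::real)))"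
    proof (cases "J \<subseteq> S")
      case True
      then have "(\<Prod>x\<in>I - S. if x \<in> J then 0 else (-1::real)) = (\<Prod>x\<in>I - S. -1)"
        by (intro prod.cong) auto
      then show ?thesis
        using True S fin by (simp add: card_Diff_subset)
    next
      case False
      then have "(\<Prod>x\<in>I - S. if x \<in> J then 0 else (-1::real)) = 0"
        using assms by (intro prod_zero) auto
      then show ?thesis using False by simp
    qed
  qed simp
  also have "\<dots> = c * (\<Prod>x\<in>I. 1 + (if x \<in> J then 0 else -1))"
    by (simp add: prod_add[OF assms(1)])
  also have "(\<Prod>x\<in>I. 1 + (if x \<in> J then 0 else -1::real)) = (if J = I then 1 else 0)"
  proof (cases "J = I")
    case False
    then show ?thesis
      using assms by (auto intro!: prod_zero)
  qed simp
  finally show ?thesis by simp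
qed

text \<open>Translates between permutations as functions, used in \<open>sym_kernel\<close>, and
  orderings as lists, which index the words. Surjectivity follows from injectivity and equal
  cardinalities.\<close>

lemma sum_permutes_permutations_of_set:
  assumes xs: "distinct xs" "set xs = A"
  shows "(\<Sum>\<pi> | \<pi> permutes A. f (map \<pi> xs)) = (\<Sum>ys\<in>permutations_of_set A. f ys)"
proof (rule sum.reindex_bij_betw)
  have fin: "finite A" using xs by auto
  have inj: "inj_on (\<lambda>\<pi>. map \<pi> xs) {\<pi>. \<pi> permutes A}"
  proof (rule inj_onI, rule ext)
    fix \<pi> \<rho> x assume *: "\<pi> \<in> {\<pi>. \<pi> permutes A}" "\<rho> \<in> {\<pi>. \<pi> permutes A}" "map \<pi> xs = map \<rho> xs"
    show "\<pi> x = \<rho> x"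
      using * xs by (cases "x \<in> A") (auto simp: permutes_not_in)
  qed
  have sub: "(\<lambda>\<pi>. map \<pi> xs) ` {\<pi>. \<pi> permutes A} \<subseteq> permutations_of_set A"
    using xs by (auto simp: permutations_of_set_def permutes_image distinct_map permutes_inj_on)
  have "card ((\<lambda>\<pi>. map \<pi> xs) ` {\<pi>. \<pi> permutes A}) = card (permutations_of_set A)"
    using fin by (simp add: card_image[OF inj] card_permutations)
  then show "bij_betw (\<lambda>\<pi>. map \<pi> xs) {\<pi>. \<pi> permutes A} (permutations_of_set A)"
    using inj card_subset_eq[OF _ sub] by (simp add: bij_betw_def)
qed

text \<open>The centre \<open>N\<close> is an argument of its own because the recursion varies the
  law, hence \<open>N\<close>, while the sample point \<open>v\<close> stays fixed.\<close>

definition chain_kernel :: "('o \<Rightarrow> real ^ 'n ^ 'n) \<Rightarrow> real ^ 'n ^ 'n \<Rightarrow> 'n \<Rightarrow> 'n \<Rightarrow> nat list \<Rightarrow> (nat \<Rightarrow> 'o) \<Rightarrow> real"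
  where "chain_kernel n N a b xs v = chain (matrix_inv N) (\<lambda>s. n (v s) - N) xs $ a $ b"

lemma chain_kernel_permute:
  assumes "set xs \<subseteq> J"
  shows "chain_kernel n N a b xs (\<lambda>s\<in>J. u (\<pi> s)) = chain_kernel n N a b (map \<pi> xs) u"
  unfolding chain_kernel_def chain_map using assms
  by (auto intro!: arg_cong[of _ _ "\<lambda>M. M $ a $ b"] chain_cong)

lemma sym_kernel_chain_kernel:
  assumes "set xs \<subseteq> {1..j}"
  shows "sym_kernel j (chain_kernel n N a b xs) u
    = (\<Sum>\<pi> | \<pi> permutes {1..j}. chain_kernel n N a b (map \<pi> xs) u) / fact j"
  unfolding sym_kernel_def chain_kernel_permute[OF assms] ..

context prob_space
begin

text \<open>Expanding the matrix product from the left splits off a mean-zero function of the first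
  coordinate, summed over the intermediate index; the row \<open>a\<close> is generalized for this
  reason. Distinct labels keep the coordinates of the factors apart.\<close>

lemma chain_kernel_centered_span:
  assumes n: "\<And>i j. (\<lambda>x. n x $ i $ j) \<in> L2 M"
    and N: "\<And>i j. N $ i $ j = (\<integral>x. n x $ i $ j \<partial>M)"
    and "distinct xs"
  shows "chain_kernel n N a b xs \<in> centered_span M (set xs)"
  using assms(3)
proof (induction xs arbitrary: a)
  case Nil
  then show ?case by (simp add: chain_kernel_def centered_span_const)
next
  case (Cons x xs)
  \<comment> \<open>\<open>g k\<close> is entry \<open>(a, k)\<close> of the inverse of
    \<open>N\<close> times the centred statistic.\<close>
  define g where "g k y = (\<Sum>l\<in>UNIV. matrix_inv N $ a $ l * (n y $ l $ k - N $ l $ k))" for k y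
  have g: "g k \<in> L2 M" for k
    unfolding g_def by (intro L2_sum L2_cmult L2_diff n L2_const)
  have "integrable M (\<lambda>y. matrix_inv N $ a $ l * (n y $ l $ k - N $ l $ k))" for l k
    using L2_integrable[OF n] by auto
  then have "(\<integral>y. g k y \<partial>M) = (\<Sum>l\<in>UNIV. (\<integral>y. matrix_inv N $ a $ l * (n y $ l $ k - N $ l $ k) \<partial>M))" for k
    unfolding g_def by (rule Bochner_Integration.integral_sum)
  also have "\<dots> k = 0" for k
    using L2_integrable[OF n] prob_space by (simp add: N)
  finally have g0: "(\<integral>y. g k y \<partial>M) = 0" for k .
  have "chain_kernel n N a b (x # xs) v = (\<Sum>k\<in>UNIV. g k (v x) * chain_kernel n N k b xs v)" for v
    by (simp add: chain_kernel_def g_def matrix_matrix_mult_def)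
  moreover have "(\<lambda>v. \<Sum>k\<in>UNIV. g k (v x) * chain_kernel n N k b xs v) \<in> centered_span M (insert x (set xs))"
    using Cons g g0 by (intro centered_span_sum centered_span_mult) auto
  ultimately show ?case by (simp add: fun_eq_iff[symmetric])
qed

end

text \<open>Integrability of all sections is carried along because \<open>degenerate_kernel\<close>
  is additive only when the integrals exist.\<close>

definition has_degenerate_part ::
    "'o measure \<Rightarrow> nat \<Rightarrow> ((nat \<Rightarrow> 'o) \<Rightarrow> real) \<Rightarrow> ((nat \<Rightarrow> 'o) \<Rightarrow> real) \<Rightarrow> bool" where
  "has_degenerate_part Q j K K' \<longleftrightarrow>
     (\<forall>S v. integrable (Pi\<^sub>M {1..j} (\<lambda>_. Q))
        (\<lambda>w. sym_kernel j K (\<lambda>s\<in>{1..j}. if s \<in> S then v s else w s))) \<and>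
     (\<forall>v. degenerate_kernel Q j K v = K' v)"

lemma has_degenerate_part_zero: "has_degenerate_part Q j (\<lambda>v. 0) (\<lambda>v. 0)"
  by (simp add: has_degenerate_part_def degenerate_kernel_def sym_kernel_def)

lemma has_degenerate_part_add:
  assumes "has_degenerate_part Q j K K'" "has_degenerate_part Q j L L'"
  shows "has_degenerate_part Q j (\<lambda>v. K v + L v) (\<lambda>v. K' v + L' v)"
proof -
  have *: "sym_kernel j (\<lambda>v. K v + L v) u = sym_kernel j K u + sym_kernel j L u" for u
    by (simp add: sym_kernel_def sum.distrib add_divide_distrib)
  show ?thesis
    using assms by (simp add: has_degenerate_part_def degenerate_kernel_def * sum.distrib distrib_left)
qed

lemma has_degenerate_part_cmult:
  assumes "has_degenerate_part Q j K K'"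
  shows "has_degenerate_part Q j (\<lambda>v. c * K v) (\<lambda>v. c * K' v)"
proof -
  have *: "sym_kernel j (\<lambda>v. c * K v) u = c * sym_kernel j K u" for u
    by (simp add: sym_kernel_def sum_distrib_left)
  show ?thesis
    using assms unfolding has_degenerate_part_def degenerate_kernel_def *
    by (simp add: mult.left_commute[of _ c] flip: sum_distrib_left)
qed

lemma has_degenerate_part_sum:
  assumes "\<And>i. i \<in> I \<Longrightarrow> has_degenerate_part Q j (K i) (K' i)"
  shows "has_degenerate_part Q j (\<lambda>v. \<Sum>i\<in>I. K i v) (\<lambda>v. \<Sum>i\<in>I. K' i v)"
  using assms by (induction I rule: infinite_finite_induct)
    (auto intro: has_degenerate_part_zero has_degenerate_part_add)

lemma has_degenerate_part_sum_list:
  assumes "\<And>i. i \<in> set is \<Longrightarrow> has_degenerate_part Q j (K i) (K' i)"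
  shows "has_degenerate_part Q j (\<lambda>v. \<Sum>i\<leftarrow>is. K i v) (\<lambda>v. \<Sum>i\<leftarrow>is. K' i v)"
  using assms by (induction "is")
    (auto intro: has_degenerate_part_zero has_degenerate_part_add)

text \<open>A permuted word is centred in exactly the coordinates it uses, so the alternating sum
  keeps it only if it uses all of \<open>{1..j}\<close>. In that case the sum over permutations runs
  through all orderings.\<close>

lemma (in prob_space) has_degenerate_part_chain_kernel:
  assumes n: "\<And>i j. (\<lambda>x. n x $ i $ j) \<in> L2 M"
    and N: "\<And>i j. N $ i $ j = (\<integral>x. n x $ i $ j \<partial>M)"
    and xs: "distinct xs" "set xs \<subseteq> {1..j}"
  shows "has_degenerate_part M j (chain_kernel n N a b xs)
    (\<lambda>v. if set xs = {1..j}
      then (\<Sum>ys\<in>permutations_of_set {1..j}. chain_kernel n N a b ys v) / fact j else 0)"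
proof -
  let ?C = "chain_kernel n N a b" and ?I = "{1..j}" and ?PI = "Pi\<^sub>M {1..j} (\<lambda>_. M)"
  let ?m = "\<lambda>S v w. \<lambda>s\<in>?I. if s \<in> S then v s else w s"
  have img: "\<pi> ` set xs \<subseteq> ?I" if "\<pi> permutes ?I" for \<pi>
    using image_mono[OF xs(2), of \<pi>] permutes_image[OF that] by simp
  have sec: "integrable ?PI (\<lambda>w. ?C (map \<pi> xs) (?m S v w)) \<and>
    (\<integral>w. ?C (map \<pi> xs) (?m S v w) \<partial>?PI) = (if \<pi> ` set xs \<subseteq> S then ?C (map \<pi> xs) v else 0)"
    if "\<pi> permutes ?I" for \<pi> S v
  proof -
    have "distinct (map \<pi> xs)" "set (map \<pi> xs) \<subseteq> ?I"
      using xs(1) img[OF that] that by (simp_all add: distinct_map permutes_inj_on)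
    then show ?thesis
      using centered_span_section[OF chain_kernel_centered_span[OF n N], of "map \<pi> xs" ?I a b S v]
      by simp
  qed
  have "degenerate_kernel M j (?C xs) v = (if set xs = ?I
      then (\<Sum>ys\<in>permutations_of_set ?I. ?C ys v) / fact j else 0)" for v
  proof -
    have "degenerate_kernel M j (?C xs) v = (\<Sum>S\<in>Pow ?I. (-1) ^ (j - card S) *
        ((\<Sum>\<pi> | \<pi> permutes ?I. if \<pi> ` set xs \<subseteq> S then ?C (map \<pi> xs) v else 0) / fact j))"
      unfolding degenerate_kernel_def sym_kernel_chain_kernel[OF xs(2)]
      using sec by simp
    also have "\<dots> = (\<Sum>S\<in>Pow ?I. (\<Sum>\<pi> | \<pi> permutes ?I.
        (-1) ^ (card ?I - card S) * (if \<pi> ` set xs \<subseteq> S then ?C (map \<pi> xs) v else 0))) / fact j"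
      by (simp add: sum_distrib_left sum_divide_distrib)
    also have "\<dots> = (\<Sum>\<pi> | \<pi> permutes ?I. (\<Sum>S\<in>Pow ?I.
        (-1) ^ (card ?I - card S) * (if \<pi> ` set xs \<subseteq> S then ?C (map \<pi> xs) v else 0))) / fact j"
      by (subst sum.swap) simp
    also have "\<dots> = (\<Sum>\<pi> | \<pi> permutes ?I. if \<pi> ` set xs = ?I then ?C (map \<pi> xs) v else 0) / fact j"
      using img by (subst sum.cong[OF refl alternating_sum_supersets]) auto
    also have "\<dots> = (\<Sum>\<pi> | \<pi> permutes ?I. if set xs = ?I then ?C (map \<pi> xs) v else 0) / fact j"
    proof -
      have "\<pi> ` set xs = ?I \<longleftrightarrow> set xs = ?I" if "\<pi> permutes ?I" for \<pi>
        using that permutes_image[OF that] inj_image_eq_iff[OF permutes_inj[OF that]] by metis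
      then show ?thesis by (intro arg_cong2[where f = "(/)"] sum.cong) auto
    qed
    also have "\<dots> = (if set xs = ?I
        then (\<Sum>ys\<in>permutations_of_set ?I. ?C ys v) / fact j else 0)"
      using sum_permutes_permutations_of_set[OF xs(1), of ?I "\<lambda>ys. ?C ys v"] by simp
    finally show ?thesis .
  qed
  moreover have "integrable ?PI (\<lambda>w. sym_kernel j (?C xs) (?m S v w))" for S v
    unfolding sym_kernel_chain_kernel[OF xs(2)] using sec
    by (intro integrable_divide_zero Bochner_Integration.integrable_sum) auto
  ultimately show ?thesis
    by (simp add: has_degenerate_part_def)
qed

section \<open>Influence functions of an entry of an inverse matrix\<close>

lemma influence_function_cong:
  assumes "influence_function P \<Theta> \<phi> \<theta> f" "\<And>\<theta>. \<theta> \<in> \<Theta> \<Longrightarrow> \<phi> \<theta> = \<phi>' \<theta>"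
  shows "influence_function P \<Theta> \<phi>' \<theta> f"
  unfolding influence_function_def
proof (intro conjI allI impI)
  fix \<gamma> g assume reg: "regular_submodel P \<Theta> \<theta> \<gamma> g"
  have "\<forall>\<^sub>F t in nhds 0. \<gamma> t \<in> \<Theta>"
    using reg by (simp add: regular_submodel_def)
  then have ev: "\<forall>\<^sub>F t in nhds 0. \<phi> (\<gamma> t) = \<phi>' (\<gamma> t)"
    by (rule eventually_mono) (use assms in auto)
  have "((\<lambda>t. \<phi> (\<gamma> t)) has_real_derivative (\<integral>x. f x * g x \<partial>P \<theta>)) (at 0)"
    using assms(1) reg by (simp add: influence_function_def)
  then show "((\<lambda>t. \<phi>' (\<gamma> t)) has_real_derivative (\<integral>x. f x * g x \<partial>P \<theta>)) (at 0)"
    using DERIV_cong_ev[OF refl ev refl] by simp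
qed (use assms(1) in \<open>auto simp: influence_function_def\<close>)

lemma influence_function_zero: "influence_function P \<Theta> (\<lambda>_. 0) \<theta> (\<lambda>_. 0)"
  by (simp add: influence_function_def L2_zero)

lemma influence_function_cmult:
  "influence_function P \<Theta> \<phi> \<theta> f \<Longrightarrow> influence_function P \<Theta> (\<lambda>\<theta>. c * \<phi> \<theta>) \<theta> (\<lambda>x. c * f x)"
  by (auto simp: influence_function_def mult.assoc intro!: L2_cmult DERIV_cmult)

lemma influence_function_add:
  assumes "prob_space (P \<theta>)" "influence_function P \<Theta> \<phi> \<theta> f" "influence_function P \<Theta> \<phi>' \<theta> f'"
  shows "influence_function P \<Theta> (\<lambda>\<theta>. \<phi> \<theta> + \<phi>' \<theta>) \<theta> (\<lambda>x. f x + f' x)"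
proof -
  interpret prob_space "P \<theta>" by (rule assms(1))
  have L: "f \<in> L2 (P \<theta>)" "f' \<in> L2 (P \<theta>)"
    using assms by (auto simp: influence_function_def)
  show ?thesis
    unfolding influence_function_def
  proof (intro conjI allI impI)
    fix \<gamma> g assume reg: "regular_submodel P \<Theta> \<theta> \<gamma> g"
    then have g: "g \<in> L2 (P \<theta>)" by (simp add: regular_submodel_def)
    have "(\<integral>x. (f x + f' x) * g x \<partial>P \<theta>) = (\<integral>x. f x * g x \<partial>P \<theta>) + (\<integral>x. f' x * g x \<partial>P \<theta>)"
      using L2_mult_integrable[OF L(1) g] L2_mult_integrable[OF L(2) g] by (simp add: distrib_right)
    then show "((\<lambda>t. \<phi> (\<gamma> t) + \<phi>' (\<gamma> t)) has_real_derivative (\<integral>x. (f x + f' x) * g x \<partial>P \<theta>)) (at 0)"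
      using assms reg by (auto simp: influence_function_def intro!: DERIV_add)
  qed (use assms L L2_integrable in \<open>auto simp: influence_function_def intro: L2_add\<close>)
qed

lemma influence_function_sum:
  assumes "prob_space (P \<theta>)" "\<And>i. i \<in> I \<Longrightarrow> influence_function P \<Theta> (\<phi> i) \<theta> (f i)"
  shows "influence_function P \<Theta> (\<lambda>\<theta>. \<Sum>i\<in>I. \<phi> i \<theta>) \<theta> (\<lambda>x. \<Sum>i\<in>I. f i x)"
  using assms by (induction I rule: infinite_finite_induct)
    (auto intro: influence_function_zero influence_function_add)

lemma L2_sum_list: "(\<And>i. i \<in> set is \<Longrightarrow> f i \<in> L2 M) \<Longrightarrow> (\<lambda>x. \<Sum>i\<leftarrow>is. f i x) \<in> L2 M"
  by (induction "is") (auto intro: L2_zero L2_add)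

lemma sum_list_matrix_component:
  "sum_list (map f xs) $ a $ b = (\<Sum>x\<leftarrow>xs. (f x :: real ^ 'k ^ 'm) $ a $ b)"
  by (induction xs) auto

text \<open>The letter \<open>y\<close> occurs exactly once, so the entry is linear in the matrix
  put in its place. This lets an integral pass into that slot.\<close>

lemma chain_linear:
  assumes "distinct ys" "y \<in> set ys"
  shows "\<exists>c. \<forall>W. chain \<Lambda> (A(y := W)) ys $ a $ b = (\<Sum>i\<in>UNIV. \<Sum>j\<in>UNIV. c i j * W $ i $ j)"
  using assms
proof (induction ys arbitrary: a)
  case (Cons x ys)
  show ?case
  proof (cases "x = y")
    case True
    then have eq: "chain \<Lambda> (A(y := W)) ys = chain \<Lambda> A ys" for W
      using Cons.prems by (intro chain_cong) auto
    have lin: "chain \<Lambda> (A(y := W)) (x # ys) $ a $ b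
        = (\<Sum>i\<in>UNIV. \<Sum>j\<in>UNIV. (\<Lambda> $ a $ i * chain \<Lambda> A ys $ j $ b) * W $ i $ j)" for W
      unfolding chain.simps eq using True
      by (simp add: matrix_matrix_mult_def sum_distrib_right, subst sum.swap) (simp add: mult_ac)
    show ?thesis by (rule exI, rule allI, rule lin)
  next
    case False
    then have "\<forall>k. \<exists>c. \<forall>W. chain \<Lambda> (A(y := W)) ys $ k $ b = (\<Sum>i\<in>UNIV. \<Sum>j\<in>UNIV. c i j * W $ i $ j)"
      using Cons.IH Cons.prems False by (auto simp del: fun_upd_apply)
    from choice[OF this] obtain c where c: "\<forall>k. \<forall>W. chain \<Lambda> (A(y := W)) ys $ k $ b = (\<Sum>i\<in>UNIV. \<Sum>j\<in>UNIV. c k i j * W $ i $ j)"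
      by blast
    have lin: "chain \<Lambda> (A(y := W)) (x # ys) $ a $ b
        = (\<Sum>i\<in>UNIV. \<Sum>j\<in>UNIV. (\<Sum>k\<in>UNIV. (\<Lambda> ** A x) $ a $ k * c k i j) * W $ i $ j)" for W
    proof -
      have "chain \<Lambda> (A(y := W)) (x # ys) $ a $ b = (\<Sum>k\<in>UNIV. (\<Lambda> ** A x) $ a $ k *
          (\<Sum>i\<in>UNIV. \<Sum>j\<in>UNIV. c k i j * W $ i $ j))"
        using False by (simp add: matrix_matrix_mult_def[of "_ ** _"] c)
      also have "\<dots> = (\<Sum>k\<in>UNIV. \<Sum>i\<in>UNIV. \<Sum>j\<in>UNIV. (\<Lambda> ** A x) $ a $ k * c k i j * W $ i $ j)"
        by (simp add: sum_distrib_left mult.assoc)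
      also have "\<dots> = (\<Sum>i\<in>UNIV. \<Sum>k\<in>UNIV. \<Sum>j\<in>UNIV. (\<Lambda> ** A x) $ a $ k * c k i j * W $ i $ j)"
        by (rule sum.swap)
      also have "\<dots> = (\<Sum>i\<in>UNIV. \<Sum>j\<in>UNIV. \<Sum>k\<in>UNIV. (\<Lambda> ** A x) $ a $ k * c k i j * W $ i $ j)"
        by (intro sum.cong refl sum.swap)
      finally show ?thesis
        by (simp add: sum_distrib_right)
    qed
    show ?thesis by (rule exI, rule allI, rule lin)
  qed
qed simp

section \<open>Solving the recursion for an entry of the inverse of a mean\<close>

definition mean_matrix :: "'o measure \<Rightarrow> ('o \<Rightarrow> real ^ 'n ^ 'm) \<Rightarrow> real ^ 'n ^ 'm" where
  "mean_matrix Q n = (\<chi> i j. \<integral>x. n x $ i $ j \<partial>Q)"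

text \<open>Isolates the setting of the recursion from the doubly robust structure. The conditions
  are imposed at every law because the kernels are differentiated at every law.\<close>

locale matrix_mean_model =
  fixes P :: "'t \<Rightarrow> 'o measure" and \<Theta> :: "'t set" and n :: "'o \<Rightarrow> real ^ 'n ^ 'n"
  assumes prob: "\<theta> \<in> \<Theta> \<Longrightarrow> prob_space (P \<theta>)"
    and n_L2: "\<theta> \<in> \<Theta> \<Longrightarrow> (\<lambda>x. n x $ i $ j) \<in> L2 (P \<theta>)"
    and invertible_mean: "\<theta> \<in> \<Theta> \<Longrightarrow> invertible (mean_matrix (P \<theta>) n)"
begin

abbreviation N where "N \<theta> \<equiv> mean_matrix (P \<theta>) n"

text \<open>By linearity in the slot \<open>y\<close> the integral over \<open>x\<close> is taken
  inside the product. Against a mean-zero \<open>g\<close> the centring disappears, which leaves in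
  the slot the derivative of the mean in direction \<open>g\<close>.\<close>

lemma chain_kernel_single_variable:
  assumes \<theta>: "\<theta> \<in> \<Theta>" and ys: "distinct ys" "y \<in> set ys"
  shows "(\<lambda>x. chain_kernel n (N \<theta>) a b ys (v(y := x))) \<in> L2 (P \<theta>)"
    and "(\<integral>x. chain_kernel n (N \<theta>) a b ys (v(y := x)) \<partial>P \<theta>) = 0"
    and "g \<in> L2 (P \<theta>) \<Longrightarrow> (\<integral>x. g x \<partial>P \<theta>) = 0 \<Longrightarrow>
      (\<integral>x. chain_kernel n (N \<theta>) a b ys (v(y := x)) * g x \<partial>P \<theta>)
      = chain (matrix_inv (N \<theta>)) ((\<lambda>s. n (v s) - N \<theta>)(y := (\<chi> i j. \<integral>x. n x $ i $ j * g x \<partial>P \<theta>))) ys $ a $ b"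
proof -
  interpret prob_space "P \<theta>" using prob \<theta> by blast
  let ?\<Lambda> = "matrix_inv (N \<theta>)" and ?A = "\<lambda>s. n (v s) - N \<theta>"
  obtain c where c: "\<And>W. chain ?\<Lambda> (?A(y := W)) ys $ a $ b = (\<Sum>i\<in>UNIV. \<Sum>j\<in>UNIV. c i j * W $ i $ j)"
    using chain_linear[OF ys] by blast
  have "(\<lambda>s. n ((v(y := x)) s) - N \<theta>) = ?A(y := n x - N \<theta>)" for x
    by auto
  then have eq: "chain_kernel n (N \<theta>) a b ys (v(y := x))
      = (\<Sum>i\<in>UNIV. \<Sum>j\<in>UNIV. c i j * (n x $ i $ j - N \<theta> $ i $ j))" for x
    unfolding chain_kernel_def by (simp add: c)
  have L: "(\<lambda>x. n x $ i $ j - N \<theta> $ i $ j) \<in> L2 (P \<theta>)" for i j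
    by (intro L2_diff n_L2 \<theta> L2_const)
  show "(\<lambda>x. chain_kernel n (N \<theta>) a b ys (v(y := x))) \<in> L2 (P \<theta>)"
    unfolding eq by (intro L2_sum L2_cmult L)
  have int: "integrable (P \<theta>) (\<lambda>x. n x $ i $ j - N \<theta> $ i $ j)"
      "integrable (P \<theta>) (\<lambda>x. n x $ i $ j)" for i j
    using L L2_integrable n_L2[OF \<theta>] by blast+
  show "(\<integral>x. chain_kernel n (N \<theta>) a b ys (v(y := x)) \<partial>P \<theta>) = 0"
    unfolding eq using int prob_space by (simp add: mean_matrix_def)
  assume g: "g \<in> L2 (P \<theta>)" "(\<integral>x. g x \<partial>P \<theta>) = 0"
  have "(\<integral>x. (n x $ i $ j - N \<theta> $ i $ j) * g x \<partial>P \<theta>) = (\<integral>x. n x $ i $ j * g x \<partial>P \<theta>)" for i j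
    using L2_mult_integrable[OF n_L2[OF \<theta>] g(1)] L2_integrable[OF g(1)] g(2)
    by (simp add: left_diff_distrib)
  moreover have "integrable (P \<theta>) (\<lambda>x. (n x $ i $ j - N \<theta> $ i $ j) * g x)" for i j
    using L2_mult_integrable[OF L g(1)] .
  ultimately show "(\<integral>x. chain_kernel n (N \<theta>) a b ys (v(y := x)) * g x \<partial>P \<theta>)
      = chain ?\<Lambda> (?A(y := (\<chi> i j. \<integral>x. n x $ i $ j * g x \<partial>P \<theta>))) ys $ a $ b"
    unfolding eq c by (simp add: sum_distrib_right mult.assoc)
qed

text \<open>Along a path with score \<open>g\<close> the product rule puts the mean of
  \<open>n\<close> times \<open>g\<close> in slot \<open>y\<close>. Putting the centred statistic at
  \<open>x\<close> there instead gives a mean-zero function of \<open>x\<close> whose integral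
  against \<open>g\<close> is that derivative.\<close>

lemma influence_function_chain_kernel:
  assumes \<theta>: "\<theta> \<in> \<Theta>" and xs: "distinct xs" "y \<notin> set xs"
  shows "influence_function P \<Theta> (\<lambda>\<theta>'. chain_kernel n (N \<theta>') a b xs v) \<theta>
    (\<lambda>x. (-1) * ((\<Sum>ys\<leftarrow>insertions y xs. chain_kernel n (N \<theta>) a b ys (v(y := x)))
      + (\<Sum>ys\<leftarrow>replacements y xs. chain_kernel n (N \<theta>) a b ys (v(y := x)))))"
proof -
  interpret prob_space "P \<theta>" using prob \<theta> by blast
  let ?yss = "insertions y xs @ replacements y xs"
  let ?F = "\<lambda>x. \<Sum>ys\<leftarrow>?yss. chain_kernel n (N \<theta>) a b ys (v(y := x))"
  have ys: "distinct ys" "y \<in> set ys" if "ys \<in> set ?yss" for ys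
  proof -
    show "y \<in> set ys"
      using that by (auto dest: insertionsD replacementsD)
    \<comment> \<open>An insertion has as many letters as labels, so no label repeats.\<close>
    have "distinct ys" if "ys \<in> set (insertions y xs)"
      using insertionsD[OF that] xs by (metis card_distinct card_insert_disjoint distinct_card finite_set)
    then show "distinct ys"
      using that replacements_distinct[OF _ xs] by auto
  qed
  note single = chain_kernel_single_variable[OF \<theta> ys, where a = a and b = b and v = v]
  have F: "?F \<in> L2 (P \<theta>)"
    by (intro L2_sum_list single)
  have lin: "(\<integral>x. (\<Sum>ys\<leftarrow>yss. chain_kernel n (N \<theta>) a b ys (v(y := x))) * g x \<partial>P \<theta>)
      = (\<Sum>ys\<leftarrow>yss. \<integral>x. chain_kernel n (N \<theta>) a b ys (v(y := x)) * g x \<partial>P \<theta>)"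
    if "set yss \<subseteq> set ?yss" "g \<in> L2 (P \<theta>)" for g yss
    using that(1)
  proof (induction yss)
    case (Cons zs zss)
    have "integrable (P \<theta>) (\<lambda>x. chain_kernel n (N \<theta>) a b zs (v(y := x)) * g x)"
      using Cons.prems that(2) by (intro L2_mult_integrable single) auto
    moreover have "integrable (P \<theta>) (\<lambda>x. (\<Sum>ys\<leftarrow>zss. chain_kernel n (N \<theta>) a b ys (v(y := x))) * g x)"
      using Cons.prems that(2) by (intro L2_mult_integrable L2_sum_list single) auto
    ultimately show ?case
      using Cons by (simp add: distrib_right del: fun_upd_apply)
  qed simp
  have "influence_function P \<Theta> (\<lambda>\<theta>'. chain_kernel n (N \<theta>') a b xs v) \<theta> (\<lambda>x. (-1) * ?F x)"
    unfolding influence_function_def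
  proof (intro conjI allI impI)
    show "(\<lambda>x. (-1) * ?F x) \<in> L2 (P \<theta>)"
      by (intro L2_cmult F)
    have "(\<integral>x. ?F x \<partial>P \<theta>) = 0"
      using lin[OF order.refl L2_const[of 1]] single(2) by (simp cong: map_cong)
    then show "(\<integral>x. (-1) * ?F x \<partial>P \<theta>) = 0"
      by (simp only: integral_mult_right_zero mult_zero_right)
    fix \<gamma> g assume reg: "regular_submodel P \<Theta> \<theta> \<gamma> g"
    then have g: "g \<in> L2 (P \<theta>)" and \<gamma>0: "\<gamma> 0 = \<theta>" and \<gamma>: "\<forall>\<^sub>F t in nhds 0. \<gamma> t \<in> \<Theta>"
      by (auto simp: regular_submodel_def)
    have g0: "(\<integral>x. g x \<partial>P \<theta>) = 0"
      by (rule regular_submodel_score_mean[OF reg prob \<theta>])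
    define V where "V = (\<chi> i j. \<integral>x. n x $ i $ j * g x \<partial>P \<theta>)"
    have "has_entrywise_derivative (\<lambda>t. N (\<gamma> t)) V"
      using regular_submodel_expectation[OF reg prob[OF \<theta>] n_L2[OF \<theta>]]
      by (simp add: has_entrywise_derivative_def mean_matrix_def V_def)
    moreover have "\<forall>\<^sub>F t in nhds 0. invertible (N (\<gamma> t))"
      using \<gamma> by (rule eventually_mono) (rule invertible_mean)
    ultimately have "has_entrywise_derivative (\<lambda>t. chain (matrix_inv (N (\<gamma> t))) (\<lambda>s. n (v s) - N (\<gamma> t)) xs)
      (- (\<Sum>ys\<leftarrow>insertions y xs. chain (matrix_inv (N (\<gamma> 0))) ((\<lambda>s. n (v s) - N (\<gamma> 0))(y := V)) ys)
       - (\<Sum>ys\<leftarrow>replacements y xs. chain (matrix_inv (N (\<gamma> 0))) ((\<lambda>s. n (v s) - N (\<gamma> 0))(y := V)) ys))"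
      using xs(2) by (rule has_entrywise_derivative_chain)
    then have "((\<lambda>t. chain_kernel n (N (\<gamma> t)) a b xs v) has_real_derivative
      (- (\<Sum>ys\<leftarrow>insertions y xs. chain (matrix_inv (N \<theta>)) ((\<lambda>s. n (v s) - N \<theta>)(y := V)) ys)
       - (\<Sum>ys\<leftarrow>replacements y xs. chain (matrix_inv (N \<theta>)) ((\<lambda>s. n (v s) - N \<theta>)(y := V)) ys)) $ a $ b) (at 0)"
      by (simp add: has_entrywise_derivative_def chain_kernel_def \<gamma>0)
    moreover have "(\<integral>x. (-1) * ?F x * g x \<partial>P \<theta>)
      = (- (\<Sum>ys\<leftarrow>insertions y xs. chain (matrix_inv (N \<theta>)) ((\<lambda>s. n (v s) - N \<theta>)(y := V)) ys)
       - (\<Sum>ys\<leftarrow>replacements y xs. chain (matrix_inv (N \<theta>)) ((\<lambda>s. n (v s) - N \<theta>)(y := V)) ys)) $ a $ b"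
    proof -
      have "(\<integral>x. (-1) * ?F x * g x \<partial>P \<theta>) = (-1) * (\<Sum>ys\<leftarrow>?yss. \<integral>x. chain_kernel n (N \<theta>) a b ys (v(y := x)) * g x \<partial>P \<theta>)"
        by (simp only: mult.assoc integral_mult_right_zero lin[OF order.refl g])
      also have "\<dots> = - (\<Sum>ys\<leftarrow>?yss. chain (matrix_inv (N \<theta>)) ((\<lambda>s. n (v s) - N \<theta>)(y := V)) ys $ a $ b)"
        using single(3)[OF _ _ g g0] unfolding V_def by (simp cong: map_cong)
      finally show ?thesis
        by (simp add: sum_list_matrix_component)
    qed
    ultimately show "((\<lambda>t. chain_kernel n (N (\<gamma> t)) a b xs v) has_real_derivative (\<integral>x. (-1) * ?F x * g x \<partial>P \<theta>)) (at 0)"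
      by simp
  qed
  then show ?thesis by simp
qed

text \<open>This is \<open>\<kappa> * (-1) ^ j\<close> times the symmetrized alternating product of
  order \<open>j\<close>, given at every law at once as the recursion demands.\<close>

definition inverse_kernel :: "real \<Rightarrow> 'n \<Rightarrow> 'n \<Rightarrow> nat \<Rightarrow> 't \<Rightarrow> (nat \<Rightarrow> 'o) \<Rightarrow> real" where
  "inverse_kernel \<kappa> a b j \<theta> v = \<kappa> * (-1) ^ j / fact j *
     (\<Sum>xs\<in>permutations_of_set {1..j}. chain_kernel n (N \<theta>) a b xs v)"

theorem hoif_kernels_inverse:
  assumes \<phi>: "\<And>\<theta>. \<theta> \<in> \<Theta> \<Longrightarrow> \<phi> \<theta> = \<kappa> * matrix_inv (N \<theta>) $ a $ b"
  shows "hoif_kernels P \<Theta> \<phi> m (inverse_kernel \<kappa> a b)"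
  unfolding hoif_kernels_def
proof (intro conjI ballI)
  fix \<theta> assume \<theta>: "\<theta> \<in> \<Theta>"
  \<comment> \<open>The empty word is the entry of the inverse itself, so order one is the insertion
    of the label 1 into it; the point \<open>v\<close> is immaterial and is later set to
    \<open>undefined\<close>.\<close>
  have "influence_function P \<Theta> (\<lambda>\<theta>'. \<kappa> * chain_kernel n (N \<theta>') a b [] v) \<theta>
      (\<lambda>x. \<kappa> * ((-1) * (chain_kernel n (N \<theta>) a b [1] (v(1 := x)))))" for v
    using influence_function_cmult[OF influence_function_chain_kernel[OF \<theta>, of "[]" 1]] by simp
  then have "influence_function P \<Theta> \<phi> \<theta> (\<lambda>x. \<kappa> * ((-1) * (chain_kernel n (N \<theta>) a b [1] (undefined(1 := x)))))"
    by (rule influence_function_cong) (simp add: \<phi> chain_kernel_def)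
  then show "influence_function P \<Theta> \<phi> \<theta> (\<lambda>x. inverse_kernel \<kappa> a b 1 \<theta> (\<lambda>s\<in>{1..1}. x))"
    by (simp add: inverse_kernel_def chain_kernel_def)
next
  fix j assume j: "j \<in> {2..m}"
  then obtain i where i: "j = Suc i" by (cases j) auto
  \<comment> \<open>An everywhere defined version of the influence function of the kernel of order
    \<open>i\<close>, with the new observation in coordinate \<open>j = i + 1\<close>.\<close>
  define D where "D \<theta> v = \<kappa> * (-1) ^ i / fact i * (\<Sum>xs\<in>permutations_of_set {1..i}.
      (-1) * ((\<Sum>ys\<leftarrow>insertions j xs. chain_kernel n (N \<theta>) a b ys v)
      + (\<Sum>ys\<leftarrow>replacements j xs. chain_kernel n (N \<theta>) a b ys v)))" for \<theta> v
  show "\<exists>D. \<forall>\<theta>\<in>\<Theta>.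
        (\<forall>v \<in> space (Pi\<^sub>M {1..j - 1} (\<lambda>_. P \<theta>)).
           influence_function P \<Theta> (\<lambda>\<theta>'. inverse_kernel \<kappa> a b (j - 1) \<theta>' v) \<theta> (\<lambda>x. D \<theta> (v(j := x)))) \<and>
        D \<theta> \<in> L2 (Pi\<^sub>M {1..j} (\<lambda>_. P \<theta>)) \<and>
        (\<forall>v \<in> space (Pi\<^sub>M {1..j} (\<lambda>_. P \<theta>)).
           real j * inverse_kernel \<kappa> a b j \<theta> v = degenerate_kernel (P \<theta>) j (D \<theta>) v)"
  proof (intro exI[of _ D] ballI conjI)
    fix \<theta> v assume \<theta>: "\<theta> \<in> \<Theta>"
    show "influence_function P \<Theta> (\<lambda>\<theta>'. inverse_kernel \<kappa> a b (j - 1) \<theta>' v) \<theta> (\<lambda>x. D \<theta> (v(j := x)))"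
      unfolding inverse_kernel_def D_def i diff_Suc_1 using \<theta>
      by (intro influence_function_cmult influence_function_sum influence_function_chain_kernel prob)
         (auto dest: permutations_of_setD)
  next
    fix \<theta> assume \<theta>: "\<theta> \<in> \<Theta>"
    interpret prob_space "P \<theta>" using prob \<theta> by blast
    have N: "N \<theta> $ i $ j = (\<integral>x. n x $ i $ j \<partial>P \<theta>)" for i j
      by (simp add: mean_matrix_def)
    have ins: "distinct ys" "set ys = {1..j}"
      if "ys \<in> set (insertions j xs)" "xs \<in> permutations_of_set {1..i}" for xs ys
    proof -
      have xs: "distinct xs" "set xs = {1..i}" using that(2) by (auto dest: permutations_of_setD)
      then show "set ys = {1..j}"
        using insertionsD[OF that(1)] i by auto
      moreover have "length xs = i" using distinct_card[OF xs(1)] xs(2) by simp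
      ultimately show "distinct ys"
        using insertionsD[OF that(1)] i by (intro card_distinct) simp
    qed
    \<comment> \<open>A replacement has only \<open>i = j - 1\<close> letters, so it misses a
      coordinate of \<open>{1..j}\<close>.\<close>
    have rep: "distinct ys" "set ys \<subseteq> {1..j}" "set ys \<noteq> {1..j}"
      if "ys \<in> set (replacements j xs)" "xs \<in> permutations_of_set {1..i}" for xs ys
    proof -
      have xs: "distinct xs" "set xs = {1..i}" using that(2) by (auto dest: permutations_of_setD)
      then show "set ys \<subseteq> {1..j}"
        using replacementsD[OF that(1)] i by auto
      show "distinct ys"
        using xs i by (intro replacements_distinct[OF that(1)]) auto
      have "length xs = i" using distinct_card[OF xs(1)] xs(2) by simp
      then show "set ys \<noteq> {1..j}"
        using replacementsD[OF that(1)] i distinct_card[OF \<open>distinct ys\<close>] by auto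
    qed
    have L: "chain_kernel n (N \<theta>) a b ys \<in> L2 (Pi\<^sub>M {1..j} (\<lambda>_. P \<theta>))"
      if "distinct ys" "set ys \<subseteq> {1..j}" for ys
      using that by (intro centered_span_L2[OF chain_kernel_centered_span] n_L2 N \<theta>) auto
    show "D \<theta> \<in> L2 (Pi\<^sub>M {1..j} (\<lambda>_. P \<theta>))"
      unfolding D_def using ins rep
      by (intro L2_cmult L2_sum L2_add L2_sum_list L) auto
    fix v
    let ?R = "\<lambda>v. (\<Sum>ys\<in>permutations_of_set {1..j}. chain_kernel n (N \<theta>) a b ys v) / fact j"
    have "has_degenerate_part (P \<theta>) j (chain_kernel n (N \<theta>) a b ys) ?R"
      if "ys \<in> set (insertions j xs)" "xs \<in> permutations_of_set {1..i}" for xs ys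
      using has_degenerate_part_chain_kernel[OF n_L2[OF \<theta>] N, of ys j a b] ins[OF that] by simp
    moreover have "has_degenerate_part (P \<theta>) j (chain_kernel n (N \<theta>) a b ys) (\<lambda>v. 0)"
      if "ys \<in> set (replacements j xs)" "xs \<in> permutations_of_set {1..i}" for xs ys
      using has_degenerate_part_chain_kernel[OF n_L2[OF \<theta>] N, of ys j a b] rep[OF that] by simp
    ultimately have "has_degenerate_part (P \<theta>) j (D \<theta>)
      (\<lambda>v. \<kappa> * (-1) ^ i / fact i * (\<Sum>xs\<in>permutations_of_set {1..i}.
         (-1) * ((\<Sum>ys\<leftarrow>insertions j xs. ?R v) + (\<Sum>ys\<leftarrow>replacements j xs. 0))))"
      unfolding D_def
      by (intro has_degenerate_part_cmult has_degenerate_part_sum has_degenerate_part_add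
          has_degenerate_part_sum_list)
    then have "degenerate_kernel (P \<theta>) j (D \<theta>) v = \<kappa> * (-1) ^ i / fact i * (\<Sum>xs\<in>permutations_of_set {1..i}.
         (-1) * ((\<Sum>ys\<leftarrow>insertions j xs. ?R v) + (\<Sum>ys\<leftarrow>replacements j xs. 0)))"
      by (simp only: has_degenerate_part_def)
    \<comment> \<open>Each ordering admits exactly \<open>j\<close> insertions, all with the same
      degenerate part; summing over the \<open>fact i\<close> orderings then cancels
      \<open>1 / fact i\<close>.\<close>
    also have "\<dots> = \<kappa> * (-1) ^ i / fact i * (\<Sum>xs\<in>permutations_of_set {1..i}. - (real j * ?R v))"
    proof -
      have "length (insertions j xs) = j" if "xs \<in> permutations_of_set {1..i}" for xs
        using length_finite_permutations_of_set[OF that] i by (simp add: length_insertions)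
      then show ?thesis
        by (intro arg_cong2[where f = "(*)"] sum.cong refl) (simp add: sum_list_triv)
    qed
    also have "\<dots> = real j * inverse_kernel \<kappa> a b j \<theta> v"
      by (simp add: inverse_kernel_def i)
    finally show "real j * inverse_kernel \<kappa> a b j \<theta> v = degenerate_kernel (P \<theta>) j (D \<theta>) v" ..
  qed
qed

end

section \<open>U-statistics\<close>

text \<open>Permuting the positions is a bijection of the injective index tuples, so every term of
  the symmetrization has the same sum. The restrictions keep the tuples extensional.\<close>

lemma ustat_sym_kernel: "ustat n j (sym_kernel j K) \<omega> = ustat n j K \<omega>"
proof -
  let ?I = "{i \<in> {1..j} \<rightarrow>\<^sub>E {1..n}. inj_on i {1..j}}"
  have step: "(\<Sum>i\<in>?I. K (\<lambda>s\<in>{1..j}. (\<lambda>s\<in>{1..j}. \<omega> (i s)) (\<pi> s))) = (\<Sum>i\<in>?I. K (\<lambda>s\<in>{1..j}. \<omega> (i s)))"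
    if \<pi>: "\<pi> permutes {1..j}" for \<pi>
  proof -
    have sub: "(\<lambda>s\<in>{1..j}. i (\<rho> s)) \<in> ?I" if i: "i \<in> ?I" and \<rho>: "\<rho> permutes {1..j}" for i \<rho>
    proof -
      have in_I: "\<rho> s \<in> {1..j}" if "s \<in> {1..j}" for s
        using permutes_in_image[OF \<rho>, of s] that by blast
      have "inj_on (i \<circ> \<rho>) {1..j}"
        using i permutes_image[OF \<rho>] permutes_inj_on[OF \<rho>] by (intro comp_inj_on) auto
      then have "inj_on (\<lambda>s\<in>{1..j}. i (\<rho> s)) {1..j}"
        by (subst inj_on_cong[where g = "i \<circ> \<rho>"]) simp_all
      moreover have "i \<in> {1..j} \<rightarrow>\<^sub>E {1..n}"
        using i by blast
      then have "(\<lambda>s\<in>{1..j}. i (\<rho> s)) \<in> {1..j} \<rightarrow>\<^sub>E {1..n}"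
        unfolding restrict_PiE_iff using in_I PiE_mem by blast
      ultimately show ?thesis by blast
    qed
    have round: "(\<lambda>s\<in>{1..j}. (\<lambda>s\<in>{1..j}. i (\<rho> s)) (\<sigma> s)) = i"
      if "i \<in> ?I" "\<sigma> permutes {1..j}" "\<And>s. \<rho> (\<sigma> s) = s" for i \<rho> \<sigma>
    proof
      fix s
      show "(\<lambda>s\<in>{1..j}. (\<lambda>s\<in>{1..j}. i (\<rho> s)) (\<sigma> s)) s = i s"
      proof (cases "s \<in> {1..j}")
        case True
        then have "\<sigma> s \<in> {1..j}"
          using permutes_in_image[OF that(2), of s] by blast
        with True show ?thesis by (simp only: restrict_apply that(3) if_True)
      next
        case False
        have i: "i \<in> {1..j} \<rightarrow>\<^sub>E {1..n}"
          using that(1) by blast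
        show ?thesis
          unfolding PiE_arb[OF i False] using False by (simp only: restrict_apply if_False)
      qed
    qed
    show ?thesis
    proof (rule sum.reindex_bij_witness[where i = "\<lambda>i. \<lambda>s\<in>{1..j}. i (inv \<pi> s)" and j = "\<lambda>i. \<lambda>s\<in>{1..j}. i (\<pi> s)"])
      fix i assume i: "i \<in> ?I"
      show "(\<lambda>s\<in>{1..j}. (\<lambda>s\<in>{1..j}. i (\<pi> s)) (inv \<pi> s)) = i"
        by (rule round[OF i permutes_inv[OF \<pi>]]) (simp add: permutes_inverses[OF \<pi>])
      show "(\<lambda>s\<in>{1..j}. (\<lambda>s\<in>{1..j}. i (inv \<pi> s)) (\<pi> s)) = i"
        by (rule round[OF i \<pi>]) (simp add: permutes_inverses[OF \<pi>])
      show "(\<lambda>s\<in>{1..j}. i (\<pi> s)) \<in> ?I" "(\<lambda>s\<in>{1..j}. i (inv \<pi> s)) \<in> ?I"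
        by (rule sub[OF i \<pi>], rule sub[OF i permutes_inv[OF \<pi>]])
      have "\<pi> s \<in> {1..j}" if "s \<in> {1..j}" for s
        using permutes_in_image[OF \<pi>, of s] that by blast
      then show "K (\<lambda>s\<in>{1..j}. \<omega> ((\<lambda>s\<in>{1..j}. i (\<pi> s)) s)) = K (\<lambda>s\<in>{1..j}. (\<lambda>s\<in>{1..j}. \<omega> (i s)) (\<pi> s))"
        by (intro arg_cong[where f = K] restrict_ext) (simp only: restrict_apply if_True)
    qed
  qed
  have "(\<Sum>i\<in>?I. sym_kernel j K (\<lambda>s\<in>{1..j}. \<omega> (i s)))
      = (\<Sum>\<pi> | \<pi> permutes {1..j}. \<Sum>i\<in>?I. K (\<lambda>s\<in>{1..j}. (\<lambda>s\<in>{1..j}. \<omega> (i s)) (\<pi> s))) / fact j"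
    unfolding sym_kernel_def by (subst sum.swap) (simp add: sum_divide_distrib)
  also have "\<dots> = (\<Sum>i\<in>?I. K (\<lambda>s\<in>{1..j}. \<omega> (i s)))"
    by (subst sum.cong[OF refl step]) (simp_all add: card_permutations)
  finally show ?thesis
    by (simp add: ustat_def)
qed

lemma ustat_cmult: "ustat n j (\<lambda>v. c * K v) \<omega> = c * ustat n j K \<omega>"
  by (simp add: ustat_def sum_distrib_left mult_ac)

lemma ustat_1:
  assumes "1 \<le> n"
  shows "ustat n 1 K \<omega> = (\<Sum>i=1..n. K (\<lambda>s\<in>{1..1}. \<omega> i)) / real n"
proof -
  have "(\<Sum>i \<in> {i \<in> {1..1} \<rightarrow>\<^sub>E {1..n}. inj_on i {1..1}}. K (\<lambda>s\<in>{1..1}. \<omega> (i s)))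
      = (\<Sum>i=1..n. K (\<lambda>s\<in>{1..1}. \<omega> i))"
  proof (rule sum.reindex_bij_witness[where j = "\<lambda>i. i 1" and i = "\<lambda>x. \<lambda>s\<in>{1..1::nat}. x"])
    fix i :: "nat \<Rightarrow> nat" assume i: "i \<in> {i \<in> {1..1} \<rightarrow>\<^sub>E {1..n}. inj_on i {1..1}}"
    then show "(\<lambda>s\<in>{1..1}. i 1) = i"
      by (auto simp: fun_eq_iff PiE_iff extensional_def)
    show "i 1 \<in> {1..n}"
      using i by (auto simp: PiE_iff)
    show "K (\<lambda>s\<in>{1..1}. \<omega> (i 1)) = K (\<lambda>s\<in>{1..1}. \<omega> (i s))"
      by (intro arg_cong[where f = K]) (auto simp: fun_eq_iff)
  qed auto
  moreover have "fact (n - 1) / fact n = 1 / real n"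
    using assms fact_reduce[of n, where 'a = real] by (simp add: field_simps)
  ultimately show ?thesis
    by (simp add: ustat_def)
qed

section \<open>Bordered matrices\<close>

text \<open>\<open>bordered d e h M f\<close> is the block matrix \<open>[[d, e, h], [0, M, f], [0, 0, d]]\<close>.\<close>

definition bordered :: "real \<Rightarrow> real ^ 'k \<Rightarrow> real \<Rightarrow> real ^ 'k ^ 'k \<Rightarrow> real ^ 'k \<Rightarrow>
    real ^ ('k::finite) option option ^ 'k option option" where
  "bordered d e h M f = (\<chi> i j.
     case i of
       None \<Rightarrow> (case j of None \<Rightarrow> d | Some None \<Rightarrow> h | Some (Some l) \<Rightarrow> e $ l)
     | Some None \<Rightarrow> (case j of None \<Rightarrow> 0 | Some None \<Rightarrow> d | Some (Some l) \<Rightarrow> 0)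
     | Some (Some k) \<Rightarrow> (case j of None \<Rightarrow> 0 | Some None \<Rightarrow> f $ k | Some (Some l) \<Rightarrow> M $ k $ l))"

lemma bordered_component [simp]:
  "bordered d e h M f $ None $ None = d"
  "bordered d e h M f $ None $ Some None = h"
  "bordered d e h M f $ None $ Some (Some l) = e $ l"
  "bordered d e h M f $ Some None $ None = 0"
  "bordered d e h M f $ Some None $ Some None = d"
  "bordered d e h M f $ Some None $ Some (Some l) = 0"
  "bordered d e h M f $ Some (Some k) $ None = 0"
  "bordered d e h M f $ Some (Some k) $ Some None = f $ k"
  "bordered d e h M f $ Some (Some k) $ Some (Some l) = M $ k $ l"
  by (simp_all add: bordered_def)

lemma matrix_eq_option2I:
  fixes A B :: "real ^ ('k::finite) option option ^ 'k option option"
  assumes "A $ None $ None = B $ None $ None" "A $ None $ Some None = B $ None $ Some None"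
    "\<And>l. A $ None $ Some (Some l) = B $ None $ Some (Some l)"
    "A $ Some None $ None = B $ Some None $ None" "A $ Some None $ Some None = B $ Some None $ Some None"
    "\<And>l. A $ Some None $ Some (Some l) = B $ Some None $ Some (Some l)"
    "\<And>k. A $ Some (Some k) $ None = B $ Some (Some k) $ None"
    "\<And>k. A $ Some (Some k) $ Some None = B $ Some (Some k) $ Some None"
    "\<And>k l. A $ Some (Some k) $ Some (Some l) = B $ Some (Some k) $ Some (Some l)"
  shows "A = B"
  unfolding vec_eq_iff
proof (intro allI)
  fix i j
  show "A $ i $ j = B $ i $ j"
    using assms by (cases i; cases "the i"; cases j; cases "the j") auto
qed

lemma sum_option: "(\<Sum>x\<in>UNIV. f x) = f None + (\<Sum>x\<in>UNIV. f (Some x))"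
  for f :: "'k::finite option \<Rightarrow> real"
  by (simp add: UNIV_option_conv sum.reindex)

text \<open>The two outer diagonal entries share one \<open>d\<close>, which multiplies. It is 1 for
  the statistic, its mean and the inverse, and 0 for centred factors; the zero is what makes long
  products collapse.\<close>

lemma bordered_mult:
  "bordered d e h M f ** bordered d' e' h' M' f'
   = bordered (d * d') (d *\<^sub>R e' + e v* M') (d * h' + e \<bullet> f' + h * d') (M ** M') (M *v f' + d' *\<^sub>R f)"
  by (rule matrix_eq_option2I)
     (simp_all add: matrix_matrix_mult_def sum_option vector_matrix_mult_def matrix_vector_mult_def
       inner_vec_def mult.commute)

lemma bordered_diff:
  "bordered d e h M f - bordered d' e' h' M' f' = bordered (d - d') (e - e') (h - h') (M - M') (f - f')"
  by (rule matrix_eq_option2I) simp_all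

lemma mat_1_bordered: "mat 1 = bordered 1 0 0 (mat 1) 0"
  by (rule matrix_eq_option2I) (simp_all add: mat_def)

lemma matrix_vector_mult_minus: "A *v (- x) = - (A *v (x :: real ^ 'k))"
  by (simp add: matrix_vector_mult_def vec_eq_iff sum_negf)

text \<open>Block back-substitution. The corner of the inverse,
  \<open>a \<bullet> (matrix_inv G *v c) - h\<close>, is the negative of the truncated parameter
  when \<open>h\<close> is the mean of H.\<close>

lemma bordered_inverse:
  fixes G :: "real ^ 'k ^ 'k"
  assumes "invertible G"
  shows "bordered 1 a h G c ** bordered 1 (- (a v* matrix_inv G)) (a \<bullet> (matrix_inv G *v c) - h)
      (matrix_inv G) (- (matrix_inv G *v c)) = mat 1"
  by (simp add: bordered_mult mat_1_bordered matrix_inv_inverse[OF assms] matrix_vector_mul_assoc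
      inner_minus_right matrix_vector_mult_minus)

text \<open>Since \<open>d = 0\<close> in each centred factor, later factors annihilate the
  \<open>h\<close> and \<open>f\<close> of earlier ones, and only the last \<open>f\<close> survives
  in the final column. The existential blocks do not reach the corner entry computed next.\<close>

lemma chain_bordered:
  fixes \<Omega> :: "real ^ 'k ^ 'k"
  shows "\<exists>E H M'. chain (bordered 1 0 h\<^sub>0 \<Omega> 0) (\<lambda>s. bordered 0 (e s) (h s) (M s) (f s)) (zs @ [l])
    = bordered 0 E H M' (foldr (**) (map (\<lambda>s. \<Omega> ** M s) zs) (mat 1) *v (\<Omega> *v f l))"
proof (induction zs)
  case Nil
  show ?case
    by (intro exI) (simp add: bordered_mult)
next
  case (Cons x zs)
  then obtain E H M' where "chain (bordered 1 0 h\<^sub>0 \<Omega> 0) (\<lambda>s. bordered 0 (e s) (h s) (M s) (f s)) (zs @ [l])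
    = bordered 0 E H M' (foldr (**) (map (\<lambda>s. \<Omega> ** M s) zs) (mat 1) *v (\<Omega> *v f l))"
    by blast
  then show ?case
    by (intro exI) (simp add: bordered_mult matrix_vector_mul_assoc matrix_mul_assoc)
qed

text \<open>The first factor supplies the row \<open>e\<close>, the last the column
  \<open>f\<close>, and those between the block \<open>M\<close>. Two ends presuppose two letters,
  so order one is treated apart.\<close>

lemma chain_bordered_corner:
  fixes \<Omega> :: "real ^ 'k ^ 'k"
  shows "chain (bordered 1 0 h\<^sub>0 \<Omega> 0) (\<lambda>s. bordered 0 (e s) (h s) (M s) (f s)) (x # zs @ [l]) $ None $ Some None
    = e x \<bullet> (foldr (**) (map (\<lambda>s. \<Omega> ** M s) zs) (mat 1) *v (\<Omega> *v f l))"
proof -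
  obtain E H M' where "chain (bordered 1 0 h\<^sub>0 \<Omega> 0) (\<lambda>s. bordered 0 (e s) (h s) (M s) (f s)) (zs @ [l])
    = bordered 0 E H M' (foldr (**) (map (\<lambda>s. \<Omega> ** M s) zs) (mat 1) *v (\<Omega> *v f l))"
    using chain_bordered by blast
  then show ?thesis
    by (simp add: bordered_mult)
qed

section \<open>Vector-valued integrals\<close>

lemma integrable_vecI:
  fixes f :: "'a \<Rightarrow> 'b::euclidean_space ^ 'k"
  assumes "\<And>i. integrable M (\<lambda>x. f x $ i)"
  shows "integrable M f"
proof -
  have "linear (axis i :: 'b \<Rightarrow> 'b ^ 'k)" for i
    by (rule linearI) (auto simp: axis_def vec_eq_iff)
  then have "integrable M (\<lambda>x. axis i (f x $ i) :: 'b ^ 'k)" for i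
    using integrable_bounded_linear[OF _ assms] linear_conv_bounded_linear by blast
  then have "integrable M (\<lambda>x. \<Sum>i\<in>UNIV. axis i (f x $ i))"
    by (intro Bochner_Integration.integrable_sum)
  moreover have "(\<Sum>i\<in>UNIV. axis i (f x $ i)) = f x" for x
    by (simp add: vec_eq_iff axis_def)
  ultimately show ?thesis by simp
qed

lemma integral_vec_component:
  fixes f :: "'a \<Rightarrow> 'b::euclidean_space ^ 'k"
  assumes "\<And>i. integrable M (\<lambda>x. f x $ i)"
  shows "(\<integral>x. f x \<partial>M) $ i = (\<integral>x. f x $ i \<partial>M)"
  using integral_bounded_linear[OF bounded_linear_vec_nth integrable_vecI[OF assms], of i] by simp

section \<open>The truncated parameter of a doubly robust functional\<close>

context linear_dr_functional
begin

abbreviation \<Theta> where "\<Theta> \<equiv> B \<times> PP \<times> T"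

lemma snd_measurable: "\<theta> \<in> \<Theta> \<Longrightarrow> snd \<in> measurable (P \<theta>) MX"
  using sets_P by (simp cong: measurable_cong_sets)

lemma MX_borel_measurable:
  "\<theta> \<in> \<Theta> \<Longrightarrow> f \<in> borel_measurable MX \<Longrightarrow> (\<lambda>y. f (snd y)) \<in> borel_measurable (P \<theta>)"
  using measurable_compose[OF snd_measurable] .

lemma S_measurable: "\<theta> \<in> \<Theta> \<Longrightarrow> S \<in> borel_measurable (P \<theta>)"
  using sets_P measurable_S by (simp cong: measurable_cong_sets)

lemma S0_measurable: "\<theta> \<in> \<Theta> \<Longrightarrow> S0 \<in> borel_measurable (P \<theta>)"
  using sets_P measurable_S0 by (simp cong: measurable_cong_sets)

lemma L2_marginal:
  "\<theta> \<in> \<Theta> \<Longrightarrow> f \<in> L2 (marginal MX (P \<theta>)) \<longleftrightarrow>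
    f \<in> borel_measurable MX \<and> integrable (P \<theta>) (\<lambda>y. (f (snd y))\<^sup>2)"
  using snd_measurable[of \<theta>] by (auto simp: L2_def marginal_def integrable_distr_eq)

lemma space_P: "\<theta> \<in> \<Theta> \<Longrightarrow> space (P \<theta>) = space MW \<times> space MX"
  using sets_eq_imp_space_eq[OF sets_P] by (simp add: space_pair_measure)

text \<open>Needed under every law of the model, also under laws with other nuisances; boundedness
  gives it.\<close>

lemma nuisance_in_L2: "\<theta> \<in> \<Theta> \<Longrightarrow> f \<in> B \<union> PP \<Longrightarrow> f \<in> L2 (marginal MX (P \<theta>))"
proof -
  assume \<theta>: "\<theta> \<in> \<Theta>" and f: "f \<in> B \<union> PP"
  interpret prob_space "P \<theta>" using prob_P \<theta> by blast
  obtain C where C: "\<forall>x\<in>space MX. \<bar>f x\<bar> \<le> C" using bounded_nuisance[OF f] by blast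
  have "integrable (P \<theta>) (\<lambda>y. (f (snd y))\<^sup>2)"
  proof (rule integrable_const_bound[where B = "C\<^sup>2"])
    have "(f (snd y))\<^sup>2 \<le> C\<^sup>2" if "y \<in> space (P \<theta>)" for y
      using that C space_P[OF \<theta>] by (intro power2_le_iff_abs_le[THEN iffD2]) force+
    then show "AE y in P \<theta>. norm ((f (snd y))\<^sup>2) \<le> C\<^sup>2" by auto
    show "(\<lambda>y. (f (snd y))\<^sup>2) \<in> borel_measurable (P \<theta>)"
      using MX_borel_measurable[OF \<theta> measurable_nuisance[OF f]] by measurable
  qed
  then show ?thesis
    using L2_marginal[OF \<theta>] measurable_nuisance[OF f] by blast
qed

lemma statistic_linear_combination:
  assumes "continuous_linear_statistic MX (P \<theta>) m" and f: "f \<in> L2 (marginal MX (P \<theta>))"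
    and z: "\<And>i. i \<in> I \<Longrightarrow> z i \<in> L2 (marginal MX (P \<theta>))"
  shows "AE y in P \<theta>. m y (\<lambda>x. f x + (\<Sum>i\<in>I. c i * z i x)) = m y f + (\<Sum>i\<in>I. c i * m y (z i))"
  using z
proof (induction I rule: infinite_finite_induct)
  case (insert i I)
  have eq: "(\<lambda>x. 1 * (f x + (\<Sum>i\<in>I. c i * z i x)) + c i * z i x)
      = (\<lambda>x. f x + (\<Sum>i\<in>insert i I. c i * z i x))"
    using insert.hyps by (simp add: fun_eq_iff)
  have lin: "\<forall>g\<in>L2 (marginal MX (P \<theta>)). \<forall>h\<in>L2 (marginal MX (P \<theta>)). \<forall>a c :: real.
        AE y in P \<theta>. m y (\<lambda>x. a * g x + c * h x) = a * m y g + c * m y h"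
    using assms(1) by (simp add: continuous_linear_statistic_def)
  have h: "(\<lambda>x. f x + (\<Sum>i\<in>I. c i * z i x)) \<in> L2 (marginal MX (P \<theta>))"
    using insert.prems by (intro L2_add f L2_sum L2_cmult) auto
  have "z i \<in> L2 (marginal MX (P \<theta>))"
    using insert.prems by simp
  from bspec[OF bspec[OF lin h] this]
  have "AE y in P \<theta>. m y (\<lambda>x. 1 * (f x + (\<Sum>i\<in>I. c i * z i x)) + c i * z i x)
      = 1 * m y (\<lambda>x. f x + (\<Sum>i\<in>I. c i * z i x)) + c i * m y (z i)"
    by (rule allE) (erule allE)
  moreover have "AE y in P \<theta>. m y (\<lambda>x. f x + (\<Sum>i\<in>I. c i * z i x)) = m y f + (\<Sum>i\<in>I. c i * m y (z i))"
    using insert.prems by (intro insert.IH) simp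
  ultimately show ?case
    unfolding eq by eventually_elim (use insert.hyps in simp)
qed (auto simp: f)

section \<open>Closed form of the truncated parameter and of its bias\<close>

lemma Hstat_measurable:
  assumes \<theta>: "\<theta> \<in> \<Theta>" and b: "b \<in> L2 (marginal MX (P \<theta>))" and p: "p \<in> L2 (marginal MX (P \<theta>))"
  shows "Hstat S m1 m2 S0 b p \<in> borel_measurable (P \<theta>)"
proof -
  have [measurable]: "S \<in> borel_measurable (P \<theta>)" "S0 \<in> borel_measurable (P \<theta>)"
    "(\<lambda>y. b (snd y)) \<in> borel_measurable (P \<theta>)" "(\<lambda>y. p (snd y)) \<in> borel_measurable (P \<theta>)"
    using \<theta> b p L2_marginal[OF \<theta>] MX_borel_measurable[OF \<theta>] S_measurable[OF \<theta>] S0_measurable[OF \<theta>] by blast+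
  have [measurable]: "(\<lambda>y. m1 y b) \<in> borel_measurable (P \<theta>)" "(\<lambda>y. m2 y p) \<in> borel_measurable (P \<theta>)"
    using m1_linear[OF \<theta>] m2_linear[OF \<theta>] b p
    by (auto simp: continuous_linear_statistic_def intro: borel_measurable_integrable)
  show ?thesis
    unfolding Hstat_def[abs_def] by measurable
qed

text \<open>H is affine in each nuisance, and the product of the two perturbations gives the Gram
  term. The statement is almost sure for fixed \<open>u\<close> and \<open>w\<close> because
  \<open>m1\<close> and \<open>m2\<close> are linear only up to null sets.\<close>

lemma Hstat_expansion:
  assumes \<theta>: "\<theta> \<in> \<Theta>" and b: "b \<in> L2 (marginal MX (P \<theta>))" and p: "p \<in> L2 (marginal MX (P \<theta>))"
    and z: "\<And>i. (\<lambda>x. z x $ i) \<in> L2 (marginal MX (P \<theta>))"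
  shows "AE y in P \<theta>. Hstat S m1 m2 S0 (\<lambda>x. b x + u \<bullet> z x) (\<lambda>x. p x + w \<bullet> z x) y
    = Hstat S m1 m2 S0 b p y + u \<bullet> Ecal_vec S p m1 z y + w \<bullet> Ecal_vec S b m2 z y
      + u \<bullet> (Szz S z y *v w)"
proof -
  have "AE y in P \<theta>. m1 y (\<lambda>x. b x + u \<bullet> z x) = m1 y b + (\<Sum>i\<in>UNIV. u $ i * m1 y (\<lambda>x. z x $ i))"
    using statistic_linear_combination[OF m1_linear[OF \<theta>] b z, where c = "\<lambda>i. u $ i" and I = UNIV] by (simp add: inner_vec_def)
  moreover have "AE y in P \<theta>. m2 y (\<lambda>x. p x + w \<bullet> z x) = m2 y p + (\<Sum>i\<in>UNIV. w $ i * m2 y (\<lambda>x. z x $ i))"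
    using statistic_linear_combination[OF m2_linear[OF \<theta>] p z, where c = "\<lambda>i. w $ i" and I = UNIV] by (simp add: inner_vec_def)
  ultimately show ?thesis
  proof eventually_elim
    case (elim y)
    define s \<beta> \<pi> x where "s = S y" and "\<beta> = b (snd y)" and "\<pi> = p (snd y)" and "x = z (snd y)"
    have 1: "u \<bullet> Ecal_vec S p m1 z y = s * \<pi> * (u \<bullet> x) + (\<Sum>i\<in>UNIV. u $ i * m1 y (\<lambda>x. z x $ i))"
      by (simp add: Ecal_vec_def Ecal_def inner_vec_def s_def \<pi>_def x_def algebra_simps sum.distrib sum_distrib_left)
    have 2: "w \<bullet> Ecal_vec S b m2 z y = s * \<beta> * (w \<bullet> x) + (\<Sum>i\<in>UNIV. w $ i * m2 y (\<lambda>x. z x $ i))"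
      by (simp add: Ecal_vec_def Ecal_def inner_vec_def s_def \<beta>_def x_def algebra_simps sum.distrib sum_distrib_left)
    have "Szz S z y *v w = (s * (x \<bullet> w)) *\<^sub>R x"
      by (simp add: vec_eq_iff Szz_def matrix_vector_mult_def inner_vec_def s_def x_def sum_distrib_left
          sum_distrib_right mult_ac)
    then have 3: "u \<bullet> (Szz S z y *v w) = s * (u \<bullet> x) * (w \<bullet> x)"
      by (simp add: inner_commute)
    show ?case
      unfolding 1 2 3 Hstat_def elim s_def \<beta>_def \<pi>_def x_def by (simp add: algebra_simps)
  qed
qed

lemma psi_trunc_eq:
  assumes \<theta>: "\<theta> \<in> \<Theta>" and b: "b \<in> L2 (marginal MX (P \<theta>))" and p: "p \<in> L2 (marginal MX (P \<theta>))"
    and z: "\<And>i. (\<lambda>x. z x $ i) \<in> L2 (marginal MX (P \<theta>))"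
    and inv: "invertible (gram (P \<theta>) S z)"
    and H: "integrable (P \<theta>) (Hstat S m1 m2 S0 b p)"
    and Eb: "\<And>i. integrable (P \<theta>) (\<lambda>y. Ecal_vec S b m2 z y $ i)"
    and Ep: "\<And>i. integrable (P \<theta>) (\<lambda>y. Ecal_vec S p m1 z y $ i)"
    and M: "\<And>i j. integrable (P \<theta>) (\<lambda>y. Szz S z y $ i $ j)"
  shows "psi_trunc S m1 m2 S0 b p z (P \<theta>) = (\<integral>y. Hstat S m1 m2 S0 b p y \<partial>P \<theta>)
    - (\<integral>y. Ecal_vec S b m2 z y \<partial>P \<theta>) \<bullet> (matrix_inv (gram (P \<theta>) S z) *v (\<integral>y. Ecal_vec S p m1 z y \<partial>P \<theta>))"
proof -
  define u w where "u = zeta (P \<theta>) S b m2 z" and "w = zeta (P \<theta>) S p m1 z"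
  define a c G where "a = (\<integral>y. Ecal_vec S b m2 z y \<partial>P \<theta>)" and "c = (\<integral>y. Ecal_vec S p m1 z y \<partial>P \<theta>)"
    and "G = gram (P \<theta>) S z"
  have u: "u = - (matrix_inv G *v a)" and w: "w = - (matrix_inv G *v c)"
    by (simp_all add: u_def w_def zeta_def a_def c_def G_def)
  have L2': "(\<lambda>x. f x + v \<bullet> z x) \<in> L2 (marginal MX (P \<theta>))" if "f \<in> L2 (marginal MX (P \<theta>))" for f v
    unfolding inner_vec_def inner_real_def using that z by (intro L2_add L2_sum L2_cmult)
  have iEb: "integrable (P \<theta>) (Ecal_vec S b m2 z)" and iEp: "integrable (P \<theta>) (Ecal_vec S p m1 z)"
    using Eb Ep by (auto intro: integrable_vecI)
  have iM: "integrable (P \<theta>) (Szz S z)"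
    by (intro integrable_vecI M)
  have "linear (\<lambda>A. A *v w)"
    by (rule linearI) (simp_all add: matrix_vector_mult_add_rdistrib scaleR_matrix_vector_assoc[symmetric])
  then have bl: "bounded_linear (\<lambda>A. A *v w)"
    by (simp add: linear_conv_bounded_linear)
  let ?R = "\<lambda>y. Hstat S m1 m2 S0 b p y + u \<bullet> Ecal_vec S p m1 z y + w \<bullet> Ecal_vec S b m2 z y
      + u \<bullet> (Szz S z y *v w)"
  have iR: "integrable (P \<theta>) (\<lambda>y. Szz S z y *v w)"
    by (rule integrable_bounded_linear[OF bl iM])
  have "psi_trunc S m1 m2 S0 b p z (P \<theta>)
      = (\<integral>y. Hstat S m1 m2 S0 (\<lambda>x. b x + u \<bullet> z x) (\<lambda>x. p x + w \<bullet> z x) y \<partial>P \<theta>)"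
    unfolding psi_trunc_def truncated_nuisance_def u_def w_def ..
  also have "\<dots> = (\<integral>y. ?R y \<partial>P \<theta>)"
  proof (rule integral_cong_AE)
    show "Hstat S m1 m2 S0 (\<lambda>x. b x + u \<bullet> z x) (\<lambda>x. p x + w \<bullet> z x) \<in> borel_measurable (P \<theta>)"
      by (intro Hstat_measurable \<theta> L2' b p)
    show "?R \<in> borel_measurable (P \<theta>)"
      using H iEb iEp iR by (intro borel_measurable_integrable Bochner_Integration.integrable_add integrable_inner_right)
    show "AE y in P \<theta>. Hstat S m1 m2 S0 (\<lambda>x. b x + u \<bullet> z x) (\<lambda>x. p x + w \<bullet> z x) y = ?R y"
      by (rule Hstat_expansion[OF \<theta> b p z])
  qed
  also have "\<dots> = (\<integral>y. Hstat S m1 m2 S0 b p y \<partial>P \<theta>) + u \<bullet> c + w \<bullet> a + u \<bullet> (G *v w)"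
    using H iEb iEp iR integral_bounded_linear[OF bl iM] by (simp add: a_def c_def G_def gram_def)
  \<comment> \<open>As \<open>w\<close> solves \<open>G *v w = - c\<close>, the quadratic term
    cancels the linear term \<open>u \<bullet> c\<close>; apart from the mean of H, only
    \<open>w \<bullet> a\<close> remains.\<close>
  also have "u \<bullet> (G *v w) = - (u \<bullet> c)"
    using inv by (simp add: w matrix_vector_mult_minus matrix_vector_mul_assoc matrix_inv_inverse G_def)
  finally show ?thesis
    by (simp add: w inner_commute flip: a_def c_def G_def)
qed

lemma trunc_bias_eq:
  assumes \<theta>: "\<theta> \<in> \<Theta>" and H: "integrable (P \<theta>) (Hstat S m1 m2 S0 b p)" and "1 \<le> n"
  shows "trunc_bias S m1 m2 S0 b p z n (P \<theta>)
    = (\<integral>y. Hstat S m1 m2 S0 b p y \<partial>P \<theta>) - psi_trunc S m1 m2 S0 b p z (P \<theta>)"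
proof -
  let ?H = "Hstat S m1 m2 S0 b p" and ?PI = "Pi\<^sub>M {1..n} (\<lambda>_. P \<theta>)"
  interpret prob_space "P \<theta>" using prob_P \<theta> by blast
  interpret PI: prob_space ?PI using prob_P[OF \<theta>] by (intro prob_space_PiM)
  have comp: "integrable ?PI (\<lambda>\<omega>. ?H (\<omega> i)) \<and> (\<integral>\<omega>. ?H (\<omega> i) \<partial>?PI) = (\<integral>y. ?H y \<partial>P \<theta>)" if i: "i \<in> {1..n}" for i
  proof -
    have d: "distr ?PI (P \<theta>) (\<lambda>\<omega>. \<omega> i) = P \<theta>"
      using distr_PiM_component[of "{1..n}" "\<lambda>_. P \<theta>", OF prob_P[OF \<theta>] i] .
    have m: "(\<lambda>\<omega>. \<omega> i) \<in> measurable ?PI (P \<theta>)"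
      using i by (rule measurable_component_singleton)
    show ?thesis
      using integrable_distr_eq[OF m borel_measurable_integrable[OF H]]
        integral_distr[OF m borel_measurable_integrable[OF H]] H unfolding d by simp
  qed
  have sum: "integrable ?PI (\<lambda>\<omega>. \<Sum>i=1..n. ?H (\<omega> i))"
    using comp by (intro Bochner_Integration.integrable_sum) blast
  have "(\<integral>\<omega>. psi_hat1 S m1 m2 S0 b p n \<omega> - psi_trunc S m1 m2 S0 b p z (P \<theta>) \<partial>?PI)
      = (1 / real n) * (\<integral>\<omega>. (\<Sum>i=1..n. ?H (\<omega> i)) \<partial>?PI) - psi_trunc S m1 m2 S0 b p z (P \<theta>)"
    unfolding psi_hat1_def using sum by (simp add: PI.prob_space del: One_nat_def)
  also have "(\<integral>\<omega>. (\<Sum>i=1..n. ?H (\<omega> i)) \<partial>?PI) = (\<Sum>i=1..n. \<integral>\<omega>. ?H (\<omega> i) \<partial>?PI)"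
    using comp by (intro Bochner_Integration.integral_sum) blast
  also have "(\<Sum>i=1..n. \<integral>\<omega>. ?H (\<omega> i) \<partial>?PI) = (\<Sum>i=1..n. \<integral>y. ?H y \<partial>P \<theta>)"
    using comp by (intro sum.cong) auto
  finally show ?thesis
    using \<open>1 \<le> n\<close> by (simp add: trunc_bias_def)
qed

section \<open>First-order conditions at the true nuisances\<close>

text \<open>With one nuisance correct, the right-hand side of the double robustness identity is 0,
  so the mean of \<open>IF1\<close> at the other parameter is a difference of two values of
  \<open>\<psi>\<close>. The product form of the parameter set keeps \<open>(b', p', c)\<close> in
  the model.\<close>

lemma Hstat_mean:
  assumes \<theta>: "(b, p, c) \<in> \<Theta>" and b': "b' \<in> B" and p': "p' \<in> PP" and eq: "b' = b \<or> p' = p"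
  shows "integrable (P (b, p, c)) (Hstat S m1 m2 S0 b' p')"
    and "(\<integral>y. Hstat S m1 m2 S0 b' p' y \<partial>P (b, p, c)) = \<psi> (b, p, c)"
proof -
  let ?P = "P (b, p, c)" and ?H = "Hstat S m1 m2 S0 b' p'" and ?\<psi> = "\<psi> (b', p', c)"
  interpret prob_space ?P using prob_P \<theta> by blast
  have \<theta>': "(b', p', c) \<in> \<Theta>" using \<theta> b' p' by auto
  have i: "integrable ?P (IF1 (b', p', c))" by (rule IF1_integrable[OF \<theta> \<theta>'])
  have [measurable]: "?H \<in> borel_measurable ?P"
    using b' p' by (intro Hstat_measurable \<theta> nuisance_in_L2) auto
  have ae: "AE y in ?P. IF1 (b', p', c) y = ?H y - ?\<psi>" by (rule IF1_form[OF \<theta> \<theta>'])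
  have "integrable ?P (\<lambda>y. ?H y - ?\<psi>)"
    using integrable_cong_AE_imp[OF i _ ae] by simp
  then have "integrable ?P (\<lambda>y. (?H y - ?\<psi>) + ?\<psi>)"
    by (intro Bochner_Integration.integrable_add) auto
  then show H: "integrable ?P ?H" by simp
  have "(\<integral>y. IF1 (b', p', c) y \<partial>?P) = (\<integral>y. ?H y - ?\<psi> \<partial>?P)"
    using i by (intro integral_cong_AE ae) auto
  also have "\<dots> = (\<integral>y. ?H y \<partial>?P) - ?\<psi>"
    using H by (simp add: prob_space)
  finally show "(\<integral>y. ?H y \<partial>?P) = \<psi> (b, p, c)"
    using doubly_robust[OF \<theta> \<theta>'] eq by auto
qed

text \<open>Conditioning on the covariate trades the weight \<open>S\<close> for the bounded weight
  \<open>lam\<close>. This yields L2 control of the mean of \<open>S\<close> times \<open>f\<close>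
  times a test function.\<close>

lemma lam_expectation:
  assumes \<theta>: "\<theta> \<in> \<Theta>" and f: "f \<in> borel_measurable MX"
    and int: "integrable (P \<theta>) (\<lambda>y. f (snd y) * S y)"
  shows "(\<integral>y. f (snd y) * S y \<partial>P \<theta>) = (\<integral>y. f (snd y) * lam \<theta> (snd y) \<partial>P \<theta>)"
proof -
  let ?F = "vimage_algebra (space (MW \<Otimes>\<^sub>M MX)) snd MX"
  interpret prob_space "P \<theta>" using prob_P \<theta> by blast
  have sp: "space (P \<theta>) = space (MW \<Otimes>\<^sub>M MX)"
    using sets_eq_imp_space_eq[OF sets_P[OF \<theta>]] .
  have snd: "snd \<in> space (MW \<Otimes>\<^sub>M MX) \<rightarrow> space MX"
    by (auto simp: space_pair_measure)
  have "sets ?F \<subseteq> sets (P \<theta>)"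
    unfolding sets_P[OF \<theta>] sets_vimage_algebra2[OF snd]
    using measurable_sets[OF measurable_snd[of MW MX]] by auto
  then interpret finite_measure_subalgebra "P \<theta>" ?F
    by unfold_locales (simp add: subalgebra_def sp)
  have "(\<lambda>y. f (snd y)) \<in> borel_measurable ?F"
    using measurable_compose[OF measurable_vimage_algebra1[OF snd] f] .
  from real_cond_exp_intg[OF int this S_measurable[OF \<theta>]]
  have "(\<integral>y. f (snd y) * S y \<partial>P \<theta>) = (\<integral>y. f (snd y) * real_cond_exp (P \<theta>) ?F S y \<partial>P \<theta>)"
    and "integrable (P \<theta>) (\<lambda>y. f (snd y) * real_cond_exp (P \<theta>) ?F S y)"
    by simp_all
  moreover have "(\<lambda>y. f (snd y) * lam \<theta> (snd y)) \<in> borel_measurable (P \<theta>)"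
    using MX_borel_measurable[OF \<theta> f] MX_borel_measurable[OF \<theta> measurable_lam[OF \<theta>]] by measurable
  ultimately show ?thesis
    using lam_cond_exp[OF \<theta>] by (auto intro!: integral_cong_AE)
qed

lemma L2_norm_marginal:
  "\<theta> \<in> \<Theta> \<Longrightarrow> f \<in> borel_measurable MX \<Longrightarrow>
    L2_norm (marginal MX (P \<theta>)) f = L2_norm (P \<theta>) (\<lambda>y. f (snd y))"
  unfolding L2_norm_def marginal_def by (subst integral_distr[OF snd_measurable]) auto

text \<open>The mean of \<open>Ecal S f m z\<close> changes by at most \<open>D + C\<close> times
  the L2 distance when \<open>z\<close> is replaced by a member of \<open>H\<close>:
  \<open>D\<close> comes from Cauchy-Schwarz after conditioning, \<open>C\<close> from continuity of
  the mean of \<open>m\<close>. Density then carries the value 0 over to \<open>z\<close>.\<close>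

lemma Ecal_mean_zero_dense:
  assumes \<theta>: "\<theta> \<in> \<Theta>" and m: "continuous_linear_statistic MX (P \<theta>) m" and f: "f \<in> B \<union> PP"
    and dense: "dense_in_L2 (marginal MX (P \<theta>)) H"
    and H: "\<And>h. h \<in> H \<Longrightarrow> integrable (P \<theta>) (\<lambda>y. S y * f (snd y) * h (snd y)) \<and> (\<integral>y. Ecal S f m h y \<partial>P \<theta>) = 0"
    and z: "z \<in> L2 (marginal MX (P \<theta>))" and int: "integrable (P \<theta>) (Ecal S f m z)"
  shows "(\<integral>y. Ecal S f m z y \<partial>P \<theta>) = 0"
proof -
  let ?Q = "marginal MX (P \<theta>)"
  interpret prob_space "P \<theta>" using prob_P \<theta> by blast
  have mi: "integrable (P \<theta>) (\<lambda>y. m y h)" if "h \<in> L2 ?Q" for h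
    using m that by (simp add: continuous_linear_statistic_def)
  obtain C where C: "\<forall>h\<in>L2 ?Q. \<bar>\<integral>y. m y h \<partial>P \<theta>\<bar> \<le> C * L2_norm ?Q h"
    using m unfolding continuous_linear_statistic_def by blast
  define D where "D = L2_norm (P \<theta>) (\<lambda>y. lam \<theta> (snd y) * f (snd y))"
  have lf: "(\<lambda>y. lam \<theta> (snd y) * f (snd y)) \<in> L2 (P \<theta>)"
  proof -
    have [measurable]: "(\<lambda>y. lam \<theta> (snd y)) \<in> borel_measurable (P \<theta>)" "(\<lambda>y. f (snd y)) \<in> borel_measurable (P \<theta>)"
      using MX_borel_measurable[OF \<theta>] measurable_lam[OF \<theta>] measurable_nuisance[OF f] by auto
    obtain K where K: "\<forall>x\<in>space MX. \<bar>f x\<bar> \<le> K" using bounded_nuisance[OF f] by blast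
    obtain c L where c: "c > 0" and "AE x in ?Q. c \<le> lam \<theta> x \<and> lam \<theta> x \<le> L"
      using lam_bounds[OF \<theta>] by blast
    then have L: "AE y in P \<theta>. c \<le> lam \<theta> (snd y) \<and> lam \<theta> (snd y) \<le> L"
      unfolding marginal_def by (intro AE_distrD[OF snd_measurable[OF \<theta>]])
    have "integrable (P \<theta>) (\<lambda>y. (lam \<theta> (snd y) * f (snd y))\<^sup>2)"
    proof (rule integrable_const_bound[where B = "(L * K)\<^sup>2"])
      show "AE y in P \<theta>. norm ((lam \<theta> (snd y) * f (snd y))\<^sup>2) \<le> (L * K)\<^sup>2"
        using L AE_space
      proof eventually_elim
        case (elim y)
        then have "\<bar>lam \<theta> (snd y)\<bar> \<le> L" "\<bar>f (snd y)\<bar> \<le> K"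
          using K c space_P[OF \<theta>] by force+
        then have "\<bar>lam \<theta> (snd y) * f (snd y)\<bar> \<le> L * K"
          unfolding abs_mult by (intro mult_mono) auto
        then show ?case
          using power_mono[of "\<bar>lam \<theta> (snd y) * f (snd y)\<bar>" "L * K" 2] by simp
      qed
    qed measurable
    then show ?thesis by (simp add: L2_def)
  qed
  have bound: "\<bar>\<integral>y. Ecal S f m z y \<partial>P \<theta>\<bar> \<le> (D + C) * L2_norm ?Q (\<lambda>x. z x - h x)" if h: "h \<in> H" for h
  proof -
    have hL: "h \<in> L2 ?Q" using dense h by (auto simp: dense_in_L2_def)
    let ?d = "\<lambda>x. z x - h x"
    have d: "?d \<in> L2 ?Q" by (intro L2_diff z hL)
    then have dm: "?d \<in> borel_measurable MX" and dL: "(\<lambda>y. ?d (snd y)) \<in> L2 (P \<theta>)"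
      using L2_marginal[OF \<theta>] MX_borel_measurable[OF \<theta>] by (auto simp: L2_def)
    have iz: "integrable (P \<theta>) (\<lambda>y. S y * f (snd y) * z (snd y))"
      using Bochner_Integration.integrable_diff[OF int mi[OF z]] by (simp add: Ecal_def)
    have ih: "integrable (P \<theta>) (\<lambda>y. S y * f (snd y) * h (snd y))" using H[OF h] by blast
    have id: "integrable (P \<theta>) (\<lambda>y. (f (snd y) * ?d (snd y)) * S y)"
      using Bochner_Integration.integrable_diff[OF iz ih] by (simp add: algebra_simps)
    have "AE y in P \<theta>. m y (\<lambda>x. 1 * z x + (-1) * h x) = 1 * m y z + (-1) * m y h"
      using m z hL unfolding continuous_linear_statistic_def by blast
    then have md: "(\<integral>y. m y ?d \<partial>P \<theta>) = (\<integral>y. m y z - m y h \<partial>P \<theta>)"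
      using mi[OF d] mi[OF z] mi[OF hL] by (intro integral_cong_AE) auto
    have "(\<integral>y. Ecal S f m z y \<partial>P \<theta>) = (\<integral>y. Ecal S f m z y \<partial>P \<theta>) - (\<integral>y. Ecal S f m h y \<partial>P \<theta>)"
      using H[OF h] by simp
    also have "\<dots> = (\<integral>y. S y * f (snd y) * z (snd y) \<partial>P \<theta>) - (\<integral>y. S y * f (snd y) * h (snd y) \<partial>P \<theta>)
        + ((\<integral>y. m y z \<partial>P \<theta>) - (\<integral>y. m y h \<partial>P \<theta>))"
      unfolding Ecal_def using iz ih mi[OF z] mi[OF hL] by simp
    also have "\<dots> = (\<integral>y. (f (snd y) * ?d (snd y)) * S y \<partial>P \<theta>) + (\<integral>y. m y ?d \<partial>P \<theta>)"
      unfolding md using iz ih mi[OF z] mi[OF hL]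
      by (simp add: algebra_simps flip: Bochner_Integration.integral_diff)
    also have "(\<integral>y. (f (snd y) * ?d (snd y)) * S y \<partial>P \<theta>)
        = (\<integral>y. (lam \<theta> (snd y) * f (snd y)) * ?d (snd y) \<partial>P \<theta>)"
      using lam_expectation[OF \<theta> _ id] measurable_nuisance[OF f] dm by (simp add: mult_ac)
    finally have "\<bar>\<integral>y. Ecal S f m z y \<partial>P \<theta>\<bar> \<le> \<bar>\<integral>y. (lam \<theta> (snd y) * f (snd y)) * ?d (snd y) \<partial>P \<theta>\<bar>
        + \<bar>\<integral>y. m y ?d \<partial>P \<theta>\<bar>"
      by linarith
    also have "\<dots> \<le> D * L2_norm ?Q ?d + C * L2_norm ?Q ?d"
      using L2_Cauchy_Schwarz[OF lf dL] bspec[OF C d] by (simp add: D_def L2_norm_marginal[OF \<theta> dm])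
    finally show ?thesis by (simp add: distrib_right)
  qed
  have "\<bar>\<integral>y. Ecal S f m z y \<partial>P \<theta>\<bar> \<le> e" if "e > 0" for e
  proof -
    \<comment> \<open>\<open>C\<close> comes without a sign, so \<open>D + C\<close> is enlarged to
      a positive constant before dividing.\<close>
    define k where "k = \<bar>D + C\<bar> + 1"
    have "k > 0" by (simp add: k_def add_pos_nonneg add.commute[of "\<bar>_\<bar>"])
    then have "e / k > 0" using that by simp
    then obtain h where h: "h \<in> H" "L2_norm ?Q (\<lambda>x. z x - h x) < e / k"
      using dense z unfolding dense_in_L2_def by blast
    have "\<bar>\<integral>y. Ecal S f m z y \<partial>P \<theta>\<bar> \<le> (D + C) * L2_norm ?Q (\<lambda>x. z x - h x)"
      by (rule bound[OF h(1)])
    also have "\<dots> \<le> k * (e / k)"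
      using h(2) L2_norm_nonneg[of ?Q "\<lambda>x. z x - h x"] by (intro mult_mono) (auto simp: k_def)
    finally show ?thesis using \<open>k > 0\<close> by simp
  qed
  then show ?thesis
    using field_le_epsilon[of "\<bar>\<integral>y. Ecal S f m z y \<partial>P \<theta>\<bar>" 0] by simp
qed

text \<open>Replacing \<open>b\<close> by \<open>b + t h\<close> with \<open>p\<close> still correct
  leaves the mean of H at \<open>\<psi>\<close>, while H itself changes by \<open>t\<close> times
  \<open>Ecal S p m1 h\<close>. The second half exchanges the roles of the nuisances.\<close>

lemma Ecal_mean_zero:
  assumes \<theta>: "(b, p, c) \<in> \<Theta>" and z: "z \<in> L2 (marginal MX (P (b, p, c)))"
  shows "integrable (P (b, p, c)) (Ecal S p m1 z) \<Longrightarrow> (\<integral>y. Ecal S p m1 z y \<partial>P (b, p, c)) = 0"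
    and "integrable (P (b, p, c)) (Ecal S b m2 z) \<Longrightarrow> (\<integral>y. Ecal S b m2 z y \<partial>P (b, p, c)) = 0"
proof -
  let ?P = "P (b, p, c)"
  have b: "b \<in> B" and p: "p \<in> PP" using \<theta> by auto
  have bL: "b \<in> L2 (marginal MX ?P)" "p \<in> L2 (marginal MX ?P)"
    using nuisance_in_L2[OF \<theta>] b p by auto
  note mean = Hstat_mean[OF \<theta>]
  show "(\<integral>y. Ecal S p m1 z y \<partial>?P) = 0" if "integrable ?P (Ecal S p m1 z)"
  proof (rule Ecal_mean_zero_dense[OF \<theta> m1_linear[OF \<theta>] _ Hb_dense[OF \<theta>] _ z that])
    fix h assume h: "h \<in> Hb"
    then have hL: "h \<in> L2 (marginal MX ?P)" using Hb_dense[OF \<theta>] by (auto simp: dense_in_L2_def)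
    \<comment> \<open>The punctured neighbourhood supplies a nonzero \<open>t\<close>, by which the
      identity is divided at the end.\<close>
    have "\<forall>\<^sub>F t::real in at 0. (\<lambda>x. b x + t * h x) \<in> B"
      using Hb_perturb[OF b h] by (simp add: eventually_at_filter eventually_mono)
    then have "\<exists>t::real. t \<noteq> 0 \<and> (\<lambda>x. b x + t * h x) \<in> B"
      using eventually_happens[OF eventually_conj[OF eventually_neq_at_within[of 0 0 UNIV]]] by fastforce
    then obtain t :: real where t: "t \<noteq> 0" "(\<lambda>x. b x + t * h x) \<in> B" by blast
    have Si: "integrable ?P (\<lambda>y. S y * p (snd y) * h (snd y))" by (rule Hb_integrable[OF \<theta> h])
    moreover have "integrable ?P (\<lambda>y. m1 y h)"
      using m1_linear[OF \<theta>] hL by (simp add: continuous_linear_statistic_def)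
    ultimately have Ei: "integrable ?P (Ecal S p m1 h)" by (simp add: Ecal_def[abs_def])
    have "AE y in ?P. m1 y (\<lambda>x. 1 * b x + t * h x) = 1 * m1 y b + t * m1 y h"
      using m1_linear[OF \<theta>] bL hL unfolding continuous_linear_statistic_def by blast
    then have "AE y in ?P. Hstat S m1 m2 S0 (\<lambda>x. b x + t * h x) p y - Hstat S m1 m2 S0 b p y = t * Ecal S p m1 h y"
      by eventually_elim (simp add: Hstat_def Ecal_def algebra_simps)
    then have "(\<integral>y. Hstat S m1 m2 S0 (\<lambda>x. b x + t * h x) p y - Hstat S m1 m2 S0 b p y \<partial>?P) = (\<integral>y. t * Ecal S p m1 h y \<partial>?P)"
      using mean(1)[OF t(2) p] mean(1)[OF b p] Ei by (intro integral_cong_AE) auto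
    then have "t * (\<integral>y. Ecal S p m1 h y \<partial>?P) = 0"
      using mean(1)[OF t(2) p] mean(1)[OF b p] mean(2)[OF t(2) p] mean(2)[OF b p] by simp
    with Si t(1) show "integrable ?P (\<lambda>y. S y * p (snd y) * h (snd y)) \<and> (\<integral>y. Ecal S p m1 h y \<partial>?P) = 0" by simp
  qed (use p in simp)
  show "(\<integral>y. Ecal S b m2 z y \<partial>?P) = 0" if "integrable ?P (Ecal S b m2 z)"
  proof (rule Ecal_mean_zero_dense[OF \<theta> m2_linear[OF \<theta>] _ Hp_dense[OF \<theta>] _ z that])
    fix h assume h: "h \<in> Hp"
    then have hL: "h \<in> L2 (marginal MX ?P)" using Hp_dense[OF \<theta>] by (auto simp: dense_in_L2_def)
    have "\<forall>\<^sub>F t::real in at 0. (\<lambda>x. p x + t * h x) \<in> PP"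
      using Hp_perturb[OF p h] by (simp add: eventually_at_filter eventually_mono)
    then have "\<exists>t::real. t \<noteq> 0 \<and> (\<lambda>x. p x + t * h x) \<in> PP"
      using eventually_happens[OF eventually_conj[OF eventually_neq_at_within[of 0 0 UNIV]]] by fastforce
    then obtain t :: real where t: "t \<noteq> 0" "(\<lambda>x. p x + t * h x) \<in> PP" by blast
    have Si: "integrable ?P (\<lambda>y. S y * b (snd y) * h (snd y))" by (rule Hp_integrable[OF \<theta> h])
    moreover have "integrable ?P (\<lambda>y. m2 y h)"
      using m2_linear[OF \<theta>] hL by (simp add: continuous_linear_statistic_def)
    ultimately have Ei: "integrable ?P (Ecal S b m2 h)" by (simp add: Ecal_def[abs_def])
    have "AE y in ?P. m2 y (\<lambda>x. 1 * p x + t * h x) = 1 * m2 y p + t * m2 y h"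
      using m2_linear[OF \<theta>] bL hL unfolding continuous_linear_statistic_def by blast
    then have "AE y in ?P. Hstat S m1 m2 S0 b (\<lambda>x. p x + t * h x) y - Hstat S m1 m2 S0 b p y = t * Ecal S b m2 h y"
      by eventually_elim (simp add: Hstat_def Ecal_def algebra_simps)
    then have "(\<integral>y. Hstat S m1 m2 S0 b (\<lambda>x. p x + t * h x) y - Hstat S m1 m2 S0 b p y \<partial>?P) = (\<integral>y. t * Ecal S b m2 h y \<partial>?P)"
      using mean(1)[OF b t(2)] mean(1)[OF b p] Ei by (intro integral_cong_AE) auto
    then have "t * (\<integral>y. Ecal S b m2 h y \<partial>?P) = 0"
      using mean(1)[OF b t(2)] mean(1)[OF b p] mean(2)[OF b t(2)] mean(2)[OF b p] by simp
    with Si t(1) show "integrable ?P (\<lambda>y. S y * b (snd y) * h (snd y)) \<and> (\<integral>y. Ecal S b m2 h y \<partial>?P) = 0" by simp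
  qed (use b in simp)
qed

text \<open>The scalar \<open>\<kappa>\<close> and the corner statistic \<open>h\<close> are free so
  that one statement covers both the truncated parameter and its bias.\<close>

lemma higher_order_influence_function_bordered:
  fixes z :: "'x \<Rightarrow> real ^ 'k"
  assumes \<theta>\<^sub>0: "(b\<^sub>0, p\<^sub>0, c\<^sub>0) \<in> \<Theta>"
    and z: "\<And>\<theta> i. \<theta> \<in> \<Theta> \<Longrightarrow> (\<lambda>x. z x $ i) \<in> L2 (marginal MX (P \<theta>))"
    and inv: "\<And>\<theta>. \<theta> \<in> \<Theta> \<Longrightarrow> invertible (gram (P \<theta>) S z)"
    and h: "\<And>\<theta>. \<theta> \<in> \<Theta> \<Longrightarrow> h \<in> L2 (P \<theta>)"
    and Eb: "\<And>\<theta> i. \<theta> \<in> \<Theta> \<Longrightarrow> (\<lambda>y. Ecal_vec S b\<^sub>0 m2 z y $ i) \<in> L2 (P \<theta>)"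
    and Ep: "\<And>\<theta> i. \<theta> \<in> \<Theta> \<Longrightarrow> (\<lambda>y. Ecal_vec S p\<^sub>0 m1 z y $ i) \<in> L2 (P \<theta>)"
    and M: "\<And>\<theta> i j. \<theta> \<in> \<Theta> \<Longrightarrow> (\<lambda>y. Szz S z y $ i $ j) \<in> L2 (P \<theta>)"
    and \<phi>: "\<And>\<theta>. \<theta> \<in> \<Theta> \<Longrightarrow> \<phi> \<theta> = \<kappa> * ((\<integral>y. Ecal_vec S b\<^sub>0 m2 z y \<partial>P \<theta>) \<bullet>
      (matrix_inv (gram (P \<theta>) S z) *v (\<integral>y. Ecal_vec S p\<^sub>0 m1 z y \<partial>P \<theta>)) - (\<integral>y. h y \<partial>P \<theta>))"
    and U: "\<And>\<omega>. U \<omega> = \<kappa> * (IF22mm S m1 m2 b\<^sub>0 p\<^sub>0 z (gram (P (b\<^sub>0, p\<^sub>0, c\<^sub>0)) S z) n m \<omega>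
      - (\<Sum>i=1..n. h (\<omega> i) - (\<integral>y. h y \<partial>P (b\<^sub>0, p\<^sub>0, c\<^sub>0))) / real n)"
    and "1 \<le> m" "1 \<le> n"
  shows "higher_order_influence_function P \<Theta> n \<phi> m (b\<^sub>0, p\<^sub>0, c\<^sub>0) U"
proof -
  let ?\<theta>\<^sub>0 = "(b\<^sub>0, p\<^sub>0, c\<^sub>0)"
  define e f where "e = Ecal_vec S b\<^sub>0 m2 z" and "f = Ecal_vec S p\<^sub>0 m1 z"
  define nn where "nn y = bordered 1 (e y) (h y) (Szz S z y) (f y)" for y
  have int: "integrable (P \<theta>) (\<lambda>y. e y $ i)" "integrable (P \<theta>) (\<lambda>y. f y $ i)"
      "integrable (P \<theta>) (\<lambda>y. Szz S z y $ i $ j)" if "\<theta> \<in> \<Theta>" for \<theta> i j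
    using prob_space.L2_integrable[OF prob_P[OF that]] Eb[OF that] Ep[OF that] M[OF that]
    by (simp_all add: e_def f_def)
  have mean: "mean_matrix (P \<theta>) nn = bordered 1 (\<integral>y. e y \<partial>P \<theta>) (\<integral>y. h y \<partial>P \<theta>) (gram (P \<theta>) S z) (\<integral>y. f y \<partial>P \<theta>)"
    if \<theta>: "\<theta> \<in> \<Theta>" for \<theta>
  proof -
    interpret prob_space "P \<theta>" by (rule prob_P[OF \<theta>])
    have "gram (P \<theta>) S z $ i $ j = (\<integral>y. Szz S z y $ i $ j \<partial>P \<theta>)" for i j
      using int[OF \<theta>] by (simp add: gram_def integral_vec_component integrable_vecI)
    then show ?thesis
      using int[OF \<theta>]
      by (intro matrix_eq_option2I) (simp_all add: mean_matrix_def nn_def integral_vec_component prob_space)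
  qed
  have minv: "matrix_inv (mean_matrix (P \<theta>) nn) = bordered 1 (- ((\<integral>y. e y \<partial>P \<theta>) v* matrix_inv (gram (P \<theta>) S z)))
      ((\<integral>y. e y \<partial>P \<theta>) \<bullet> (matrix_inv (gram (P \<theta>) S z) *v (\<integral>y. f y \<partial>P \<theta>)) - (\<integral>y. h y \<partial>P \<theta>))
      (matrix_inv (gram (P \<theta>) S z)) (- (matrix_inv (gram (P \<theta>) S z) *v (\<integral>y. f y \<partial>P \<theta>)))"
    if \<theta>: "\<theta> \<in> \<Theta>" for \<theta>
    unfolding mean[OF \<theta>] by (rule matrix_inv_eqI[OF bordered_inverse[OF inv[OF \<theta>]]])
  have minvertible: "invertible (mean_matrix (P \<theta>) nn)" if \<theta>: "\<theta> \<in> \<Theta>" for \<theta>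
    unfolding mean[OF \<theta>] using bordered_inverse[OF inv[OF \<theta>]] by (auto simp: invertible_right_inverse)
  interpret MM: matrix_mean_model P \<Theta> nn
  proof (rule matrix_mean_model.intro)
    show "prob_space (P \<theta>)" if "\<theta> \<in> \<Theta>" for \<theta>
      by (rule prob_P[OF that])
    show "invertible (mean_matrix (P \<theta>) nn)" if "\<theta> \<in> \<Theta>" for \<theta>
      by (rule minvertible[OF that])
    fix \<theta> i j assume \<theta>: "\<theta> \<in> \<Theta>"
    interpret prob_space "P \<theta>" by (rule prob_P[OF \<theta>])
    show "(\<lambda>x. nn x $ i $ j) \<in> L2 (P \<theta>)"
      using h[OF \<theta>] Eb[OF \<theta>] Ep[OF \<theta>] M[OF \<theta>]
      by (cases i; cases "the i"; cases j; cases "the j") (auto simp: nn_def e_def f_def L2_const)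
  qed
  let ?K = "MM.inverse_kernel \<kappa> None (Some None)"
  have kernels: "hoif_kernels P \<Theta> \<phi> m ?K"
    by (rule MM.hoif_kernels_inverse) (simp add: \<phi> minv e_def f_def)
  let ?N = "mean_matrix (P ?\<theta>\<^sub>0) nn" and ?G = "gram (P ?\<theta>\<^sub>0) S z" and ?h\<^sub>0 = "\<integral>y. h y \<partial>P ?\<theta>\<^sub>0"
  \<comment> \<open>The specific law enters here: \<open>b\<^sub>0\<close> and
    \<open>p\<^sub>0\<close> are its own nuisances, so both first-order conditions apply.\<close>
  have e0: "(\<integral>y. e y \<partial>P ?\<theta>\<^sub>0) = 0" and f0: "(\<integral>y. f y \<partial>P ?\<theta>\<^sub>0) = 0"
    using Ecal_mean_zero[OF \<theta>\<^sub>0 z[OF \<theta>\<^sub>0]] int(1,2)[OF \<theta>\<^sub>0]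
    by (simp_all add: vec_eq_iff integral_vec_component e_def f_def Ecal_vec_def)
  have N0: "nn y - ?N = bordered 0 (e y) (h y - ?h\<^sub>0) (Szz S z y - ?G) (f y)" for y
    unfolding mean[OF \<theta>\<^sub>0] nn_def by (simp add: bordered_diff e0 f0)
  have inv0: "matrix_inv ?N = bordered 1 0 (- ?h\<^sub>0) (matrix_inv ?G) 0"
    unfolding minv[OF \<theta>\<^sub>0] e0 f0 by simp
  have K1: "?K 1 ?\<theta>\<^sub>0 v = - \<kappa> * (h (v 1) - ?h\<^sub>0)" for v
    by (simp add: MM.inverse_kernel_def chain_kernel_def inv0 N0 bordered_mult)
  have Kj: "?K j ?\<theta>\<^sub>0 v = \<kappa> * sym_kernel j (IFjj_kernel S m1 m2 b\<^sub>0 p\<^sub>0 z ?G j) v" if "2 \<le> j" for j v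
  proof -
    \<comment> \<open>This ordering puts observation 1 at the left end and observation 2 at the
      right end, as in \<open>IFjj_kernel\<close>; after symmetrization any ordering of
      \<open>{1..j}\<close> may represent the kernel. The sign built into \<open>IFjj_kernel\<close>
      cancels the one in \<open>inverse_kernel\<close>.\<close>
    let ?ys = "1 # [3..<Suc j] @ [2]"
    have ys: "distinct ?ys" "set ?ys = {1..j}"
      using that by auto
    have ck: "chain_kernel nn ?N None (Some None) ?ys v = (-1) ^ j * IFjj_kernel S m1 m2 b\<^sub>0 p\<^sub>0 z ?G j v" for v
      unfolding chain_kernel_def inv0 N0 chain_bordered_corner IFjj_kernel_def
      by (simp add: e_def f_def matrix_vector_mul_assoc flip: power_mult_distrib mult.assoc)
    have "?K j ?\<theta>\<^sub>0 v = \<kappa> * (-1) ^ j * sym_kernel j (chain_kernel nn ?N None (Some None) ?ys) v"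
      unfolding MM.inverse_kernel_def sum_permutes_permutations_of_set[OF ys, symmetric]
      using ys by (subst sym_kernel_chain_kernel) auto
    also have "sym_kernel j (chain_kernel nn ?N None (Some None) ?ys) v
        = (-1) ^ j * sym_kernel j (IFjj_kernel S m1 m2 b\<^sub>0 p\<^sub>0 z ?G j) v"
      unfolding sym_kernel_def ck by (simp add: sum_distrib_left)
    finally show ?thesis
      by (simp flip: power_mult_distrib mult.assoc)
  qed
  have "U \<omega> = (\<Sum>j=1..m. ustat n j (?K j ?\<theta>\<^sub>0) \<omega>)" for \<omega>
  proof -
    have "(\<Sum>j=1..m. ustat n j (?K j ?\<theta>\<^sub>0) \<omega>)
        = ustat n 1 (?K 1 ?\<theta>\<^sub>0) \<omega> + (\<Sum>j=2..m. ustat n j (?K j ?\<theta>\<^sub>0) \<omega>)"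
      using sum.atLeast_Suc_atMost[of 1 m "\<lambda>j. ustat n j (?K j ?\<theta>\<^sub>0) \<omega>"] \<open>1 \<le> m\<close>
      by (simp add: numeral_2_eq_2)
    also have "ustat n 1 (?K 1 ?\<theta>\<^sub>0) \<omega> = - \<kappa> * ((\<Sum>i=1..n. h (\<omega> i) - ?h\<^sub>0) / real n)"
      unfolding ustat_1[OF \<open>1 \<le> n\<close>] K1 by (simp add: sum_distrib_left sum_negf)
    also have "(\<Sum>j=2..m. ustat n j (?K j ?\<theta>\<^sub>0) \<omega>) = \<kappa> * IF22mm S m1 m2 b\<^sub>0 p\<^sub>0 z ?G n m \<omega>"
      unfolding IF22mm_def sum_distrib_left
    proof (rule sum.cong)
      fix j assume j: "j \<in> {2..m}"
      then have "?K j ?\<theta>\<^sub>0 = (\<lambda>v. \<kappa> * sym_kernel j (IFjj_kernel S m1 m2 b\<^sub>0 p\<^sub>0 z ?G j) v)"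
        by (intro ext Kj) simp
      then show "ustat n j (?K j ?\<theta>\<^sub>0) \<omega> = \<kappa> * ustat n j (IFjj_kernel S m1 m2 b\<^sub>0 p\<^sub>0 z ?G j) \<omega>"
        by (simp only: ustat_cmult ustat_sym_kernel)
    qed simp
    finally show ?thesis
      by (simp add: U right_diff_distrib)
  qed
  with kernels show ?thesis
    unfolding higher_order_influence_function_def by blast
qed

end

theorem theoremA2:
  fixes MW :: "'w measure" and MX :: "'x measure"
    and P :: "('x, 'c) param \<Rightarrow> ('w \<times> 'x) measure"
    and B :: "('x \<Rightarrow> real) set" and PP :: "('x \<Rightarrow> real) set" and T :: "'c set"
    and \<psi> :: "('x, 'c) param \<Rightarrow> real"
    and IF1 :: "('x, 'c) param \<Rightarrow> 'w \<times> 'x \<Rightarrow> real"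
    and S :: "'w \<times> 'x \<Rightarrow> real"
    and lam :: "('x, 'c) param \<Rightarrow> 'x \<Rightarrow> real"
    and Hb :: "('x \<Rightarrow> real) set" and Hp :: "('x \<Rightarrow> real) set"
    and m1 :: "'w \<times> 'x \<Rightarrow> ('x \<Rightarrow> real) \<Rightarrow> real"
    and m2 :: "'w \<times> 'x \<Rightarrow> ('x \<Rightarrow> real) \<Rightarrow> real"
    and S0 :: "'w \<times> 'x \<Rightarrow> real"
    and b\<^sub>0 :: "'x \<Rightarrow> real" and p\<^sub>0 :: "'x \<Rightarrow> real" and c\<^sub>0 :: 'c
    and z :: "'x \<Rightarrow> real ^ 'k"
    and n m :: nat
  assumes dr: "linear_dr_functional MW MX P B PP T \<psi> IF1 S lam Hb Hp m1 m2 S0"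
    and theta0: "(b\<^sub>0, p\<^sub>0, c\<^sub>0) \<in> B \<times> PP \<times> T"
    and z_L2: "\<And>\<theta> i. \<theta> \<in> B \<times> PP \<times> T \<Longrightarrow> (\<lambda>x. z x $ i) \<in> L2 (marginal MX (P \<theta>))"
    and gram_invertible: "\<And>\<theta>. \<theta> \<in> B \<times> PP \<times> T \<Longrightarrow> invertible (gram (P \<theta>) S z)"
    and finite_variance_H:
      "\<And>\<theta>. \<theta> \<in> B \<times> PP \<times> T \<Longrightarrow> Hstat S m1 m2 S0 b\<^sub>0 p\<^sub>0 \<in> L2 (P \<theta>)"
    and finite_variance_b:
      "\<And>\<theta> i. \<theta> \<in> B \<times> PP \<times> T \<Longrightarrow> (\<lambda>y. Ecal_vec S b\<^sub>0 m2 z y $ i) \<in> L2 (P \<theta>)"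
    and finite_variance_p:
      "\<And>\<theta> i. \<theta> \<in> B \<times> PP \<times> T \<Longrightarrow> (\<lambda>y. Ecal_vec S p\<^sub>0 m1 z y $ i) \<in> L2 (P \<theta>)"
    and finite_variance_Szz:
      "\<And>\<theta> i j. \<theta> \<in> B \<times> PP \<times> T \<Longrightarrow> (\<lambda>y. Szz S z y $ i $ j) \<in> L2 (P \<theta>)"
    and m: "2 \<le> m" "m \<le> n"
  shows
    "higher_order_influence_function P (B \<times> PP \<times> T) n
       (\<lambda>\<theta>. psi_trunc S m1 m2 S0 b\<^sub>0 p\<^sub>0 z (P \<theta>)) m (b\<^sub>0, p\<^sub>0, c\<^sub>0)
       (\<lambda>\<omega>. IF1_hat S m1 m2 S0 b\<^sub>0 p\<^sub>0 (\<psi> (b\<^sub>0, p\<^sub>0, c\<^sub>0)) n \<omega>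
          - IF22mm S m1 m2 b\<^sub>0 p\<^sub>0 z (gram (P (b\<^sub>0, p\<^sub>0, c\<^sub>0)) S z) n m \<omega>)
     \<and> higher_order_influence_function P (B \<times> PP \<times> T) n
       (\<lambda>\<theta>. trunc_bias S m1 m2 S0 b\<^sub>0 p\<^sub>0 z n (P \<theta>)) m (b\<^sub>0, p\<^sub>0, c\<^sub>0)
       (IF22mm S m1 m2 b\<^sub>0 p\<^sub>0 z (gram (P (b\<^sub>0, p\<^sub>0, c\<^sub>0)) S z) n m)"
proof -
  interpret linear_dr_functional MW MX P B PP T \<psi> IF1 S lam Hb Hp m1 m2 S0 by (rule dr)
  let ?\<theta>\<^sub>0 = "(b\<^sub>0, p\<^sub>0, c\<^sub>0)" and ?H = "Hstat S m1 m2 S0 b\<^sub>0 p\<^sub>0"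
  have nuisance: "b\<^sub>0 \<in> B" "p\<^sub>0 \<in> PP" using theta0 by auto
  have psi: "psi_trunc S m1 m2 S0 b\<^sub>0 p\<^sub>0 z (P \<theta>) = (\<integral>y. ?H y \<partial>P \<theta>)
      - (\<integral>y. Ecal_vec S b\<^sub>0 m2 z y \<partial>P \<theta>) \<bullet> (matrix_inv (gram (P \<theta>) S z) *v (\<integral>y. Ecal_vec S p\<^sub>0 m1 z y \<partial>P \<theta>))"
    and H: "integrable (P \<theta>) ?H" if \<theta>: "\<theta> \<in> \<Theta>" for \<theta>
  proof -
    note L2_int = prob_space.L2_integrable[OF prob_P[OF \<theta>]]
    show "integrable (P \<theta>) ?H"
      by (rule L2_int[OF finite_variance_H[OF \<theta>]])
    show "psi_trunc S m1 m2 S0 b\<^sub>0 p\<^sub>0 z (P \<theta>) = (\<integral>y. ?H y \<partial>P \<theta>)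
      - (\<integral>y. Ecal_vec S b\<^sub>0 m2 z y \<partial>P \<theta>) \<bullet> (matrix_inv (gram (P \<theta>) S z) *v (\<integral>y. Ecal_vec S p\<^sub>0 m1 z y \<partial>P \<theta>))"
      using nuisance
      by (intro psi_trunc_eq \<theta> z_L2 gram_invertible nuisance_in_L2 L2_int finite_variance_H
          finite_variance_b finite_variance_p finite_variance_Szz) auto
  qed
  \<comment> \<open>\<open>IF1_hat\<close> centres at \<open>\<psi>\<close>, the recursion at the
    mean of H; at the initial law the two agree.\<close>
  have mean_H: "(\<integral>y. ?H y \<partial>P ?\<theta>\<^sub>0) = \<psi> ?\<theta>\<^sub>0"
    by (rule Hstat_mean(2)[OF theta0 nuisance]) simp
  have bias: "trunc_bias S m1 m2 S0 b\<^sub>0 p\<^sub>0 z n (P \<theta>)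
      = (\<integral>y. ?H y \<partial>P \<theta>) - psi_trunc S m1 m2 S0 b\<^sub>0 p\<^sub>0 z (P \<theta>)" if "\<theta> \<in> \<Theta>" for \<theta>
    using m by (intro trunc_bias_eq that H) simp
  note bordered = higher_order_influence_function_bordered[OF theta0 z_L2 gram_invertible _
      finite_variance_b finite_variance_p finite_variance_Szz]
  show ?thesis
  proof
    \<comment> \<open>The parameter is minus the corner entry with H in the corner, hence
      \<open>\<kappa> = -1\<close>.\<close>
    show "higher_order_influence_function P \<Theta> n (\<lambda>\<theta>. psi_trunc S m1 m2 S0 b\<^sub>0 p\<^sub>0 z (P \<theta>)) m ?\<theta>\<^sub>0
       (\<lambda>\<omega>. IF1_hat S m1 m2 S0 b\<^sub>0 p\<^sub>0 (\<psi> ?\<theta>\<^sub>0) n \<omega>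
          - IF22mm S m1 m2 b\<^sub>0 p\<^sub>0 z (gram (P ?\<theta>\<^sub>0) S z) n m \<omega>)"
      using m by (intro bordered[where h = ?H and \<kappa> = "-1"] finite_variance_H)
        (simp_all add: psi mean_H IF1_hat_def)
    \<comment> \<open>In the bias the mean of H cancels, so the corner statistic is 0 and the term
      of order one vanishes.\<close>
    show "higher_order_influence_function P \<Theta> n (\<lambda>\<theta>. trunc_bias S m1 m2 S0 b\<^sub>0 p\<^sub>0 z n (P \<theta>)) m ?\<theta>\<^sub>0
       (IF22mm S m1 m2 b\<^sub>0 p\<^sub>0 z (gram (P ?\<theta>\<^sub>0) S z) n m)"
      using m by (intro bordered[where h = "\<lambda>_. 0" and \<kappa> = 1] L2_zero)
        (simp_all add: bias psi)
  qed
qed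

end
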